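(* Let $\Omega=[0,1)$, let $\mathrm{BI}$ be the set of simple binary intervals $J_{nk}=[k/2^n,(k+1)/2^n)$ ($n\in\mathbb N$, $0\le k<2^n$), let $\mathcal R$ be the set of finite unions of intervals from $\mathrm{BI}$ with its canonical numbering $\alpha$, so that $\mathcal S=(\Omega,\sigma(\mathcal R),\mathcal R,\alpha)$ is a computable measurable space. Let $\lambda_0$ be Lebesgue measure restricted to $[0,1)$. Let $\mathrm{RN}_0$ be the operator mapping every measure $\mu$ on $\sigma(\mathcal R)$ with $\mu(\Omega)=1/2$ and $\mu\le\lambda_0$ to the $h\in L^1(\lambda_0)$ such that $\mu(E)=\int_E h\,\mathrm d\lambda_0$ for all $E\in\mathcal R$, where $\mu$ is represented by $\delta_{\mathcal M,<\infty}$ and $h$ by $\delta_{\lambda_0}$. Then $\mathrm{EC}\leq_{sW}\mathrm{RN}_0$.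
   Context: All names are infinite sequences over a fixed finite alphabet $\Sigma\supseteq\{0,1\}$; computability of partial functions on $\Sigma^{\mathbb N}$ is Type-2 (Turing machine) computability. A representation of a set $M$ is a surjective partial map $\delta:\subseteq\Sigma^{\mathbb N}\to M$; a realizer of $f$ between represented sets $(M_1,\delta_1),(M_2,\delta_2)$ is a partial $F$ on names with $f(\delta_1(y))=\delta_2(F(y))$ whenever $\delta_1(y)\in\mathrm{dom}(f)$. $f\leq_{sW} g$ means: there are computable partial functions $K,H$ on names such that $K\circ G\circ H$ is a realizer of $f$ for every realizer $G$ of $g$. A computable measurable space $(\Omega,\mathcal A,\mathcal R,\alpha)$: $\mathcal R$ a countable ring of subsets of $\Omega$ with $\bigcup\mathcal R=\Omega$, $\mathcal A=\sigma(\mathcal R)$, $\alpha:\mathbb N\to\mathcal R$ a surjective numbering w.r.t. which $\cup,\cap,\setminus$ are computable. $\delta_{\mathcal M}(p)=\mu$ iff $p$ encodes a list of all $(u,n,v)\in\mathbb Q\times\mathbb N\times\mathbb Q$ with $u<\mu(\alpha(n))<v$; $\delta_{\mathcal M,<\infty}(p)=\mu$ iff $p=\langle p_1,p_2\rangle$ with $\delta_{\mathcal M}(p_1)=\mu$ and $p_2$ encodes a list of all $(u,v)\in\mathbb Q^2$ with $u<\mu(\Omega)<v$. A rational step function is a finite sum $\sum_k a_k\chi_{E_k}$ with $a_k\in\mathbb Q$, $E_k\in\mathcal R$. $\delta_{\lambda_0}(p)=f\in L^1(\lambda_0)$ iff $p$ encodes a sequence $(s_i)_i$ of rational step functions with $\int|s_i-f|\,\mathrm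 d\lambda_0\le2^{-i}$ for all $i$. $\mu\le\lambda_0$ means $\mu(E)\le\lambda_0(E)$ for all measurable $E$. $\mathrm{EC}$ is the identity map from $(2^{\mathbb N},\mathrm{En})$ to $(2^{\mathbb N},\mathrm{Cf})$, where $\mathrm{dom}(\mathrm{En})=\{0^{n_0}10^{n_1}1\cdots\mid n_i\in\mathbb N,\ (n_i=n_j\neq0\Rightarrow i=j)\}$, $\mathrm{En}(p)=\{n\mid 10^{n+1}1\text{ is a subword of }p\}$, $\mathrm{Cf}(p)=\{n\mid p_n=1\}$. *)

theory Defs
  imports "HOL-Analysis.Analysis"
begin

section \<open>Type-2 Turing machines\<close>

text \<open>
  The alphabet is an arbitrary type of sort \<open>{finite, zero_neq_one}\<close>: finitely many symbols, two of
  which are the distinct symbols \<open>0\<close> and \<open>1\<close>.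
\<close>

type_synonym 's name = "nat \<Rightarrow> 's"

text \<open>
  A machine is a flowchart, written as a list of statements: a one-way read-only input tape, a
  one-way write-only output tape, and work tapes addressed by natural numbers. Work symbols are
  natural numbers, with \<open>0\<close> as the blank. A program is a finite list, so it uses only finitely many
  work tapes and work symbols. Control passes to the next statement unless a jump is taken (jump
  targets are absolute positions); the machine halts when control leaves the list.
\<close>

datatype 's instr =
    Input_Right
  | If_Input 's nat            \<comment> \<open>jump if the scanned input symbol is the given one\<close>
  | Output 's
  | Work_Left nat
  | Work_Right nat
  | Work_Write nat nat         \<comment> \<open>tape, symbol\<close>
  | If_Work nat nat nat        \<comment> \<open>tape, symbol, jump target\<close>
  | Goto nat

type_synonym 's program = "'s instr list"

record 's conf =
  pc :: nat
  inp :: nat                   \<comment> \<open>input head position\<close>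
  head :: "nat \<Rightarrow> int"
  tape :: "nat \<Rightarrow> int \<Rightarrow> nat"
  out :: "'s list"

definition init_conf :: "'s conf" where
  "init_conf = \<lparr>pc = 0, inp = 0, head = (\<lambda>_. 0), tape = (\<lambda>_ _. 0), out = []\<rparr>"

fun exec :: "'s name \<Rightarrow> 's instr \<Rightarrow> 's conf \<Rightarrow> 's conf" where
  "exec p Input_Right c = c\<lparr>pc := pc c + 1, inp := inp c + 1\<rparr>"
| "exec p (If_Input s l) c = c\<lparr>pc := if p (inp c) = s then l else pc c + 1\<rparr>"
| "exec p (Output s) c = c\<lparr>pc := pc c + 1, out := out c @ [s]\<rparr>"
| "exec p (Work_Left i) c = c\<lparr>pc := pc c + 1, head := (head c)(i := head c i - 1)\<rparr>"
| "exec p (Work_Right i) c = c\<lparr>pc := pc c + 1, head := (head c)(i := head c i + 1)\<rparr>"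
| "exec p (Work_Write i x) c =
     c\<lparr>pc := pc c + 1, tape := (tape c)(i := (tape c i)(head c i := x))\<rparr>"
| "exec p (If_Work i x l) c =
     c\<lparr>pc := if tape c i (head c i) = x then l else pc c + 1\<rparr>"
| "exec p (Goto l) c = c\<lparr>pc := l\<rparr>"

definition step :: "'s program \<Rightarrow> 's name \<Rightarrow> 's conf \<Rightarrow> 's conf" where
  "step P p c = (if pc c < length P then exec p (P ! pc c) c else c)"

definition run :: "'s program \<Rightarrow> 's name \<Rightarrow> nat \<Rightarrow> 's conf" where
  "run P p t = (step P p ^^ t) init_conf"

definition produces :: "'s program \<Rightarrow> 's name \<Rightarrow> 's name \<Rightarrow> bool" where
  "produces P p q \<longleftrightarrow> (\<forall>n. \<exists>t. n < length (out (run P p t)) \<and> out (run P p t) ! n = q n)"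

definition partial_of :: "('a \<Rightarrow> 'b \<Rightarrow> bool) \<Rightarrow> 'a \<rightharpoonup> 'b" where
  "partial_of R x = (if \<exists>y. R x y then Some (THE y. R x y) else None)"

text \<open>
  A machine computes exactly the partial function that is defined on those inputs on which
  infinitely many output symbols are written.
\<close>

definition type2_computable :: "('s name \<rightharpoonup> 's name) \<Rightarrow> bool" where
  "type2_computable F \<longleftrightarrow> (\<exists>P. F = partial_of (produces P))"


section \<open>Strong Weihrauch reducibility\<close>

definition is_representation :: "('s name \<rightharpoonup> 'm) \<Rightarrow> 'm set \<Rightarrow> bool" where
  "is_representation \<delta> M \<longleftrightarrow> ran \<delta> = M"

definition realizer ::
    "('s name \<rightharpoonup> 'a) \<Rightarrow> ('s name \<rightharpoonup> 'b) \<Rightarrow> ('a \<rightharpoonup> 'b) \<Rightarrow> ('s name \<rightharpoonup> 's name) \<Rightarrow> bool" where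
  "realizer \<delta>1 \<delta>2 f F \<longleftrightarrow>
     (\<forall>y x z. \<delta>1 y = Some x \<longrightarrow> f x = Some z \<longrightarrow> (\<exists>q. F y = Some q \<and> \<delta>2 q = Some z))"

definition sW_reducible ::
    "('s name \<rightharpoonup> 'a) \<Rightarrow> ('s name \<rightharpoonup> 'b) \<Rightarrow> ('a \<rightharpoonup> 'b) \<Rightarrow>
     ('s name \<rightharpoonup> 'c) \<Rightarrow> ('s name \<rightharpoonup> 'd) \<Rightarrow> ('c \<rightharpoonup> 'd) \<Rightarrow> bool" where
  "sW_reducible \<delta>1 \<delta>2 f \<gamma>1 \<gamma>2 g \<longleftrightarrow>
     (\<exists>K H. type2_computable K \<and> type2_computable H \<and>
        (\<forall>G. realizer \<gamma>1 \<gamma>2 g G \<longrightarrow> realizer \<delta>1 \<delta>2 f (K \<circ>\<^sub>m G \<circ>\<^sub>m H)))"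


section \<open>Names of sequences and the problem EC\<close>

text \<open>
  \<open>seq_name a\<close> is the name \<open>0^(a 0) 1 0^(a 1) 1 0^(a 2) 1 ...\<close>; its \<open>i\<close>-th symbol \<open>1\<close> stands at
  position \<open>(a 0 + 1) + ... + (a (i - 1) + 1) + a i\<close>.
\<close>

definition seq_name :: "(nat \<Rightarrow> nat) \<Rightarrow> 's::{finite,zero_neq_one} name" where
  "seq_name a k = (if \<exists>i. k = (\<Sum>j<i. (a j + 1)) + a i then 1 else 0)"

text \<open>
  \<open>En p\<close> consists of the \<open>n\<close> for which \<open>1 0^(n + 1) 1\<close> is a subword of \<open>p\<close>. The first block of zeros is
  not preceded by a \<open>1\<close> and hence does not count.
\<close>

definition En :: "'s::{finite,zero_neq_one} name \<rightharpoonup> nat set" where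
  "En p =
     (if \<exists>a. p = seq_name a \<and> (\<forall>i j. a i = a j \<and> a j \<noteq> 0 \<longrightarrow> i = j)
      then Some {n. \<exists>k. p k = 1 \<and> (\<forall>j\<in>{1..n + 1}. p (k + j) = 0) \<and> p (k + n + 2) = 1}
      else None)"

definition Cf :: "'s::{finite,zero_neq_one} name \<rightharpoonup> nat set" where
  "Cf p = Some {n. p n = 1}"

definition EC :: "nat set \<rightharpoonup> nat set" where
  "EC A = Some A"


section \<open>Representations of measures\<close>

text \<open>
  \<open>lists_all d p S\<close>: the name \<open>p\<close> encodes a list of all elements of \<open>S\<close>, where \<open>d\<close> is the numbering
  of the items. Rational numbers are numbered by \<^const>\<open>nat_to_rat_surj\<close>, pairs by
  \<^const>\<open>prod_decode\<close>.
\<close>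

definition lists_all :: "(nat \<Rightarrow> 'b) \<Rightarrow> 's::{finite,zero_neq_one} name \<Rightarrow> 'b set \<Rightarrow> bool" where
  "lists_all d p S \<longleftrightarrow> (\<exists>a. p = seq_name a \<and> range (\<lambda>i. d (a i)) = S)"

definition rat_pair :: "nat \<Rightarrow> rat \<times> rat" where
  "rat_pair c = (case prod_decode c of (x, y) \<Rightarrow> (nat_to_rat_surj x, nat_to_rat_surj y))"

definition rat_nat_rat :: "nat \<Rightarrow> rat \<times> nat \<times> rat" where
  "rat_nat_rat c =
     (case prod_decode c of (x, r) \<Rightarrow> case prod_decode r of (n, y) \<Rightarrow>
        (nat_to_rat_surj x, n, nat_to_rat_surj y))"

definition strictly_between :: "rat \<Rightarrow> ennreal \<Rightarrow> rat \<Rightarrow> bool" where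
  "strictly_between u m v \<longleftrightarrow>
     ereal (real_of_rat u) < enn2ereal m \<and> enn2ereal m < ereal (real_of_rat v)"

text \<open>
  Measures on \<open>\<sigma>(R)\<close>, where \<open>R\<close> is the range of the numbering \<open>\<alpha>\<close>. They are required to be finite
  on \<open>R\<close>; this is what makes a measure determined by its values on \<open>R\<close>.
\<close>

definition ring_measures :: "'a set \<Rightarrow> (nat \<Rightarrow> 'a set) \<Rightarrow> 'a measure set" where
  "ring_measures \<Omega> \<alpha> =
     {\<mu>. space \<mu> = \<Omega> \<and> sets \<mu> = sigma_sets \<Omega> (range \<alpha>) \<and> (\<forall>n. emeasure \<mu> (\<alpha> n) \<noteq> \<infinity>)}"

definition names_measure ::
    "'a set \<Rightarrow> (nat \<Rightarrow> 'a set) \<Rightarrow> 's::{finite,zero_neq_one} name \<Rightarrow> 'a measure \<Rightarrow> bool" where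
  "names_measure \<Omega> \<alpha> p \<mu> \<longleftrightarrow>
     \<mu> \<in> ring_measures \<Omega> \<alpha> \<and>
     lists_all rat_nat_rat p {(u, n, v). strictly_between u (emeasure \<mu> (\<alpha> n)) v}"

definition delta_M ::
    "'a set \<Rightarrow> (nat \<Rightarrow> 'a set) \<Rightarrow> 's::{finite,zero_neq_one} name \<rightharpoonup> 'a measure" where
  "delta_M \<Omega> \<alpha> = partial_of (names_measure \<Omega> \<alpha>)"

text \<open>
  The pair \<open>\<langle>p1, p2\<rangle>\<close> of two names is their interleaving.
\<close>

definition fst_name :: "'s name \<Rightarrow> 's name" where
  "fst_name p i = p (2 * i)"

definition snd_name :: "'s name \<Rightarrow> 's name" where
  "snd_name p i = p (2 * i + 1)"

definition delta_M_fin ::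
    "'a set \<Rightarrow> (nat \<Rightarrow> 'a set) \<Rightarrow> 's::{finite,zero_neq_one} name \<rightharpoonup> 'a measure" where
  "delta_M_fin \<Omega> \<alpha> p =
     (case delta_M \<Omega> \<alpha> (fst_name p) of
        None \<Rightarrow> None
      | Some \<mu> \<Rightarrow>
          if lists_all rat_pair (snd_name p) {(u, v). strictly_between u (emeasure \<mu> \<Omega>) v}
          then Some \<mu> else None)"


section \<open>The dyadic measurable space on the unit interval\<close>

definition J :: "nat \<Rightarrow> nat \<Rightarrow> real set" where
  "J n k = {real k / 2 ^ n ..< (real k + 1) / 2 ^ n}"

definition BI :: "real set set" where
  "BI = {J n k |n k. k < 2 ^ n}"

definition dyadic_ring :: "real set set" where
  "dyadic_ring = {\<Union>F |F. finite F \<and> F \<subseteq> BI}"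

text \<open>
  \<open>m\<close> is read as the canonical index of a finite set of codes of pairs \<open>(n, k)\<close>; codes with
  \<open>k \<ge> 2^n\<close> are ignored.
\<close>

definition alpha :: "nat \<Rightarrow> real set" where
  "alpha m = \<Union>{J n k |n k. k < 2 ^ n \<and> prod_encode (n, k) \<in> set_decode m}"

definition lambda0 :: "real measure" where
  "lambda0 = restrict_space lborel {0..<1}"


section \<open>The space \<open>L1\<close>\<close>

text \<open>Elements of \<open>L1\<close> are classes of integrable functions modulo equality almost everywhere.\<close>

definition ae_equal :: "'a measure \<Rightarrow> (('a \<Rightarrow> real) \<times> ('a \<Rightarrow> real)) set" where
  "ae_equal M = {(f, g). integrable M f \<and> integrable M g \<and> (AE x in M. f x = g x)}"

definition L1 :: "'a measure \<Rightarrow> ('a \<Rightarrow> real) set set" where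
  "L1 M = {f. integrable M f} // ae_equal M"

text \<open>The code of a rational step function (sum of \<open>a * indicator E\<close>) is that of a list of pairs of codes \<open>(a, E)\<close>.\<close>

definition step_fun :: "(nat \<Rightarrow> 'a set) \<Rightarrow> nat \<Rightarrow> 'a \<Rightarrow> real" where
  "step_fun \<alpha> c x =
     (\<Sum>(a, e) \<leftarrow> map prod_decode (list_decode c).
        real_of_rat (nat_to_rat_surj a) * indicator (\<alpha> e) x)"

definition names_L1 :: "'s::{finite,zero_neq_one} name \<Rightarrow> (real \<Rightarrow> real) set \<Rightarrow> bool" where
  "names_L1 p h \<longleftrightarrow>
     h \<in> L1 lambda0 \<and>
     (\<exists>s. p = seq_name s \<and>
        (\<exists>f\<in>h. \<forall>i. (LINT x|lambda0. \<bar>step_fun alpha (s i) x - f x\<bar>) \<le> 1 / 2 ^ i))"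

definition delta_lambda0 :: "'s::{finite,zero_neq_one} name \<rightharpoonup> (real \<Rightarrow> real) set" where
  "delta_lambda0 = partial_of names_L1"


section \<open>The Radon-Nikodym operator\<close>

definition dom_RN0 :: "real measure set" where
  "dom_RN0 =
     {\<mu>. space \<mu> = {0..<1} \<and> sets \<mu> = sigma_sets {0..<1} dyadic_ring \<and>
         emeasure \<mu> {0..<1} = ennreal (1 / 2) \<and>
         (\<forall>E\<in>sets \<mu>. emeasure \<mu> E \<le> emeasure lambda0 E)}"

definition is_density :: "real measure \<Rightarrow> (real \<Rightarrow> real) set \<Rightarrow> bool" where
  "is_density \<mu> h \<longleftrightarrow>
     h \<in> L1 lambda0 \<and>
     (\<exists>f\<in>h. \<forall>E\<in>dyadic_ring. measure \<mu> E = (LINT x:E|lambda0. f x))"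

definition RN0 :: "real measure \<rightharpoonup> (real \<Rightarrow> real) set" where
  "RN0 \<mu> = (if \<mu> \<in> dom_RN0 then Some (THE h. is_density \<mu> h) else None)"


section \<open>Well-definedness\<close>

text \<open>
  The choices made by \<^const>\<open>partial_of\<close> and \<^const>\<open>RN0\<close> are between unique candidates, and the
  four partial maps naming the sets involved are representations of these sets.
\<close>

lemma seq_name_pos_strict_mono: "strict_mono (\<lambda>i :: nat. (\<Sum>j<i. (a j + 1)) + (a i :: nat))"
  unfolding strict_mono_Suc_iff by simp

lemma strict_mono_range_unique:
  fixes f g :: "nat \<Rightarrow> nat"
  assumes f: "strict_mono f" and g: "strict_mono g" and r: "range f = range g"
  shows "f = g"
proof
  fix i show "f i = g i"
  proof (induction i rule: less_induct)
    case (less i)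
    have *: "g' i \<le> f' i" if f': "strict_mono f'" and g': "strict_mono g'" 
      and r': "range f' = range g'" and l: "\<And>j. j < i \<Longrightarrow> f' j = g' j" for f' g' :: "nat \<Rightarrow> nat"
    proof -
      have "f' i \<in> range g'" using r' by blast
      then obtain j where j: "f' i = g' j" by blast
      have "\<not> j < i" using l[of j] j strict_mono_eq[OF f', of i j] by auto
      then show ?thesis using j g' by (simp add: strict_mono_less_eq)
    qed
    show ?case using *[OF f g r less] *[OF g f r[symmetric] less[symmetric]] by simp
  qed
qed

lemma seq_name_inj: 
  assumes "seq_name a = (seq_name b :: 's::{finite,zero_neq_one} name)"
  shows "a = b"
proof -
  let ?f = "\<lambda>a i. (\<Sum>j<i. (a j + 1)) + (a i :: nat)"
  have ran: "range (?f a) = {k. seq_name a k = (1::'s)}" for a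
    unfolding seq_name_def by auto
  have eq: "?f a = ?f b"
    by (rule strict_mono_range_unique[OF seq_name_pos_strict_mono seq_name_pos_strict_mono])
      (simp only: ran assms)
  then have eq': "?f a i = ?f b i" for i by meson
  show ?thesis
  proof
    fix i show "a i = b i"
    proof (cases i)
      case 0 with eq'[of 0] show ?thesis by simp
    next
      case (Suc k) with eq'[of "Suc k"] eq'[of k] show ?thesis by simp
    qed
  qed
qed

lemma partial_of_eq_Some_iff:
  assumes "\<And>y z. R x y \<Longrightarrow> R x z \<Longrightarrow> y = z"
  shows "partial_of R x = Some y \<longleftrightarrow> R x y"
proof -
  have "(THE z. R x z) = y" if "R x y" for y
    using that assms by blast
  then show ?thesis unfolding partial_of_def using assms by auto
qed

lemma produces_unique: "produces P p q \<Longrightarrow> produces P p q' \<Longrightarrow> q = q'"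
proof
  fix n assume "produces P p q" "produces P p q'"
  have mono: "\<exists>us. out (run P p (t + d)) = out (run P p t) @ us" for t d
  proof (induction d)
    case (Suc d)
    have s: "\<exists>us. out (step P p c) = out c @ us" for c
      unfolding step_def by (cases "P ! pc c") auto
    have r: "run P p (t + Suc d) = step P p (run P p (t + d))"
      by (simp add: run_def)
    from Suc s[of "run P p (t + d)"] show ?case unfolding r by auto
  qed auto
  obtain t t' where t: "n < length (out (run P p t))" "out (run P p t) ! n = q n"
     "n < length (out (run P p t'))" "out (run P p t') ! n = q' n"
    using \<open>produces P p q\<close> \<open>produces P p q'\<close> unfolding produces_def by meson
  show "q n = q' n" 
    using mono[of t "t' - t"] mono[of t' "t - t'"] t
    by (cases "t \<le> t'") (auto simp: nth_append)
qed

lemma range_alpha: "range alpha = dyadic_ring"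
proof (intro set_eqI iffI)
  fix E assume "E \<in> range alpha"
  then obtain m where E: "E = alpha m" by blast
  let ?F = "{J n k |n k. k < 2 ^ n \<and> prod_encode (n, k) \<in> set_decode m}"
  have "?F \<subseteq> (\<lambda>c. case prod_decode c of (n, k) \<Rightarrow> J n k) ` set_decode m"
  proof
    fix X assume "X \<in> ?F"
    then obtain n k where X: "X = J n k" "prod_encode (n, k) \<in> set_decode m" by blast
    show "X \<in> (\<lambda>c. case prod_decode c of (n, k) \<Rightarrow> J n k) ` set_decode m"
      by (rule image_eqI[OF _ X(2)]) (simp add: X(1))
  qed
  then have "finite ?F" using finite_surj finite_set_decode by blast
  moreover have "?F \<subseteq> BI" unfolding BI_def by auto
  ultimately show "E \<in> dyadic_ring" unfolding dyadic_ring_def E alpha_def by blast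
next
  fix E assume "E \<in> dyadic_ring"
  then obtain F where F: "E = \<Union>F" "finite F" "F \<subseteq> BI" unfolding dyadic_ring_def by blast
  from F(2,3) have "\<exists>C. finite C \<and> F = (\<lambda>(n, k). J n k) ` C \<and> C \<subseteq> {(n, k). k < 2 ^ n}"
  proof (induction F)
    case (insert x F)
    then obtain C n k where "finite C" "F = (\<lambda>(n, k). J n k) ` C" "C \<subseteq> {(n, k). k < 2 ^ n}"
      "x = J n k" "k < 2 ^ n" unfolding BI_def by auto
    then show ?case by (intro exI[of _ "insert (n, k) C"]) auto
  qed auto
  then obtain C where C: "finite C" "F = (\<lambda>(n, k). J n k) ` C" "C \<subseteq> {(n, k). k < 2 ^ n}" by blast
  have *: "set_decode (set_encode (prod_encode ` C)) = prod_encode ` C" using C(1) by simp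
  have "{J n k |n k. k < 2 ^ n \<and> prod_encode (n, k) \<in> prod_encode ` C} = (\<lambda>(n, k). J n k) ` C"
    (is "?L = ?R")
  proof
    show "?L \<subseteq> ?R" by (auto simp: inj_image_mem_iff[OF inj_prod_encode])
    show "?R \<subseteq> ?L"
    proof
      fix X assume "X \<in> ?R"
      then obtain n k where "(n, k) \<in> C" "X = J n k" by auto
      with C(3) show "X \<in> ?L" by blast
    qed
  qed
  then have "E = alpha (set_encode (prod_encode ` C))"
    unfolding alpha_def * F(1) C(2) by (rule arg_cong[where f = Union, symmetric])
  then show "E \<in> range alpha" by (rule range_eqI)
qed


lemma mem_J_iff: "x \<in> J n k \<longleftrightarrow> \<lfloor>x * 2 ^ n\<rfloor> = int k"
  unfolding J_def floor_eq_iff by (auto simp: field_simps)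

lemma J_in_unit: "k < 2 ^ n \<Longrightarrow> J n k \<subseteq> {0..<1}"
proof
  fix x assume k: "k < 2 ^ n" and x: "x \<in> J n k"
  have "real k + 1 \<le> 2 ^ n" using k 
    by (metis Suc_leI of_nat_Suc of_nat_le_iff of_nat_numeral of_nat_power add.commute)
  moreover have "real k \<le> x * 2 ^ n" "x * 2 ^ n < real k + 1" using x unfolding J_def by (auto simp: field_simps)
  ultimately have "0 \<le> x * 2 ^ n" "x * 2 ^ n < 1 * 2 ^ n" by linarith+
  moreover have "(0::real) < 2 ^ n" by simp
  ultimately have "0 \<le> x" "x < 1"
    using mult_less_cancel_right_pos[of "2 ^ n" x 1] mult_neg_pos[of x "2 ^ n"] by linarith+
  then show "x \<in> {0..<1}" by simp
qed

lemma J_0: "J 0 0 = {0..<1}"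
  unfolding J_def by simp

lemma ex_J: "x \<in> {0..<1} \<Longrightarrow> \<exists>k<2 ^ n. x \<in> J n k"
proof (intro exI[of _ "nat \<lfloor>x * 2 ^ n\<rfloor>"] conjI)
  assume x: "x \<in> {0..<1}"
  then show "x \<in> J n (nat \<lfloor>x * 2 ^ n\<rfloor>)" unfolding mem_J_iff by simp
  have "x * 2 ^ n < 2 ^ n" using x by simp
  then have "\<lfloor>x * 2 ^ n\<rfloor> < 2 ^ n" by (simp add: floor_less_iff)
  then show "nat \<lfloor>x * 2 ^ n\<rfloor> < 2 ^ n" using x by (simp add: nat_less_iff)
qed

lemma J_nested:
  assumes nm: "n \<le> m" and x: "x \<in> J n k" "x \<in> J m l"
  shows "J m l \<subseteq> J n k"
proof
  have *: "\<lfloor>z * 2 ^ n\<rfloor> = \<lfloor>z * 2 ^ m\<rfloor> div 2 ^ (m - n)" for z :: real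
  proof -
    have "\<lfloor>z * 2 ^ n\<rfloor> = \<lfloor>z * 2 ^ m / real_of_int (2 ^ (m - n))\<rfloor>"
    proof -
      have "(2::real) ^ m = 2 ^ n * 2 ^ (m - n)" using nm by (simp flip: power_add)
      then show ?thesis by simp
    qed
    also have "\<dots> = \<lfloor>z * 2 ^ m\<rfloor> div 2 ^ (m - n)"
      by (rule floor_divide_real_eq_div) simp
    finally show ?thesis .
  qed
  fix y assume "y \<in> J m l"
  then show "y \<in> J n k" using x *[of x] *[of y] unfolding mem_J_iff by simp
qed

lemma BI_Int: 
  assumes "A \<in> BI" "B \<in> BI" shows "A \<inter> B = {} \<or> A \<inter> B \<in> BI"
proof -
  obtain n k m l where *: "A = J n k" "B = J m l" using assms unfolding BI_def by blast
  consider "A \<inter> B = {}" | "A \<subseteq> B" | "B \<subseteq> A"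
    using J_nested[of n m _ k l] J_nested[of m n _ l k] unfolding * by (metis disjoint_iff nat_le_linear)
  then show ?thesis using assms by (metis inf.absorb1 inf.absorb2)
qed

lemma BI_subset_ring: "BI \<subseteq> dyadic_ring"
  unfolding dyadic_ring_def by (auto intro!: exI[of _ "{_}"])

lemma dyadic_ring_empty: "{} \<in> dyadic_ring"
  unfolding dyadic_ring_def by (auto intro!: exI[of _ "{}"])

lemma dyadic_ring_Un: "A \<in> dyadic_ring \<Longrightarrow> B \<in> dyadic_ring \<Longrightarrow> A \<union> B \<in> dyadic_ring"
proof -
  assume "A \<in> dyadic_ring" "B \<in> dyadic_ring"
  then obtain F G where "A = \<Union>F" "finite F" "F \<subseteq> BI" "B = \<Union>G" "finite G" "G \<subseteq> BI"
    unfolding dyadic_ring_def by blast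
  then show ?thesis unfolding dyadic_ring_def by (auto intro!: exI[of _ "F \<union> G"])
qed

lemma dyadic_ring_UN: 
  "finite I \<Longrightarrow> (\<And>i. i \<in> I \<Longrightarrow> A i \<in> dyadic_ring) \<Longrightarrow> (\<Union>i\<in>I. A i) \<in> dyadic_ring"
  by (induction I rule: finite_induct) (auto simp: dyadic_ring_empty dyadic_ring_Un)

lemma dyadic_ring_Int: 
  assumes A: "A \<in> dyadic_ring" and B: "B \<in> dyadic_ring" shows "A \<inter> B \<in> dyadic_ring"
proof -
  from A B obtain F G where *: "A = \<Union>F" "finite F" "F \<subseteq> BI" "B = \<Union>G" "finite G" "G \<subseteq> BI"
    unfolding dyadic_ring_def by blast
  have "(\<Union>(X, Y)\<in>F \<times> G. X \<inter> Y) \<in> dyadic_ring"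
    using * BI_Int BI_subset_ring dyadic_ring_empty
    by (intro dyadic_ring_UN) (auto, metis subset_iff)
  moreover have "(\<Union>(X, Y)\<in>F \<times> G. X \<inter> Y) = A \<inter> B" unfolding * by auto
  ultimately show ?thesis by simp
qed

lemma dyadic_ring_Diff_BI: "A \<in> BI \<Longrightarrow> {0..<1} - A \<in> dyadic_ring"
proof -
  assume "A \<in> BI"
  then obtain n k where A: "A = J n k" "k < 2 ^ n" unfolding BI_def by blast
  have "{0..<1} - A = (\<Union>l\<in>{..<2 ^ n} - {k}. J n l)"
  proof (intro set_eqI iffI)
    fix x assume x: "x \<in> {0..<1} - A"
    then obtain l where "l < 2 ^ n" "x \<in> J n l" using ex_J by blast
    then show "x \<in> (\<Union>l\<in>{..<2 ^ n} - {k}. J n l)" using x unfolding A(1) by auto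
  next
    fix x assume "x \<in> (\<Union>l\<in>{..<2 ^ n} - {k}. J n l)"
    then obtain l where "l < 2 ^ n" "l \<noteq> k" "x \<in> J n l" by auto
    then show "x \<in> {0..<1} - A" using J_in_unit[of l n] unfolding A(1) by (auto simp: mem_J_iff)
  qed
  also have "\<dots> \<in> dyadic_ring"
    using BI_subset_ring by (intro dyadic_ring_UN) (auto simp: BI_def)
  finally show ?thesis .
qed

lemma algebra_dyadic_ring: "algebra {0..<1} dyadic_ring"
  unfolding algebra_iff_Int
proof (intro conjI ballI)
  show "dyadic_ring \<subseteq> Pow {0..<1}"
  proof
    fix A assume "A \<in> dyadic_ring"
    then obtain F where "A = \<Union>F" "F \<subseteq> BI" unfolding dyadic_ring_def by blast
    moreover have "X \<subseteq> {0..<1}" if "X \<in> BI" for X using that J_in_unit unfolding BI_def by blast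
    ultimately show "A \<in> Pow {0..<1}" by blast
  qed
  show "{} \<in> dyadic_ring" by (rule dyadic_ring_empty)
  show "A \<inter> B \<in> dyadic_ring" if "A \<in> dyadic_ring" "B \<in> dyadic_ring" for A B
    using that by (rule dyadic_ring_Int)
  show "{0..<1} - A \<in> dyadic_ring" if "A \<in> dyadic_ring" for A
  proof -
    obtain F where F: "finite F" "F \<subseteq> BI" "A = \<Union>F" using \<open>A \<in> dyadic_ring\<close> unfolding dyadic_ring_def by blast
    from F(1,2) have "{0..<1} - \<Union>F \<in> dyadic_ring"
    proof (induction F)
      case empty
      have "J 0 0 \<in> BI" unfolding BI_def by (intro CollectI exI conjI) auto
      then show ?case using BI_subset_ring J_0 by auto
    next
      case (insert X F)
      have "{0..<1} - \<Union>(insert X F) = ({0..<1} - X) \<inter> ({0..<1} - \<Union>F)" by auto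
      then show ?case using insert dyadic_ring_Int dyadic_ring_Diff_BI by simp
    qed
    then show ?thesis using F by simp
  qed
qed

lemma space_lambda0: "space lambda0 = {0..<1}"
  unfolding lambda0_def by (simp add: space_restrict_space)

lemma sets_lambda0: "sets lambda0 = sigma_sets {0..<1} dyadic_ring"
proof
  interpret R: algebra "{0..<1::real}" dyadic_ring by (rule algebra_dyadic_ring)
  interpret S: sigma_algebra "{0..<1::real}" "sigma_sets {0..<1} dyadic_ring"
    by (rule sigma_algebra_sigma_sets) (use R.space_closed in auto)
  have J: "J n k \<in> sets lambda0" if "k < 2 ^ n" for n k
    using J_in_unit[OF that] unfolding lambda0_def by (subst sets_restrict_space_iff) (auto simp: J_def)
  have "dyadic_ring \<subseteq> sets lambda0"
  proof
    fix A assume "A \<in> dyadic_ring"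
    then obtain F where F: "A = \<Union>F" "finite F" "F \<subseteq> BI" unfolding dyadic_ring_def by blast
    moreover have "F \<subseteq> sets lambda0" using J F unfolding BI_def by blast
    ultimately show "A \<in> sets lambda0" by auto
  qed
  then show "sigma_sets {0..<1} dyadic_ring \<subseteq> sets lambda0"
    using sets.sigma_sets_subset[of dyadic_ring lambda0] by (simp add: space_lambda0)
  have cBI: "countable BI"
  proof -
    have "BI \<subseteq> range (\<lambda>(n, k). J n k)" unfolding BI_def by auto
    then show ?thesis by (rule countable_subset) simp
  qed
  have I: "{0..<1} \<inter> {..<a} \<in> sigma_sets {0..<1} dyadic_ring" for a :: real
  proof -
    have "{0..<1} \<inter> {..<a} = \<Union>{X \<in> BI. X \<subseteq> {..<a}}"
    proof (intro set_eqI iffI)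
      fix x assume x: "x \<in> {0..<1} \<inter> {..<a}"
      then obtain n where n: "(1/2) ^ n < a - x"
        using real_arch_pow_inv[of "a - x" "1/2"] by auto
      obtain k where k: "k < 2 ^ n" "x \<in> J n k" using ex_J[of x n] x by blast
      have "J n k \<subseteq> {..<a}"
      proof
        fix y assume "y \<in> J n k"
        then have "y < (real k + 1) / 2 ^ n" "real k / 2 ^ n \<le> x" using k by (auto simp: J_def)
        then have "y < x + (1/2) ^ n" by (simp add: add_divide_distrib power_one_over)
        then show "y \<in> {..<a}" using n by auto
      qed
      then show "x \<in> \<Union>{X \<in> BI. X \<subseteq> {..<a}}" using k unfolding BI_def by blast
    next
      fix x assume "x \<in> \<Union>{X \<in> BI. X \<subseteq> {..<a}}"
      then show "x \<in> {0..<1} \<inter> {..<a}" using J_in_unit unfolding BI_def by blast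
    qed
    also have "\<dots> \<in> sigma_sets {0..<1} dyadic_ring"
      using BI_subset_ring
      by (intro S.countable_Union countable_subset[OF _ cBI]) (auto intro: sigma_sets.Basic)
    finally show ?thesis .
  qed
  have u: "{0..<1::real} \<in> sigma_sets UNIV (range lessThan)"
  proof -
    have "{0..<1::real} \<in> sets borel" by simp
    then show ?thesis unfolding borel_Iio by (subst (asm) sets_measure_of) auto
  qed
  have "sets lambda0 = (\<inter>) {0..<1} ` sets borel"
    unfolding lambda0_def by (simp add: sets_restrict_space)
  also have "\<dots> = (\<inter>) {0..<1} ` sigma_sets UNIV (range lessThan)"
    unfolding borel_Iio by (subst sets_measure_of) auto
  also have "\<dots> = sigma_sets {0..<1} ((\<inter>) {0..<1} ` range lessThan)"
    by (rule sigma_sets_Int[OF u]) simp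
  also have "\<dots> \<subseteq> sigma_sets {0..<1} dyadic_ring"
    using I by (intro S.sigma_sets_subset) auto
  finally show "sets lambda0 \<subseteq> sigma_sets {0..<1} dyadic_ring" .
qed

lemma finite_measure_lambda0: "finite_measure lambda0"
  by standard (simp add: space_lambda0, simp add: lambda0_def emeasure_restrict_space)

lemma lists_all_unique:
  assumes "lists_all d p S" "lists_all d p T" shows "S = T"
proof -
  obtain a b where *: "p = seq_name a" "range (\<lambda>i. d (a i)) = S" 
    "p = seq_name b" "range (\<lambda>i. d (b i)) = T"
    using assms unfolding lists_all_def by blast
  then have "a = b" using seq_name_inj by metis
  then show ?thesis using * by simp
qed

lemma names_measure_unique:
  assumes int: "Int_stable (range \<alpha>)" and sub: "range \<alpha> \<subseteq> Pow \<Omega>" and cov: "\<Union>(range \<alpha>) = \<Omega>"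
    and m: "names_measure \<Omega> \<alpha> p \<mu>" and n: "names_measure \<Omega> \<alpha> p \<nu>"
  shows "\<mu> = \<nu>"
proof -
  have S: "{(u, n, v). strictly_between u (emeasure \<mu> (\<alpha> n)) v} =
        {(u, n, v). strictly_between u (emeasure \<nu> (\<alpha> n)) v}"
    using lists_all_unique m n unfolding names_measure_def by meson
  have less: "x \<le> y" if fin: "x \<noteq> \<infinity>" "y \<noteq> \<infinity>" 
    and that: "\<And>u v. strictly_between u x v \<Longrightarrow> strictly_between u y v" for x y
  proof (rule ccontr)
    assume "\<not> x \<le> y"
    obtain a b where ab: "x = ennreal a" "y = ennreal b" "0 \<le> a" "0 \<le> b" 
      using fin by (cases x; cases y) (auto simp: infinity_ennreal_def)
    then have "b < a" using \<open>\<not> x \<le> y\<close> by simp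
    obtain u where u: "b < real_of_rat u" "real_of_rat u < a" using of_rat_dense[OF \<open>b < a\<close>] by blast
    obtain v where v: "a < real_of_rat v" using of_rat_dense[of a "a + 1"] by auto
    have "strictly_between u x v" unfolding strictly_between_def using ab u v by simp
    then have "strictly_between u y v" by (rule that)
    then show False unfolding strictly_between_def using ab u by simp
  qed
  have eq: "emeasure \<mu> (\<alpha> n) = emeasure \<nu> (\<alpha> n)" for n
  proof (rule antisym)
    have f: "emeasure \<mu> (\<alpha> n) \<noteq> \<infinity>" "emeasure \<nu> (\<alpha> n) \<noteq> \<infinity>"
      using m n unfolding names_measure_def ring_measures_def by auto
    show "emeasure \<mu> (\<alpha> n) \<le> emeasure \<nu> (\<alpha> n)" using S by (intro less f) blast
    show "emeasure \<nu> (\<alpha> n) \<le> emeasure \<mu> (\<alpha> n)" using S by (intro less f) blast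
  qed
  show ?thesis
    using m n eq 
    by (intro measure_eqI_generator_eq_countable[OF int sub _ _ _ _ cov, of \<mu> \<nu>])
       (auto simp: names_measure_def ring_measures_def)
qed

lemma equiv_ae_equal: "equiv {f. integrable M f} (ae_equal M)"
proof (rule equivI)
  show "ae_equal M \<subseteq> {f. integrable M f} \<times> {f. integrable M f}" unfolding ae_equal_def by auto
  show "refl_on {f. integrable M f} (ae_equal M)" unfolding ae_equal_def by (auto intro!: refl_onI)
  show "sym (ae_equal M)" unfolding ae_equal_def by (intro symI) (auto elim: AE_mp)
  show "trans (ae_equal M)" unfolding ae_equal_def
  proof (rule transI)
    fix f g h
    assume "(f, g) \<in> {(f, g). integrable M f \<and> integrable M g \<and> (AE x in M. f x = g x)}"
      "(g, h) \<in> {(f, g). integrable M f \<and> integrable M g \<and> (AE x in M. f x = g x)}"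
    then have *: "integrable M f" "integrable M h" "AE x in M. f x = g x" "AE x in M. g x = h x" by auto
    from *(3,4) have "AE x in M. f x = h x" by eventually_elim simp
    with * show "(f, h) \<in> {(f, g). integrable M f \<and> integrable M g \<and> (AE x in M. f x = g x)}" by auto
  qed
qed

lemma L1_cases:
  assumes "h \<in> L1 M" obtains f where "f \<in> h" "integrable M f"
  using assms equiv_class_self[OF equiv_ae_equal] unfolding L1_def by (metis mem_Collect_eq quotientE)

lemma L1_mem:
  assumes "h \<in> L1 M" "f \<in> h"
  shows "integrable M f" and "g \<in> h \<longleftrightarrow> integrable M g \<and> (AE x in M. f x = g x)"
proof -
  have sub: "h \<subseteq> {f. integrable M f}"
    using assms(1) in_quotient_imp_subset[OF equiv_ae_equal] unfolding L1_def by blast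
  then show f: "integrable M f" using assms(2) by blast
  have "g \<in> h \<longleftrightarrow> (f, g) \<in> ae_equal M"
    using assms in_quotient_imp_closed[OF equiv_ae_equal] in_quotient_imp_in_rel[OF equiv_ae_equal, of h M f g]
    unfolding L1_def by blast
  then show "g \<in> h \<longleftrightarrow> integrable M g \<and> (AE x in M. f x = g x)"
    using f unfolding ae_equal_def by simp
qed

lemma L1_eqI:
  assumes "h \<in> L1 M" "k \<in> L1 M" "f \<in> h" "g \<in> k" "AE x in M. f x = g x"
  shows "h = k"
proof -
  have "g \<in> h" using L1_mem assms by metis
  then show ?thesis
    using assms quotient_disj[OF equiv_ae_equal] unfolding L1_def by blast
qed

lemma L1_class:
  assumes "integrable M f" obtains h where "h \<in> L1 M" "f \<in> h"
  using assms equiv_class_self[OF equiv_ae_equal, of f M] quotientI[of f "{f. integrable M f}"]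
  unfolding L1_def by blast

lemma alpha_sets: "alpha n \<in> sets lambda0"
  unfolding sets_lambda0 using range_alpha by (blast intro: sigma_sets.Basic)

lemma integrable_step_fun: "integrable lambda0 (step_fun alpha c)"
proof -
  interpret finite_measure lambda0 by (rule finite_measure_lambda0)
  have "integrable lambda0 (\<lambda>x. \<Sum>(a, e) \<leftarrow> cs. real_of_rat (nat_to_rat_surj a) * indicator (alpha e) x)"
    for cs
    by (induction cs) (auto intro!: Bochner_Integration.integrable_add 
        integrable_mult_right integrable_real_indicator alpha_sets simp: less_top[symmetric])
  then show ?thesis unfolding step_fun_def[abs_def] .
qed

lemma L1_dist_zero_imp_AE:
  assumes f: "integrable M f" and g: "integrable M g" and "(LINT x|M. \<bar>f x - g x\<bar>) \<le> (0 :: real)"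
  shows "AE x in M. f x = g x"
proof -
  have i: "integrable M (\<lambda>x. \<bar>f x - g x\<bar>)" using f g by auto
  have "(LINT x|M. \<bar>f x - g x\<bar>) = 0" using assms(3) by (intro antisym) auto
  then have "AE x in M. \<bar>f x - g x\<bar> = 0" using integral_nonneg_eq_0_iff_AE[OF i] by auto
  then show ?thesis by auto
qed

lemma L1_triangle:
  fixes f g h :: "'a \<Rightarrow> real"
  assumes f: "integrable M f" and g: "integrable M g" and h: "integrable M h"
  shows "(LINT x|M. \<bar>f x - h x\<bar>) \<le> (LINT x|M. \<bar>f x - g x\<bar>) + (LINT x|M. \<bar>g x - h x\<bar>)"
proof -
  have "(LINT x|M. \<bar>f x - h x\<bar>) \<le> (LINT x|M. \<bar>f x - g x\<bar> + \<bar>g x - h x\<bar>)"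
    using f g h by (intro integral_mono) auto
  then show ?thesis using f g h by simp
qed

lemma names_L1_unique:
  assumes h: "names_L1 p h" and k: "names_L1 p k" shows "h = k"
proof -
  obtain s f where s: "h \<in> L1 lambda0" "p = seq_name s" "f \<in> h"
    "\<And>i. (LINT x|lambda0. \<bar>step_fun alpha (s i) x - f x\<bar>) \<le> 1 / 2 ^ i"
    using h unfolding names_L1_def by blast
  obtain s' g where s': "k \<in> L1 lambda0" "p = seq_name s'" "g \<in> k"
    "\<And>i. (LINT x|lambda0. \<bar>step_fun alpha (s' i) x - g x\<bar>) \<le> 1 / 2 ^ i"
    using k unfolding names_L1_def by blast
  have ss: "s' = s" using s s' seq_name_inj by metis
  have f: "integrable lambda0 f" and g: "integrable lambda0 g" using L1_mem s s' by metis+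
  have "(LINT x|lambda0. \<bar>f x - g x\<bar>) \<le> 2 * (1/2) ^ i" for i
    using L1_triangle[OF f integrable_step_fun g, of "s i"] s(4)[of i] s'(4)[of i]
    by (simp add: ss abs_minus_commute power_one_over)
  moreover have "(\<lambda>i. 2 * (1/2 :: real) ^ i) \<longlonglongrightarrow> 2 * 0"
    by (intro tendsto_mult_left LIMSEQ_power_zero) simp
  ultimately have "(LINT x|lambda0. \<bar>f x - g x\<bar>) \<le> 2 * 0" by (intro LIMSEQ_le_const[of _ "2 * 0"] exI[of _ 0] allI impI)
  then have "(LINT x|lambda0. \<bar>f x - g x\<bar>) \<le> 0" by simp
  then show ?thesis using L1_dist_zero_imp_AE f g L1_eqI s s' by metis
qed

lemma set_integral_zero_sigma:
  assumes g: "integrable lambda0 g"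
    and z: "\<And>E. E \<in> dyadic_ring \<Longrightarrow> (LINT x:E|lambda0. g x) = (0::real)"
    and E: "E \<in> sets lambda0"
  shows "(LINT x:E|lambda0. g x) = 0"
proof -
  interpret R: algebra "{0..<1::real}" dyadic_ring by (rule algebra_dyadic_ring)
  have int: "set_integrable lambda0 A g" if "A \<in> sets lambda0" for A
    using g that unfolding set_integrable_def by (rule integrable_mult_indicator[rotated])
  have E': "E \<in> sigma_sets {0..<1} dyadic_ring" using E sets_lambda0 by simp
  have "Int_stable dyadic_ring" unfolding Int_stable_def by auto
  then show ?thesis using R.space_closed E'
  proof (induction E rule: sigma_sets_induct_disjoint)
    case (basic A) then show ?case by (rule z)
  next
    case empty show ?case by (simp add: set_lebesgue_integral_def)
  next
    case (compl A)
    have A: "A \<in> sets lambda0" "{0..<1} - A \<in> sets lambda0" 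
      using compl(1) sets.compl_sets[of A lambda0] unfolding space_lambda0 sets_lambda0 by auto
    have "A \<union> ({0..<1} - A) = {0..<1}" using sets.sets_into_space[OF A(1)] space_lambda0 by auto
    then have "(LINT x:{0..<1}|lambda0. g x) = (LINT x:A|lambda0. g x) + (LINT x:{0..<1} - A|lambda0. g x)"
      using set_integral_Un[of A "{0..<1} - A" lambda0 g] int A by simp
    then show ?case using z[of "{0..<1}"] compl by simp
  next
    case (union A)
    have A: "A i \<in> sets lambda0" for i using union(2) unfolding sets_lambda0 by auto
    have "(LINT x:(\<Union>i. A i)|lambda0. g x) = (\<Sum>i. (LINT x:A i|lambda0. g x))"
      using union(1) A by (intro lebesgue_integral_countable_add int) (auto simp: disjoint_family_on_def)
    then show ?case using union by simp
  qed
qed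

lemma is_density_unique:
  assumes "is_density \<mu> h" "is_density \<mu> k" shows "h = k"
proof -
  obtain f where f: "h \<in> L1 lambda0" "f \<in> h" "\<And>E. E \<in> dyadic_ring \<Longrightarrow> measure \<mu> E = (LINT x:E|lambda0. f x)"
    using assms(1) unfolding is_density_def by blast
  obtain g where g: "k \<in> L1 lambda0" "g \<in> k" "\<And>E. E \<in> dyadic_ring \<Longrightarrow> measure \<mu> E = (LINT x:E|lambda0. g x)"
    using assms(2) unfolding is_density_def by blast
  have i: "integrable lambda0 f" "integrable lambda0 g" using L1_mem f g by metis+
  have si: "set_integrable lambda0 A f" "set_integrable lambda0 A g" if "A \<in> sets lambda0" for A
    using integrable_mult_indicator[OF that i(1)] integrable_mult_indicator[OF that i(2)]
    unfolding set_integrable_def by auto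
  have R: "E \<in> sets lambda0" if "E \<in> dyadic_ring" for E
    using that unfolding sets_lambda0 by (rule sigma_sets.Basic)
  have "AE x in lambda0. f x = g x"
  proof (rule density_unique_real[OF i])
    fix A assume A: "A \<in> sets lambda0"
    have "(LINT x:A|lambda0. f x - g x) = 0"
    proof (rule set_integral_zero_sigma[OF _ _ A])
      show "integrable lambda0 (\<lambda>x. f x - g x)" using i by simp
      show "(LINT x:E|lambda0. f x - g x) = 0" if E: "E \<in> dyadic_ring" for E
        using set_integral_diff(2)[OF si(1)[OF R[OF E]] si(2)[OF R[OF E]]] f(3)[OF E] g(3)[OF E] by linarith
    qed
    then show "(LINT x:A|lambda0. f x) = (LINT x:A|lambda0. g x)"
      using set_integral_diff(2)[OF si(1)[OF A] si(2)[OF A]] by linarith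
  qed
  with f(1) g(1) f(2) g(2) show ?thesis by (rule L1_eqI)
qed

lemma is_density_exists:
  assumes "\<mu> \<in> dom_RN0" shows "\<exists>h. is_density \<mu> h"
proof -
  interpret finite_measure lambda0 by (rule finite_measure_lambda0)
  have s: "sets \<mu> = sets lambda0" and sp: "space \<mu> = {0..<1}" 
    and le: "\<And>E. E \<in> sets \<mu> \<Longrightarrow> emeasure \<mu> E \<le> emeasure lambda0 E"
    and e: "emeasure \<mu> {0..<1} = ennreal (1 / 2)"
    using assms sets_lambda0 unfolding dom_RN0_def by auto
  interpret N: finite_measure \<mu> by standard (simp add: sp e)
  have ac: "absolutely_continuous lambda0 \<mu>"
    unfolding absolutely_continuous_def using le s by (auto simp: null_sets_def) (metis le_zero_eq)
  obtain D where D: "D \<in> borel_measurable lambda0" "AE x in lambda0. RN_deriv lambda0 \<mu> x = ennreal (D x)"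
    "\<And>x. 0 \<le> D x" using real_RN_deriv[OF N.finite_measure_axioms ac s] by metis
  have d: "density lambda0 D = \<mu>"
  proof -
    have "density lambda0 D = density lambda0 (RN_deriv lambda0 \<mu>)"
      using D by (intro density_cong) auto
    then show ?thesis using density_RN_deriv[OF ac s] by simp
  qed
  have em: "emeasure \<mu> A = (\<integral>\<^sup>+x\<in>A. D x \<partial>lambda0)" if "A \<in> sets lambda0" for A
    using that D(1) unfolding d[symmetric] by (intro emeasure_density) auto
  have int: "integrable lambda0 D"
  proof (rule integrableI_nonneg)
    have "(\<integral>\<^sup>+x. D x \<partial>lambda0) = emeasure \<mu> (space lambda0)"
      by (subst em) (auto intro!: nn_integral_cong)
    also have "\<dots> < \<infinity>" using N.emeasure_finite[of "space lambda0"] unfolding infinity_ennreal_def by (metis top.not_eq_extremum)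
    finally show "(\<integral>\<^sup>+x. D x \<partial>lambda0) < \<infinity>" .
  qed (use D in auto)
  have m: "measure \<mu> A = (LINT x:A|lambda0. D x)" if "A \<in> sets lambda0" for A
  proof -
    have si: "integrable lambda0 (\<lambda>x. indicator A x * D x)" 
      using integrable_mult_indicator[OF that int] by simp
    have "(\<integral>\<^sup>+x\<in>A. D x \<partial>lambda0) = (\<integral>\<^sup>+x. ennreal (indicator A x * D x) \<partial>lambda0)"
      by (intro nn_integral_cong) (auto split: split_indicator)
    also have "\<dots> = ennreal (LINT x|lambda0. indicator A x * D x)"
      using si D(3) by (intro nn_integral_eq_integral) auto
    finally show ?thesis using em[OF that] D(3)
      unfolding set_lebesgue_integral_def measure_def 
      by (simp add: integral_nonneg)
  qed
  obtain h where h: "h \<in> L1 lambda0" "D \<in> h" using L1_class[OF int] .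
  have "E \<in> sets lambda0" if "E \<in> dyadic_ring" for E
    using that unfolding sets_lambda0 by (rule sigma_sets.Basic)
  then show ?thesis using h m unfolding is_density_def by blast
qed

lemma RN0_eq_Some_iff: "RN0 \<mu> = Some h \<longleftrightarrow> \<mu> \<in> dom_RN0 \<and> is_density \<mu> h"
proof -
  have "(THE h. is_density \<mu> h) = k" if "is_density \<mu> k" for k
  proof (rule the_equality)
    show "is_density \<mu> k" by (rule that)
    show "h = k" if "is_density \<mu> h" for h
      using that \<open>is_density \<mu> k\<close> by (rule is_density_unique)
  qed
  then show ?thesis using is_density_exists[of \<mu>] unfolding RN0_def by (cases "\<mu> \<in> dom_RN0") force+
qed

lemma delta_lambda0_eq_Some_iff: "delta_lambda0 p = Some h \<longleftrightarrow> names_L1 p h"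
  unfolding delta_lambda0_def by (rule partial_of_eq_Some_iff) (rule names_L1_unique)

lemma delta_M_eq_Some_iff: "delta_M {0..<1} alpha p = Some \<mu> \<longleftrightarrow> names_measure {0..<1} alpha p \<mu>"
  unfolding delta_M_def
proof (rule partial_of_eq_Some_iff)
  interpret R: algebra "{0..<1::real}" dyadic_ring by (rule algebra_dyadic_ring)
  show "\<mu> = \<nu>" if "names_measure {0..<1} alpha p \<mu>" "names_measure {0..<1} alpha p \<nu>" for \<mu> \<nu>
  proof (rule names_measure_unique[OF _ _ _ that])
    show "Int_stable (range alpha)" unfolding range_alpha by (rule Int_stableI) (rule dyadic_ring_Int)
    show "range alpha \<subseteq> Pow {0..<1}" unfolding range_alpha by (rule R.space_closed)
    show "\<Union>(range alpha) = {0..<1}"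
      unfolding range_alpha using R.space_closed R.top by blast
  qed
qed

lemma representation_Cf: "is_representation Cf UNIV"
proof -
  have "Cf (\<lambda>n. if n \<in> A then 1 else 0) = Some A" for A unfolding Cf_def by auto
  then show ?thesis unfolding is_representation_def by (auto simp: ran_def)
qed

lemma seq_name_eq_1_iff:
  "seq_name a k = (1 :: 's::{finite,zero_neq_one}) \<longleftrightarrow> (\<exists>i. k = (\<Sum>j<i. (a j + 1)) + a i)"
  unfolding seq_name_def by auto

lemma seq_name_subword_iff:
  "(\<exists>k. seq_name a k = (1 :: 's::{finite,zero_neq_one}) \<and>
        (\<forall>j\<in>{1..n + 1}. seq_name a (k + j) = (0 :: 's)) \<and> seq_name a (k + n + 2) = (1 :: 's))
    \<longleftrightarrow> (\<exists>i. a (Suc i) = n + 1)" (is "?L \<longleftrightarrow> ?R")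
proof
  let ?f = "\<lambda>i. (\<Sum>j<i. (a j + 1)) + a i"
  have mono: "strict_mono ?f" by (rule seq_name_pos_strict_mono)
  have Suc: "?f (Suc i) = ?f i + 1 + a (Suc i)" for i by simp
  have one: "seq_name a k = (1 :: 's) \<longleftrightarrow> (\<exists>i. k = ?f i)" for k by (rule seq_name_eq_1_iff)
  have zero: "seq_name a k = (0 :: 's) \<longleftrightarrow> (\<nexists>i. k = ?f i)" for k unfolding seq_name_def by auto
  { assume ?L
    then obtain k i i' where k: "k = ?f i" "k + n + 2 = ?f i'" and z: "\<And>j. j \<in> {1..n + 1} \<Longrightarrow> \<forall>i. k + j \<noteq> ?f i"
      unfolding one zero by blast
    have "?f i < ?f i'" using k by simp
    then have "i < i'" using strict_mono_less[OF mono] by blast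
    then have le: "?f (Suc i) \<le> ?f i'" using strict_mono_less_eq[OF mono, of "Suc i" i'] by simp
    have "a (Suc i) = n + 1"
    proof (rule ccontr)
      assume "a (Suc i) \<noteq> n + 1"
      then have "1 + a (Suc i) \<in> {1..n + 1}" using le Suc[of i] k by simp
      from z[OF this] have "k + (1 + a (Suc i)) \<noteq> ?f (Suc i)" by blast
      then show False using Suc[of i] k by simp
    qed
    then show ?R by blast }
  { assume ?R
    then obtain i where i: "a (Suc i) = n + 1" by blast
    have "?f i + j \<noteq> ?f l" if j: "j \<in> {1..n + 1}" for j l
    proof
      assume "?f i + j = ?f l"
      then have "?f i < ?f l" "?f l < ?f (Suc i)" using j i Suc[of i] by auto
      then show False using strict_mono_less[OF mono] by (meson not_less_eq)
    qed
    moreover have "?f i + n + 2 = ?f (Suc i)" using i Suc[of i] by simp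
    ultimately show ?L unfolding one zero by blast }
qed

lemma representation_En: "is_representation En UNIV"
proof -
  have "\<exists>p. En p = Some A" for A
  proof -
    define a where "a = case_nat 0 (\<lambda>i. if i \<in> A then i + 1 else 0)"
    have 1: "a i = a j \<and> a j \<noteq> 0 \<longrightarrow> i = j" for i j
      unfolding a_def by (auto split: nat.splits if_splits)
    have 2: "(\<exists>i. a (Suc i) = n + 1) \<longleftrightarrow> n \<in> A" for n
      unfolding a_def by (auto split: if_splits)
    have "En (seq_name a) = Some A"
      unfolding En_def seq_name_subword_iff 2 using 1 by (simp add: exI[of _ a])
    then show ?thesis by blast
  qed
  then show ?thesis unfolding is_representation_def by (auto simp: ran_def)
qed

lemma lists_all_ex:
  assumes "surj d" "S \<noteq> {}"
  shows "\<exists>p :: 's::{finite,zero_neq_one} name. lists_all d p S"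
proof -
  obtain x where x: "x \<in> S" using assms(2) by blast
  define a where "a n = (if d n \<in> S then n else inv d x)" for n
  have "range (\<lambda>i. d (a i)) = S"
  proof
    show "range (\<lambda>i. d (a i)) \<subseteq> S" using x assms(1) by (auto simp: a_def surj_f_inv_f)
    show "S \<subseteq> range (\<lambda>i. d (a i))"
    proof
      fix y assume "y \<in> S"
      then have "y = d (a (inv d y))" using assms(1) by (simp add: a_def surj_f_inv_f)
      then show "y \<in> range (\<lambda>i. d (a i))" by blast
    qed
  qed
  then show ?thesis unfolding lists_all_def by blast
qed

lemma surj_rat_pair: "surj rat_pair"
proof -
  have "\<exists>c. rat_pair c = (u, v)" for u v
  proof -
    obtain x y where "u = nat_to_rat_surj x" "v = nat_to_rat_surj y"
      using surj_nat_to_rat_surj by (metis surjD)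
    then have "rat_pair (prod_encode (x, y)) = (u, v)" by (simp add: rat_pair_def)
    then show ?thesis by blast
  qed
  then show ?thesis unfolding surj_def by (metis surj_pair)
qed

lemma surj_rat_nat_rat: "surj rat_nat_rat"
proof -
  have "\<exists>c. rat_nat_rat c = (u, n, v)" for u n v
  proof -
    obtain x y where "u = nat_to_rat_surj x" "v = nat_to_rat_surj y"
      using surj_nat_to_rat_surj by (metis surjD)
    then have "rat_nat_rat (prod_encode (x, prod_encode (n, y))) = (u, n, v)"
      by (simp add: rat_nat_rat_def)
    then show ?thesis by blast
  qed
  then show ?thesis unfolding surj_def by (metis surj_pair)
qed

lemma strictly_between_ex: "m \<noteq> \<infinity> \<Longrightarrow> \<exists>u v. strictly_between u m v"
proof (cases m)
  case (real r)
  obtain u v where "real_of_rat u < r" "r < real_of_rat v"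
    using of_rat_dense[of "r - 1" r] of_rat_dense[of r "r + 1"] by auto
  then show ?thesis unfolding strictly_between_def using real by (intro exI[of _ u] exI[of _ v]) simp
qed (simp add: infinity_ennreal_def)

lemma representation_delta_M_fin:
  "is_representation (delta_M_fin {0..<1} alpha)
     {\<mu>. space \<mu> = {0..<1} \<and> sets \<mu> = sigma_sets {0..<1} dyadic_ring \<and> emeasure \<mu> {0..<1} \<noteq> \<infinity>}"
  (is "is_representation _ ?S")
proof -
  have "\<exists>n. alpha n = {0..<1}"
    using algebra.top[OF algebra_dyadic_ring] range_alpha by (metis imageE)
  then obtain n0 where n0: "alpha n0 = {0..<1}" by blast
  have "\<mu> \<in> ?S" if "delta_M_fin {0..<1} alpha p = Some \<mu>" for p :: "'a name" and \<mu>
    using that n0 unfolding delta_M_fin_def 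
    by (auto split: option.splits if_splits 
        simp: delta_M_eq_Some_iff names_measure_def ring_measures_def range_alpha) metis
  moreover have "\<exists>p :: 'a name. delta_M_fin {0..<1} alpha p = Some \<mu>" if "\<mu> \<in> ?S" for \<mu>
  proof -
    have fin: "emeasure \<mu> A \<noteq> \<infinity>" for A
      using that emeasure_space[of \<mu> A] by (auto simp: top_unique)
    let ?T = "{(u, n, v). strictly_between u (emeasure \<mu> (alpha n)) v}"
    let ?U = "{(u, v). strictly_between u (emeasure \<mu> {0..<1}) v}"
    have "?T \<noteq> {}" "?U \<noteq> {}" 
      using strictly_between_ex[OF fin, of "alpha 0"] strictly_between_ex[OF fin, of "{0..<1}"] by blast+
    then obtain p q :: "'a name" where pq: "lists_all rat_nat_rat p ?T" "lists_all rat_pair q ?U"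
      using lists_all_ex surj_rat_nat_rat surj_rat_pair by meson
    define r where "r i = (if even i then p (i div 2) else q (i div 2))" for i
    have r: "fst_name r = p" "snd_name r = q"
      unfolding fst_name_def[abs_def] snd_name_def[abs_def] r_def by auto
    have "delta_M {0..<1} alpha p = Some \<mu>"
      unfolding delta_M_eq_Some_iff names_measure_def ring_measures_def 
      using that fin pq by (auto simp: range_alpha)
    then have "delta_M_fin {0..<1} alpha r = Some \<mu>"
      unfolding delta_M_fin_def r using pq by simp
    then show ?thesis by blast
  qed
  ultimately show ?thesis unfolding is_representation_def ran_def by blast
qed

lemma step_fun_append:
  "step_fun \<alpha> (list_encode (list_decode c @ list_decode d)) x = step_fun \<alpha> c x + step_fun \<alpha> d x"
  unfolding step_fun_def by simp

lemma step_fun_scale: "\<exists>d. \<forall>x. step_fun \<alpha> d x = real_of_rat r * step_fun \<alpha> c x"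
proof -
  have "\<exists>ds. \<forall>x. (\<Sum>(a, e) \<leftarrow> map prod_decode ds. real_of_rat (nat_to_rat_surj a) * indicator (\<alpha> e) x) =
       real_of_rat r * (\<Sum>(a, e) \<leftarrow> map prod_decode cs. real_of_rat (nat_to_rat_surj a) * indicator (\<alpha> e) x)"
    for cs
  proof (induction cs)
    case (Cons c cs)
    then obtain ds where ds: "\<forall>x. (\<Sum>(a, e) \<leftarrow> map prod_decode ds. real_of_rat (nat_to_rat_surj a) * indicator (\<alpha> e) x) =
       real_of_rat r * (\<Sum>(a, e) \<leftarrow> map prod_decode cs. real_of_rat (nat_to_rat_surj a) * indicator (\<alpha> e) x)" by blast
    obtain a e where c: "prod_decode c = (a, e)" by fastforce
    obtain b where b: "r * nat_to_rat_surj a = nat_to_rat_surj b" using surj_nat_to_rat_surj by (metis surjD)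
    then have "real_of_rat (nat_to_rat_surj b) = real_of_rat r * real_of_rat (nat_to_rat_surj a)"
      by (metis of_rat_mult)
    then show ?case using ds c
      by (intro exI[of _ "prod_encode (b, e) # ds"]) (auto simp: algebra_simps)
  qed (auto intro: exI[of _ "[]"])
  then show ?thesis unfolding step_fun_def by (metis list_encode_inverse)
qed

definition step_approx :: "(real \<Rightarrow> real) \<Rightarrow> bool" where
  "step_approx f \<longleftrightarrow>
     integrable lambda0 f \<and> (\<forall>e>0. \<exists>c. (LINT x|lambda0. \<bar>step_fun alpha c x - f x\<bar>) < e)"

lemma step_approx_limit:
  assumes f: "integrable lambda0 f"
    and g: "\<And>e. e > 0 \<Longrightarrow> \<exists>g. step_approx g \<and> (LINT x|lambda0. \<bar>g x - f x\<bar>) < e"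
  shows "step_approx f"
  unfolding step_approx_def
proof (intro conjI allI impI f)
  fix e :: real assume e: "e > 0"
  then obtain g where g: "step_approx g" "(LINT x|lambda0. \<bar>g x - f x\<bar>) < e / 2" using g[of "e / 2"] by auto
  then obtain c where c: "(LINT x|lambda0. \<bar>step_fun alpha c x - g x\<bar>) < e / 2"
    using e unfolding step_approx_def by (meson half_gt_zero)
  have "(LINT x|lambda0. \<bar>step_fun alpha c x - f x\<bar>) < e"
    using L1_triangle[OF integrable_step_fun _ f, of g c] c g by (auto simp: step_approx_def)
  then show "\<exists>c. (LINT x|lambda0. \<bar>step_fun alpha c x - f x\<bar>) < e" ..
qed

lemma step_approx_add:
  assumes f: "step_approx f" and g: "step_approx g" shows "step_approx (\<lambda>x. f x + g x)"
  unfolding step_approx_def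
proof (intro conjI allI impI)
  have i: "integrable lambda0 f" "integrable lambda0 g" using f g by (auto simp: step_approx_def)
  then show "integrable lambda0 (\<lambda>x. f x + g x)" by simp
  fix e :: real assume e: "e > 0"
  obtain c d where c: "(LINT x|lambda0. \<bar>step_fun alpha c x - f x\<bar>) < e / 2" 
     and d: "(LINT x|lambda0. \<bar>step_fun alpha d x - g x\<bar>) < e / 2"
    using e f g unfolding step_approx_def by (meson half_gt_zero)
  let ?c = "list_encode (list_decode c @ list_decode d)"
  have "(LINT x|lambda0. \<bar>step_fun alpha ?c x - (f x + g x)\<bar>) \<le>
    (LINT x|lambda0. \<bar>step_fun alpha c x - f x\<bar> + \<bar>step_fun alpha d x - g x\<bar>)"
    using i integrable_step_fun[of c] integrable_step_fun[of d] integrable_step_fun[of ?c]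
    by (intro integral_mono) (auto simp: step_fun_append)
  also have "\<dots> = (LINT x|lambda0. \<bar>step_fun alpha c x - f x\<bar>) + (LINT x|lambda0. \<bar>step_fun alpha d x - g x\<bar>)"
    using i integrable_step_fun[of c] integrable_step_fun[of d] by simp
  finally show "\<exists>c. (LINT x|lambda0. \<bar>step_fun alpha c x - (f x + g x)\<bar>) < e"
    using c d by (intro exI[of _ ?c]) linarith
qed

lemma step_approx_rat:
  assumes f: "step_approx f" shows "step_approx (\<lambda>x. real_of_rat r * f x)"
  unfolding step_approx_def
proof (intro conjI allI impI)
  have i: "integrable lambda0 f" using f by (auto simp: step_approx_def)
  then show "integrable lambda0 (\<lambda>x. real_of_rat r * f x)" by simp
  fix e :: real assume e: "e > 0"
  let ?r = "\<bar>real_of_rat r\<bar> + 1"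
  obtain c where c: "(LINT x|lambda0. \<bar>step_fun alpha c x - f x\<bar>) < e / ?r"
    using f e unfolding step_approx_def by (meson abs_ge_zero add_nonneg_pos divide_pos_pos zero_less_one)
  obtain d where d: "\<And>x. step_fun alpha d x = real_of_rat r * step_fun alpha c x" 
    using step_fun_scale by blast
  have nn: "0 \<le> (LINT x|lambda0. \<bar>step_fun alpha c x - f x\<bar>)" by simp
  have "(LINT x|lambda0. \<bar>step_fun alpha d x - real_of_rat r * f x\<bar>) =
     \<bar>real_of_rat r\<bar> * (LINT x|lambda0. \<bar>step_fun alpha c x - f x\<bar>)"
    by (simp add: d abs_mult flip: right_diff_distrib)
  also have "\<dots> \<le> ?r * (LINT x|lambda0. \<bar>step_fun alpha c x - f x\<bar>)"
    using nn by (simp add: distrib_right)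
  also have "\<dots> < e" using c by (simp add: pos_less_divide_eq mult.commute add_nonneg_pos)
  finally show "\<exists>c. (LINT x|lambda0. \<bar>step_fun alpha c x - real_of_rat r * f x\<bar>) < e" ..
qed

lemma step_approx_scale:
  assumes f: "step_approx f" shows "step_approx (\<lambda>x. c * f x)"
proof (rule step_approx_limit)
  have i: "integrable lambda0 f" using f by (auto simp: step_approx_def)
  then show "integrable lambda0 (\<lambda>x. c * f x)" by simp
  fix e :: real assume e: "e > 0"
  define I where "I = (LINT x|lambda0. \<bar>f x\<bar>)"
  have I: "0 \<le> I" unfolding I_def by simp
  have "c < c + e / (I + 1)" using e I by simp
  then obtain r where r: "c < real_of_rat r" "real_of_rat r < c + e / (I + 1)" using of_rat_dense by blast
  have "(LINT x|lambda0. \<bar>real_of_rat r * f x - c * f x\<bar>) = (real_of_rat r - c) * I"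
    using r unfolding I_def by (simp add: abs_mult flip: left_diff_distrib)
  also have "\<dots> \<le> (real_of_rat r - c) * (I + 1)" using r by (intro mult_left_mono) auto
  also have "\<dots> < e" using r(2) I by (simp add: field_simps)
  finally show "\<exists>g. step_approx g \<and> (LINT x|lambda0. \<bar>g x - c * f x\<bar>) < e"
    using step_approx_rat[OF f] by blast
qed

lemma step_approx_ring: "E \<in> dyadic_ring \<Longrightarrow> step_approx (indicator E)"
proof -
  assume "E \<in> dyadic_ring"
  then obtain n where n: "E = alpha n" using range_alpha by blast
  obtain a where a: "nat_to_rat_surj a = 1" using surj_nat_to_rat_surj by (metis surjD)
  have "step_fun alpha (list_encode [prod_encode (a, n)]) = indicator E"
    unfolding step_fun_def n using a by (auto simp: fun_eq_iff)
  moreover have "step_approx (step_fun alpha c)" for c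
    unfolding step_approx_def by (intro conjI allI impI exI[of _ c] integrable_step_fun) simp
  ultimately show ?thesis by metis
qed

lemma step_approx_dominated:
  fixes s :: "nat \<Rightarrow> real \<Rightarrow> real"
  assumes s: "\<And>i. step_approx (s i)" and f: "integrable lambda0 f" and w: "integrable lambda0 w"
    and lim: "\<And>x. x \<in> space lambda0 \<Longrightarrow> (\<lambda>i. s i x) \<longlonglongrightarrow> f x"
    and bd: "\<And>i x. x \<in> space lambda0 \<Longrightarrow> \<bar>s i x\<bar> \<le> w x"
  shows "step_approx f"
proof (rule step_approx_limit[OF f])
  have [measurable]: "s i \<in> borel_measurable lambda0" "f \<in> borel_measurable lambda0" for i
    using s f by (auto simp: step_approx_def)
  have "(\<lambda>i. LINT x|lambda0. \<bar>s i x - f x\<bar>) \<longlonglongrightarrow> (LINT x|lambda0. 0)"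
  proof (rule integral_dominated_convergence[where w = "\<lambda>x. w x + \<bar>f x\<bar>"])
    show "integrable lambda0 (\<lambda>x. w x + \<bar>f x\<bar>)" using w f by auto
    show "AE x in lambda0. (\<lambda>i. \<bar>s i x - f x\<bar>) \<longlonglongrightarrow> 0"
      using lim by (intro AE_I2 tendsto_rabs_zero) (simp add: LIM_zero_iff)
    show "AE x in lambda0. norm \<bar>s i x - f x\<bar> \<le> w x + \<bar>f x\<bar>" for i
    proof (rule AE_I2)
      fix x assume "x \<in> space lambda0"
      from bd[OF this, of i] show "norm \<bar>s i x - f x\<bar> \<le> w x + \<bar>f x\<bar>" by simp
    qed
  qed auto
  then have l: "(\<lambda>i. LINT x|lambda0. \<bar>s i x - f x\<bar>) \<longlonglongrightarrow> 0" by simp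
  fix e :: real assume "e > 0"
  then have "\<forall>\<^sub>F i in sequentially. (LINT x|lambda0. \<bar>s i x - f x\<bar>) < e"
    using order_tendstoD(2)[OF l] by blast
  then obtain i where "(LINT x|lambda0. \<bar>s i x - f x\<bar>) < e"
    by (auto simp: eventually_sequentially)
  then show "\<exists>g. step_approx g \<and> (LINT x|lambda0. \<bar>g x - f x\<bar>) < e" using s by blast
qed

lemma step_approx_sets:
  assumes E: "E \<in> sets lambda0" shows "step_approx (indicator E)"
proof -
  interpret finite_measure lambda0 by (rule finite_measure_lambda0)
  interpret R: algebra "{0..<1::real}" dyadic_ring by (rule algebra_dyadic_ring)
  have int: "integrable lambda0 (indicator A :: real \<Rightarrow> real)" if "A \<in> sets lambda0" for A
    using that by (intro integrable_real_indicator) (auto simp: less_top[symmetric])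
  have E': "E \<in> sigma_sets {0..<1} dyadic_ring" using E sets_lambda0 by simp
  have "Int_stable dyadic_ring" unfolding Int_stable_def by auto
  then show ?thesis using R.space_closed E'
  proof (induction E rule: sigma_sets_induct_disjoint)
    case (basic A) then show ?case by (rule step_approx_ring)
  next
    case empty show ?case by (rule step_approx_ring) simp
  next
    case (compl A)
    have A: "A \<in> sets lambda0" using compl(1) sets_lambda0 by simp
    have "indicator ({0..<1} - A) = (\<lambda>x. indicator {0..<1} x + (- 1) * indicator A x :: real)"
      using sets.sets_into_space[OF A] space_lambda0 by (auto simp: fun_eq_iff indicator_def)
    then show ?case 
      using step_approx_add[OF step_approx_ring[OF R.top] step_approx_scale[OF compl(2), of "- 1"]]
      by simp
  next
    case (union A)
    have A: "A i \<in> sets lambda0" for i using union(2) unfolding sets_lambda0 by auto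
    have fin: "step_approx (indicator (\<Union>i<n. A i))" for n
    proof (induction n)
      case 0
      have "(\<Union>i<0. A i) = {}" by simp
      then show ?case using step_approx_ring[OF R.empty_sets] by (simp only:)
    next
      case (Suc n)
      have "indicator (\<Union>i<Suc n. A i) = (\<lambda>x. indicator (\<Union>i<n. A i) x + indicator (A n) x :: real)"
      proof
        fix x
        have "A i \<inter> A n = {}" if "i < n" for i
          using union(1) that by (simp add: disjoint_family_on_def)
        then have "x \<notin> A n \<or> x \<notin> (\<Union>i<n. A i)" by blast
        then show "indicator (\<Union>i<Suc n. A i) x = (indicator (\<Union>i<n. A i) x + indicator (A n) x :: real)"
          unfolding lessThan_Suc UN_insert by (simp add: indicator_def)
      qed
      then show ?case using step_approx_add[OF Suc union(3)[of n]] by simp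
    qed
    show ?case
    proof (rule step_approx_dominated[where s = "\<lambda>n. indicator (\<Union>i<n. A i)" and w = "\<lambda>_. 1"])
      show "integrable lambda0 (indicator (\<Union>i. A i) :: real \<Rightarrow> real)" using A by (intro int) auto
      show "(\<lambda>n. indicator (\<Union>i<n. A i) x :: real) \<longlonglongrightarrow> indicator (\<Union>i. A i) x" for x
        by (rule LIMSEQ_indicator_UN)
    qed (auto simp: fin)
  qed
qed

lemma step_approx_integrable:
  assumes "integrable lambda0 f" shows "step_approx f"
  using assms
proof (induction rule: integrable_induct)
  case (base A c)
  then show ?case using step_approx_scale[OF step_approx_sets, of A c] by (simp add: mult.commute)
next
  case (add f g) then show ?case using step_approx_add by blast
next
  case (lim f s)
  show ?case
    using lim by (intro step_approx_dominated[of s f "\<lambda>x. 2 * \<bar>f x\<bar>"]) auto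
qed

lemma representation_delta_lambda0: "is_representation delta_lambda0 (L1 lambda0)"
proof -
  have "\<exists>p. names_L1 (p :: 'a name) h" if h: "h \<in> L1 lambda0" for h
  proof -
    obtain f where f: "f \<in> h" "integrable lambda0 f" using L1_cases[OF h] .
    have "\<exists>c. (LINT x|lambda0. \<bar>step_fun alpha c x - f x\<bar>) \<le> 1 / 2 ^ i" for i :: nat
      using step_approx_integrable[OF f(2)] unfolding step_approx_def by (meson less_imp_le zero_less_divide_1_iff zero_less_numeral zero_less_power)
    then obtain s where "\<And>i. (LINT x|lambda0. \<bar>step_fun alpha (s i) x - f x\<bar>) \<le> 1 / 2 ^ i" by metis
    then show ?thesis unfolding names_L1_def using h f by blast
  qed
  moreover have "h \<in> L1 lambda0" if "names_L1 p h" for p :: "'a name" and h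
    using that unfolding names_L1_def by blast
  ultimately show ?thesis
    unfolding is_representation_def ran_def delta_lambda0_eq_Some_iff by blast
qed
end

theory Submission
  imports Defs
begin

text \<open>
  Let \<open>A\<close> be enumerated by the blocks \<open>b 0, b 1, \<dots>\<close> of a name, where \<open>b j = n + 1\<close> announces \<open>n\<close>. The
  measure \<open>\<mu>\<close> passed to the Radon-Nikodym operator has a density \<open>h\<close> with values in \<open>{0, 1/2, 1}\<close>. On the
  interval \<open>[2^-(n+1), 2^-n)\<close> it is constantly \<open>1/2\<close> if \<open>n \<notin> A\<close>; if \<open>n\<close> is announced in block \<open>j\<close>,
  it oscillates there between \<open>0\<close> and \<open>1\<close> at a dyadic level beyond \<open>j\<close>. As oscillations
  finer than level \<open>L\<close> average out on cells of level \<open>L\<close>, the measures of these cells are dyadic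
  rationals that depend on the first \<open>L\<close> blocks only, so a name of \<open>\<mu>\<close> is computable from the
  enumeration. Conversely, the integral of \<open>\<bar>h - 1/2\<bar>\<close> over \<open>[2^-(n+1), 2^-n)\<close> is \<open>2^-(n+2)\<close> or \<open>0\<close>
  according to whether \<open>n \<in> A\<close>, and a step function within \<open>2^-(n+4)\<close> of \<open>h\<close> tells these cases apart.
\<close>

section \<open>While programs on type-2 machines\<close>

text \<open>The obstacle is that \<open>H\<close> cannot retract: it commits to bounds on the
  measure while later blocks may still announce any number. Replacing the constant 1/2 by an
  oscillation with the same mean changes no mass of a cell coarser than the oscillation, so a
  sufficiently fine one respects all commitments made so far. The masses see only weak limits of
  densities, whereas a name of \<open>h\<close> controls the norm of L1; this gap is what the
  operator has to bridge. The values 0, 1/2 and 1 keep the density between 0 and 1, which bounds the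
  measure by \<open>lambda0\<close>, and their balance around 1/2 keeps the total mass at exactly
  1/2. In a strong reduction \<open>K\<close> sees the name of \<open>h\<close> but not the
  enumeration, so it cannot know in which block a number was announced. It must therefore decode a
  quantity that is the same for all frequencies; the distance from 1/2 has this property. All masses
  involved are rationals given by finite sums over cells. Hence every decision reduces to exact
  integer arithmetic and bounded loops, and iteration of a given number of rounds suffices as
  programming principle.\<close>

datatype cmd =
    Inc nat
  | Dec nat
  | Seq cmd cmd  (infixr \<open>;;\<close> 60)
  | Cond nat cmd cmd
  | While nat cmd

inductive big :: "cmd \<Rightarrow> (nat \<Rightarrow> nat) \<Rightarrow> (nat \<Rightarrow> nat) \<Rightarrow> bool" where
  Inc: "big (Inc r) \<sigma> (\<sigma>(r := Suc (\<sigma> r)))"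
| Dec: "big (Dec r) \<sigma> (\<sigma>(r := \<sigma> r - 1))"
| Seq: "big c \<sigma> \<sigma>' \<Longrightarrow> big d \<sigma>' \<sigma>'' \<Longrightarrow> big (c ;; d) \<sigma> \<sigma>''"
| Cond_pos: "\<sigma> r > 0 \<Longrightarrow> big c \<sigma> \<sigma>' \<Longrightarrow> big (Cond r c d) \<sigma> \<sigma>'"
| Cond_zero: "\<sigma> r = 0 \<Longrightarrow> big d \<sigma> \<sigma>' \<Longrightarrow> big (Cond r c d) \<sigma> \<sigma>'"
| While_zero: "\<sigma> r = 0 \<Longrightarrow> big (While r c) \<sigma> \<sigma>"
| While_pos: "\<sigma> r > 0 \<Longrightarrow> big c \<sigma> \<sigma>' \<Longrightarrow> big (While r c) \<sigma>' \<sigma>'' \<Longrightarrow> big (While r c) \<sigma> \<sigma>''"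

text \<open>Jump targets are absolute, so the code depends on the address \<open>k\<close> at which
  it is placed. \<open>Inc\<close> moves before it writes and \<open>Dec\<close> erases before it
  moves, which keeps the marks exactly on the cells from 1 up to the head; on the value 0
  \<open>Dec\<close> jumps over its own body, so the head never becomes negative.\<close>

fun compile :: "cmd \<Rightarrow> nat \<Rightarrow> 's program" where
  "compile (Inc r) k = [Work_Right r, Work_Write r 1]"
| "compile (Dec r) k = [If_Work r 0 (k + 3), Work_Write r 0, Work_Left r]"
| "compile (c ;; d) k = (let P = compile c k in P @ compile d (k + length P))"
| "compile (Cond r c d) k =
     (let P = compile c (k + 1); Q = compile d (k + length P + 2)
      in If_Work r 0 (k + length P + 2) # P @ Goto (k + length P + 2 + length Q) # Q)"
| "compile (While r c) k =
     (let P = compile c (k + 1) in If_Work r 0 (k + length P + 2) # P @ [Goto k])"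

text \<open>
  A register is kept on a work tape of its own: its value is the position of the head, and the
  cells \<open>1\<close> up to the head carry the symbol \<open>1\<close>. Thus the head scans a blank iff the value is \<open>0\<close>,
  and all registers are \<open>0\<close> in the initial configuration.
\<close>

definition conf_of :: "nat \<Rightarrow> (nat \<Rightarrow> nat) \<Rightarrow> nat \<Rightarrow> 's list \<Rightarrow> 's conf" where
  "conf_of k \<sigma> i us =
     \<lparr>pc = k, inp = i, head = (\<lambda>r. int (\<sigma> r)),
      tape = (\<lambda>r z. if 1 \<le> z \<and> z \<le> int (\<sigma> r) then 1 else 0), out = us\<rparr>"

definition reaches :: "'s program \<Rightarrow> 's name \<Rightarrow> 's conf \<Rightarrow> 's conf \<Rightarrow> bool" where
  "reaches P p c c' \<longleftrightarrow> (\<exists>t. (step P p ^^ t) c = c')"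

definition code_at :: "'s program \<Rightarrow> nat \<Rightarrow> 's program \<Rightarrow> bool" where
  "code_at P k Q \<longleftrightarrow> (\<exists>A B. P = A @ Q @ B \<and> length A = k)"

section \<open>Runs of machine code placed inside a program\<close>

lemma code_at_append:
  "code_at P k (Q @ R) \<longleftrightarrow> code_at P k Q \<and> code_at P (k + length Q) R"
proof
  assume "code_at P k (Q @ R)"
  then obtain A B where "P = A @ (Q @ R) @ B" "length A = k" unfolding code_at_def by blast
  then have "P = A @ Q @ (R @ B)" "P = (A @ Q) @ R @ B" "length (A @ Q) = k + length Q" by auto
  then show "code_at P k Q \<and> code_at P (k + length Q) R"
    using \<open>length A = k\<close> unfolding code_at_def by blast
next
  assume "code_at P k Q \<and> code_at P (k + length Q) R"
  then obtain A B A' B' where "P = A @ Q @ B" "length A = k" "P = A' @ R @ B'" "length A' = k + length Q"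
    unfolding code_at_def by blast
  then show "code_at P k (Q @ R)"
    unfolding code_at_def by (intro exI[of _ A] exI[of _ B']) (auto simp: append_eq_append_conv_if)
qed

lemma code_at_Nil: "code_at P k [] \<longleftrightarrow> k \<le> length P"
proof
  assume "k \<le> length P"
  then show "code_at P k []"
    unfolding code_at_def by (intro exI[of _ "take k P"] exI[of _ "drop k P"]) simp
qed (auto simp: code_at_def)

lemma code_at_Cons:
  "code_at P k (x # Q) \<longleftrightarrow> k < length P \<and> P ! k = x \<and> code_at P (Suc k) Q"
proof -
  have "code_at P k [x] \<longleftrightarrow> k < length P \<and> P ! k = x"
    unfolding code_at_def
  proof safe
    assume "k < length P" "x = P ! k"
    then show "\<exists>A B. P = A @ [P ! k] @ B \<and> length A = k"
      by (intro exI[of _ "take k P"] exI[of _ "drop (Suc k) P"]) (simp add: id_take_nth_drop[symmetric])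
  qed auto
  then show ?thesis using code_at_append[of P k "[x]" Q] by simp
qed

lemma reaches_refl: "reaches P p c c"
  unfolding reaches_def by (rule exI[of _ 0]) simp

lemma reaches_trans: "reaches P p c c' \<Longrightarrow> reaches P p c' c'' \<Longrightarrow> reaches P p c c''"
  unfolding reaches_def by (metis comp_apply funpow_add)

lemma reaches_step: "reaches P p (step P p c) c' \<Longrightarrow> reaches P p c c'"
  unfolding reaches_def by (metis comp_apply funpow_Suc_right)

lemma reaches_steps2: "step P p (step P p c) = c' \<Longrightarrow> reaches P p c c'"
  using reaches_step[OF reaches_step[OF reaches_refl]] by blast

lemma step_conf_of:
  assumes "k < length P"
  shows "P ! k = If_Work r 0 l \<Longrightarrow>
      step P p (conf_of k \<sigma> i us) = conf_of (if \<sigma> r = 0 then l else Suc k) \<sigma> i us"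
    and "P ! k = Goto l \<Longrightarrow> step P p (conf_of k \<sigma> i us) = conf_of l \<sigma> i us"
    and "P ! k = Input_Right \<Longrightarrow> step P p (conf_of k \<sigma> i us) = conf_of (Suc k) \<sigma> (Suc i) us"
    and "P ! k = If_Input s l \<Longrightarrow>
      step P p (conf_of k \<sigma> i us) = conf_of (if p i = s then l else Suc k) \<sigma> i us"
    and "P ! k = Output s \<Longrightarrow> step P p (conf_of k \<sigma> i us) = conf_of (Suc k) \<sigma> i (us @ [s])"
  using assms unfolding step_def conf_of_def by (simp_all)

lemma step_Inc:
  assumes "code_at P k [Work_Right r, Work_Write r 1]"
  shows "reaches P p (conf_of k \<sigma> i us) (conf_of (k + 2) (\<sigma>(r := Suc (\<sigma> r))) i us)"
proof -
  have P: "k < length P" "P ! k = Work_Right r" "Suc k < length P" "P ! Suc k = Work_Write r 1"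
    using assms unfolding code_at_Cons by auto
  let ?t = "\<lambda>\<sigma> r z. if 1 \<le> z \<and> z \<le> int (\<sigma> r) then 1 else 0 :: nat"
  let ?h = "\<lambda>\<sigma> r. int (\<sigma> r)"
  have t: "(?t \<sigma>)(r := (?t \<sigma> r)(int (\<sigma> r) + 1 := 1)) = ?t (\<sigma>(r := Suc (\<sigma> r)))"
    by (intro ext) auto
  have h: "(?h \<sigma>)(r := int (\<sigma> r) + 1) = ?h (\<sigma>(r := Suc (\<sigma> r)))"
    by (intro ext) auto
  have "step P p (conf_of k \<sigma> i us) =
      \<lparr>pc = Suc k, inp = i, head = (?h \<sigma>)(r := int (\<sigma> r) + 1), tape = ?t \<sigma>, out = us\<rparr>"
    using P(1,2) by (simp add: step_def conf_of_def)
  moreover have "step P p \<dots> =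
      \<lparr>pc = k + 2, inp = i, head = (?h \<sigma>)(r := int (\<sigma> r) + 1),
       tape = (?t \<sigma>)(r := (?t \<sigma> r)(int (\<sigma> r) + 1 := 1)), out = us\<rparr>"
    using P(3,4) by (simp add: step_def)
  ultimately have "step P p (step P p (conf_of k \<sigma> i us)) = conf_of (k + 2) (\<sigma>(r := Suc (\<sigma> r))) i us"
    unfolding t h conf_of_def by simp
  then show ?thesis by (auto intro: reaches_steps2)
qed

lemma step_Dec:
  assumes "code_at P k [Work_Write r 0, Work_Left r]" and "\<sigma> r > 0"
  shows "reaches P p (conf_of k \<sigma> i us) (conf_of (k + 2) (\<sigma>(r := \<sigma> r - 1)) i us)"
proof -
  have P: "k < length P" "P ! k = Work_Write r 0" "Suc k < length P" "P ! Suc k = Work_Left r"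
    using assms(1) unfolding code_at_Cons by auto
  let ?t = "\<lambda>\<sigma> r z. if 1 \<le> z \<and> z \<le> int (\<sigma> r) then 1 else 0 :: nat"
  let ?h = "\<lambda>\<sigma> r. int (\<sigma> r)"
  have t: "(?t \<sigma>)(r := (?t \<sigma> r)(int (\<sigma> r) := 0)) = ?t (\<sigma>(r := \<sigma> r - 1))"
    using assms(2) by (intro ext) auto
  have h: "(?h \<sigma>)(r := int (\<sigma> r) - 1) = ?h (\<sigma>(r := \<sigma> r - 1))"
    using assms(2) by (intro ext) (auto simp: of_nat_diff)
  have "step P p (conf_of k \<sigma> i us) =
      \<lparr>pc = Suc k, inp = i, head = ?h \<sigma>, tape = (?t \<sigma>)(r := (?t \<sigma> r)(int (\<sigma> r) := 0)), out = us\<rparr>"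
    using P(1,2) by (simp add: step_def conf_of_def)
  moreover have "step P p \<dots> =
      \<lparr>pc = k + 2, inp = i, head = (?h \<sigma>)(r := int (\<sigma> r) - 1),
       tape = (?t \<sigma>)(r := (?t \<sigma> r)(int (\<sigma> r) := 0)), out = us\<rparr>"
    using P(3,4) by (simp add: step_def)
  ultimately have "step P p (step P p (conf_of k \<sigma> i us)) = conf_of (k + 2) (\<sigma>(r := \<sigma> r - 1)) i us"
    unfolding t h conf_of_def by simp
  then show ?thesis by (auto intro: reaches_steps2)
qed

text \<open>Induction on the derivation of \<open>big\<close> unrolls loops into finitely many
  rounds. Input position and output are arbitrary and preserved, so compiled commands can be
  inserted between the instructions that read and write.\<close>

lemma compile_correct:
  fixes P :: "'s program"
  assumes "big c \<sigma> \<sigma>'" and "code_at P k (compile c k)"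
  shows "reaches P p (conf_of k \<sigma> i us) (conf_of (k + length (compile c k :: 's program)) \<sigma>' i us)"
  using assms
proof (induction arbitrary: k rule: big.induct)
  case (Inc r \<sigma>)
  then have "code_at P k [Work_Right r, Work_Write r 1]" by simp
  from step_Inc[OF this, of p \<sigma> i us] show ?case by (simp add: fun_upd_def)
next
  case (Dec r \<sigma>)
  then have P: "k < length P" "P ! k = If_Work r 0 (k + 3)" "code_at P (Suc k) [Work_Write r 0, Work_Left r]"
    by (simp_all add: code_at_Cons)
  show ?case
  proof (rule reaches_step, cases "\<sigma> r = 0")
    case True
    then show "reaches P p (step P p (conf_of k \<sigma> i us))
        (conf_of (k + length (compile (Dec r) k :: 's program)) (\<sigma>(r := \<sigma> r - 1)) i us)"
      by (simp add: step_conf_of(1)[OF P(1,2)] reaches_refl fun_upd_idem eval_nat_numeral)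
  next
    case False
    with step_Dec[OF P(3)] show "reaches P p (step P p (conf_of k \<sigma> i us))
        (conf_of (k + length (compile (Dec r) k :: 's program)) (\<sigma>(r := \<sigma> r - 1)) i us)"
      by (simp add: step_conf_of(1)[OF P(1,2)] eval_nat_numeral)
  qed
next
  case (Seq c \<sigma> \<sigma>' d \<sigma>'')
  let ?P = "compile c k :: 's program"
  have P: "code_at P k ?P" "code_at P (k + length ?P) (compile d (k + length ?P))"
    using Seq.prems by (simp_all add: Let_def code_at_append)
  show ?case
    using reaches_trans[OF Seq.IH(1)[OF P(1)] Seq.IH(2)[OF P(2)]] by (simp add: Let_def add.assoc)
next
  case (Cond_pos \<sigma> r c \<sigma>' d)
  let ?P = "compile c (k + 1) :: 's program" let ?l = "k + length ?P + 2"
  let ?Q = "compile d ?l :: 's program"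
  have P: "k < length P" "P ! k = If_Work r 0 ?l" "code_at P (k + 1) ?P"
    "k + 1 + length ?P < length P" "P ! (k + 1 + length ?P) = Goto (?l + length ?Q)"
    using Cond_pos.prems by (simp_all add: Let_def code_at_append code_at_Cons)
  have 1: "reaches P p (conf_of k \<sigma> i us) (conf_of (k + 1) \<sigma> i us)"
    by (rule reaches_step) (use Cond_pos(1) in \<open>simp add: step_conf_of(1)[OF P(1,2)] reaches_refl\<close>)
  have 2: "reaches P p (conf_of (k + 1 + length ?P) \<sigma>' i us) (conf_of (?l + length ?Q) \<sigma>' i us)"
    by (rule reaches_step) (simp only: step_conf_of(2)[OF P(4,5)] reaches_refl)
  show ?case
    using reaches_trans[OF 1 reaches_trans[OF Cond_pos.IH[OF P(3)] 2]] by (simp add: Let_def add_ac)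
next
  case (Cond_zero \<sigma> r d \<sigma>' c)
  let ?P = "compile c (k + 1) :: 's program" let ?l = "k + length ?P + 2"
  have P: "k < length P" "P ! k = If_Work r 0 ?l" "code_at P ?l (compile d ?l)"
    using Cond_zero.prems by (simp_all add: Let_def code_at_append code_at_Cons)
  have 1: "reaches P p (conf_of k \<sigma> i us) (conf_of ?l \<sigma> i us)"
    by (rule reaches_step) (use Cond_zero(1) in \<open>simp add: step_conf_of(1)[OF P(1,2)] reaches_refl\<close>)
  show ?case
    using reaches_trans[OF 1 Cond_zero.IH[OF P(3)]] by (simp add: Let_def add_ac)
next
  case (While_zero \<sigma> r c)
  let ?P = "compile c (k + 1) :: 's program" let ?l = "k + length ?P + 2"
  have P: "k < length P" "P ! k = If_Work r 0 ?l"
    using While_zero.prems by (simp_all add: Let_def code_at_Cons)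
  show ?case
    by (rule reaches_step) (use While_zero(1) in \<open>simp add: step_conf_of(1)[OF P] reaches_refl Let_def\<close>)
next
  case (While_pos \<sigma> r c \<sigma>' \<sigma>'')
  let ?P = "compile c (k + 1) :: 's program" let ?l = "k + length ?P + 2"
  have P: "k < length P" "P ! k = If_Work r 0 ?l" "code_at P (k + 1) ?P"
    "k + 1 + length ?P < length P" "P ! (k + 1 + length ?P) = Goto k"
    using While_pos.prems by (simp_all add: Let_def code_at_append code_at_Cons)
  have 1: "reaches P p (conf_of k \<sigma> i us) (conf_of (k + 1) \<sigma> i us)"
    by (rule reaches_step) (use While_pos(1) in \<open>simp add: step_conf_of(1)[OF P(1,2)] reaches_refl\<close>)
  have 2: "reaches P p (conf_of (k + 1 + length ?P) \<sigma>' i us) (conf_of k \<sigma>' i us)"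
    by (rule reaches_step) (simp only: step_conf_of(2)[OF P(4,5)] reaches_refl)
  show ?case
    using reaches_trans[OF 1 reaches_trans[OF While_pos.IH(1)[OF P(3)] reaches_trans[OF 2 While_pos.IH(2)[OF While_pos.prems]]]] .
qed

section \<open>Register operations and Cantor pairing\<close>

lemma big_Inc: "\<sigma>' = \<sigma>(r := Suc (\<sigma> r)) \<Longrightarrow> big (Inc r) \<sigma> \<sigma>'"
  using big.Inc by simp

lemma big_Dec: "\<sigma>' = \<sigma>(r := \<sigma> r - 1) \<Longrightarrow> big (Dec r) \<sigma> \<sigma>'"
  using big.Dec by metis

text \<open>Rule for counted loops: \<open>f n\<close> is the state after \<open>n\<close> rounds,
  and as \<open>r\<close> drops by one in each round, the number of rounds is the initial value of
  \<open>r\<close>.\<close>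

lemma big_loop:
  assumes "\<And>n. n < \<sigma> r \<Longrightarrow> big c (f n) (f (Suc n))" and "\<And>n. n \<le> \<sigma> r \<Longrightarrow> f n r = \<sigma> r - n"
    and "f 0 = \<sigma>"
  shows "big (While r c) \<sigma> (f (\<sigma> r))"
proof -
  have "big (While r c) (f (\<sigma> r - n)) (f (\<sigma> r))" if "n \<le> \<sigma> r" for n
    using that
  proof (induction n)
    case 0 then show ?case using assms(2)[of "\<sigma> r"] by (simp add: big.While_zero)
  next
    case (Suc n)
    then have "Suc (\<sigma> r - Suc n) = \<sigma> r - n" by simp
    then show ?case
      using Suc assms(1)[of "\<sigma> r - Suc n"] assms(2)[of "\<sigma> r - Suc n"]
        big.While_pos[of "f (\<sigma> r - Suc n)" r c "f (\<sigma> r - n)" "f (\<sigma> r)"] by simp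
  qed
  from this[of "\<sigma> r"] show ?thesis using assms(3) by simp
qed

definition Clear :: "nat \<Rightarrow> cmd" where
  "Clear r = While r (Dec r)"

definition Move :: "nat \<Rightarrow> nat \<Rightarrow> cmd" where
  "Move r s = While r (Dec r ;; Inc s)"

definition Move2 :: "nat \<Rightarrow> nat \<Rightarrow> nat \<Rightarrow> cmd" where
  "Move2 r s t = While r (Dec r ;; Inc s ;; Inc t)"

lemma big_Clear:
  assumes "\<sigma>' = \<sigma>(r := 0)" shows "big (Clear r) \<sigma> \<sigma>'"
proof -
  have "big (While r (Dec r)) \<sigma> ((\<lambda>n. \<sigma>(r := \<sigma> r - n)) (\<sigma> r))"
    by (rule big_loop) (auto intro!: big_Dec simp: fun_eq_iff)
  then show ?thesis using assms unfolding Clear_def by simp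
qed

lemma big_Move:
  assumes "r \<noteq> s" "\<sigma>' = \<sigma>(r := 0, s := \<sigma> s + \<sigma> r)" shows "big (Move r s) \<sigma> \<sigma>'"
proof -
  have "big (While r (Dec r ;; Inc s)) \<sigma> ((\<lambda>n. \<sigma>(r := \<sigma> r - n, s := \<sigma> s + n)) (\<sigma> r))"
    by (rule big_loop)
      (use assms in \<open>auto intro!: big.Seq[OF big_Dec[OF refl] big_Inc] simp: fun_eq_iff\<close>)
  then show ?thesis using assms unfolding Move_def by simp
qed

lemma big_Move2:
  assumes "r \<noteq> s" "r \<noteq> t" "s \<noteq> t" "\<sigma>' = \<sigma>(r := 0, s := \<sigma> s + \<sigma> r, t := \<sigma> t + \<sigma> r)"
  shows "big (Move2 r s t) \<sigma> \<sigma>'"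
proof -
  have "big (While r (Dec r ;; Inc s ;; Inc t)) \<sigma>
     ((\<lambda>n. \<sigma>(r := \<sigma> r - n, s := \<sigma> s + n, t := \<sigma> t + n)) (\<sigma> r))"
    by (rule big_loop)
      (use assms in \<open>auto intro!: big.Seq[OF big_Dec[OF refl] big.Seq[OF big_Inc[OF refl] big_Inc]] simp: fun_eq_iff\<close>)
  then show ?thesis using assms unfolding Move2_def by simp
qed

text \<open>Emptying a register is the only way to read its value, so the value is sent to two
  places and restored from the scratch register \<open>t\<close>.\<close>

definition Copy :: "nat \<Rightarrow> nat \<Rightarrow> nat \<Rightarrow> cmd" where
  "Copy r s t = Move2 r s t ;; Move t r"

lemma big_Copy:
  assumes "r \<noteq> s" "r \<noteq> t" "s \<noteq> t" "\<sigma> t = 0" "\<sigma>' = \<sigma>(s := \<sigma> s + \<sigma> r)"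
  shows "big (Copy r s t) \<sigma> \<sigma>'"
  unfolding Copy_def
  by (rule big.Seq[OF big_Move2[OF _ _ _ refl] big_Move]) (use assms in auto)

text \<open>Cantor pairing: \<open>prod_encode (m, n) = triangle (m + n) + m\<close>. With
  \<open>m\<close> in \<open>b + 2\<close> and \<open>n\<close> in \<open>b + 1\<close>, the first
  move leaves \<open>m\<close> in \<open>b\<close> and \<open>m + n\<close> in \<open>b + 1\<close>;
  the loop then adds \<open>m + n\<close>, \<open>m + n - 1\<close>, ..., 1 to
  \<open>b\<close>.\<close>

definition Encode :: "nat \<Rightarrow> cmd" where
  "Encode b = Move2 (b + 2) b (b + 1) ;;
     While (b + 1) (Copy (b + 1) b (b + 2) ;; Dec (b + 1))"

lemma big_Encode:
  assumes "\<sigma> b = 0" "\<sigma>' = \<sigma>(b := prod_encode (\<sigma> (b + 2), \<sigma> (b + 1)), b + 1 := 0, b + 2 := 0)"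
  shows "big (Encode b) \<sigma> \<sigma>'"
proof -
  have *: "big (While (b + 1) (Copy (b + 1) b (b + 2) ;; Dec (b + 1))) \<tau>
      (\<tau>(b := \<tau> b + triangle n, b + 1 := 0))" if "\<tau> (b + 1) = n" "\<tau> (b + 2) = 0" for n \<tau>
    using that
  proof (induction n arbitrary: \<tau>)
    case 0 then show ?case by (auto intro: big.While_zero simp: fun_upd_idem)
  next
    case (Suc n)
    show ?case
    proof (rule big.While_pos)
      let ?\<tau> = "\<tau>(b := \<tau> b + Suc n, b + 1 := n)"
      show "big (Copy (b + 1) b (b + 2);; Dec (b + 1)) \<tau> ?\<tau>"
        by (rule big.Seq[OF big_Copy[OF _ _ _ _ refl] big_Dec]) (use Suc.prems in auto)
      have eq: "\<tau>(b := \<tau> b + triangle (Suc n), b + 1 := 0) = ?\<tau>(b := ?\<tau> b + triangle n, b + 1 := 0)"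
        by (auto simp: fun_eq_iff)
      show "big (While (b + 1) (Copy (b + 1) b (b + 2) ;; Dec (b + 1))) ?\<tau>
          (\<tau>(b := \<tau> b + triangle (Suc n), b + 1 := 0))"
        unfolding eq by (rule Suc.IH) (use Suc.prems in auto)
    qed (use Suc.prems in auto)
  qed
  show ?thesis
    unfolding Encode_def
  proof (rule big.Seq[OF big_Move2[OF _ _ _ refl]])
    let ?\<tau> = "\<sigma>(b + 2 := 0, b := \<sigma> b + \<sigma> (b + 2), b + 1 := \<sigma> (b + 1) + \<sigma> (b + 2))"
    have "\<sigma>' = ?\<tau>(b := ?\<tau> b + triangle (?\<tau> (b + 1)), b + 1 := 0)"
      using assms by (auto simp: fun_eq_iff prod_encode_def add.commute)
    then show "big (While (b + 1) (Copy (b + 1) b (b + 2) ;; Dec (b + 1))) ?\<tau> \<sigma>'"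
      using *[of ?\<tau>, OF refl] assms(1) by simp
  qed auto
qed

text \<open>Decoding walks through all pairs in the order of their codes.\<close>

definition Decode :: "nat \<Rightarrow> cmd" where
  "Decode b = While b (Dec b ;; Cond (b + 2) (Dec (b + 2) ;; Inc (b + 1)) (Inc (b + 2) ;; Move (b + 1) (b + 2)))"

lemma prod_decode_0: "prod_decode 0 = (0, 0)"
  by (simp add: prod_decode_def prod_decode_aux.simps)

lemma prod_decode_Suc:
  "prod_decode (Suc x) = (case prod_decode x of (m, n) \<Rightarrow> if n = 0 then (0, Suc m) else (Suc m, n - 1))"
proof -
  obtain m n where x: "prod_decode x = (m, n)" by fastforce
  then have "Suc x = Suc (prod_encode (m, n))" by (metis prod_decode_inverse)
  also have "\<dots> = prod_encode (if n = 0 then (0, Suc m) else (Suc m, n - 1))"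
    by (cases n) (simp_all add: prod_encode_def)
  finally show ?thesis using x by simp
qed

lemma big_Decode:
  assumes "\<sigma> (b + 1) = 0" "\<sigma> (b + 2) = 0"
    "\<sigma>' = \<sigma>(b := 0, b + 1 := fst (prod_decode (\<sigma> b)), b + 2 := snd (prod_decode (\<sigma> b)))"
  shows "big (Decode b) \<sigma> \<sigma>'"
proof -
  let ?f = "\<lambda>x. \<sigma>(b := \<sigma> b - x, b + 1 := fst (prod_decode x), b + 2 := snd (prod_decode x))"
  have "big (Decode b) \<sigma> (?f (\<sigma> b))"
    unfolding Decode_def
  proof (rule big_loop[where f = ?f])
    fix x assume "x < \<sigma> b"
    show "big (Dec b ;; Cond (b + 2) (Dec (b + 2) ;; Inc (b + 1)) (Inc (b + 2) ;; Move (b + 1) (b + 2)))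
        (?f x) (?f (Suc x))"
    proof (rule big.Seq[OF big_Dec[OF refl]], cases "snd (prod_decode x) = 0")
      case True
      then show "big (Cond (b + 2) (Dec (b + 2) ;; Inc (b + 1)) (Inc (b + 2) ;; Move (b + 1) (b + 2)))
        ((?f x)(b := ?f x b - 1)) (?f (Suc x))"
        by (intro big.Cond_zero big.Seq[OF big_Inc[OF refl] big_Move])
          (auto simp: prod_decode_Suc fun_eq_iff split: prod.splits)
    next
      case False
      then show "big (Cond (b + 2) (Dec (b + 2) ;; Inc (b + 1)) (Inc (b + 2) ;; Move (b + 1) (b + 2)))
        ((?f x)(b := ?f x b - 1)) (?f (Suc x))"
        by (intro big.Cond_pos big.Seq[OF big_Dec[OF refl] big_Inc])
          (auto simp: prod_decode_Suc fun_eq_iff split: prod.splits)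
    qed
  next
    show "?f 0 = \<sigma>" using assms by (auto simp: prod_decode_0 fun_eq_iff)
  qed simp
  then show ?thesis using assms by simp
qed

text \<open>A calling convention: argument and result share register \<open>b\<close>, the registers
  above \<open>b\<close> are scratch space found and left empty, and those below are preserved.
  Programs are nested by calling them at a larger base.\<close>

definition computes :: "(nat \<Rightarrow> cmd) \<Rightarrow> (nat \<Rightarrow> nat) \<Rightarrow> bool" where
  "computes C f \<longleftrightarrow> (\<forall>b \<sigma>. (\<forall>r>b. \<sigma> r = 0) \<longrightarrow> big (C b) \<sigma> (\<sigma>(b := f (\<sigma> b))))"

definition while_fun :: "(nat \<Rightarrow> nat) \<Rightarrow> bool" where
  "while_fun f \<longleftrightarrow> (\<exists>C. computes C f)"

section \<open>Closure properties of functions computed by while programs\<close>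

lemma while_funI:
  assumes "\<And>b \<sigma>. (\<And>r. r > b \<Longrightarrow> \<sigma> r = 0) \<Longrightarrow> big (C b) \<sigma> (\<sigma>(b := f (\<sigma> b)))"
  shows "while_fun f"
  using assms unfolding while_fun_def computes_def by blast

lemma while_fun_Suc: "while_fun Suc"
  by (rule while_funI[of Inc]) (rule big_Inc, simp)

lemma while_fun_pred: "while_fun (\<lambda>x. x - 1)"
  by (rule while_funI[of Dec]) (rule big_Dec, simp)

lemma while_fun_zero: "while_fun (\<lambda>x. 0)"
  by (rule while_funI[of Clear]) (rule big_Clear, simp)

lemma while_fun_comp:
  assumes "while_fun f" "while_fun g" shows "while_fun (\<lambda>x. f (g x))"
proof -
  obtain C D where C: "computes C f" and D: "computes D g" using assms unfolding while_fun_def by blast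
  show ?thesis
  proof (rule while_funI[of "\<lambda>b. D b ;; C b"])
    fix b and \<sigma> :: "nat \<Rightarrow> nat" assume z: "\<And>r. r > b \<Longrightarrow> \<sigma> r = 0"
    have "big (D b) \<sigma> (\<sigma>(b := g (\<sigma> b)))" using D z unfolding computes_def by blast
    moreover have "big (C b) (\<sigma>(b := g (\<sigma> b))) ((\<sigma>(b := g (\<sigma> b)))(b := f ((\<sigma>(b := g (\<sigma> b))) b)))"
      using C z unfolding computes_def by (metis fun_upd_other less_irrefl)
    ultimately show "big (D b ;; C b) \<sigma> (\<sigma>(b := f (g (\<sigma> b))))" by (auto intro: big.Seq)
  qed
qed

lemma while_fun_id: "while_fun (\<lambda>x. x)"
  using while_fun_comp[OF while_fun_pred while_fun_Suc] by simp

lemma while_fun_const: "while_fun (\<lambda>x. n)"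
proof (induction n)
  case 0 show ?case by (rule while_fun_zero)
next
  case (Suc n) then show ?case using while_fun_comp[OF while_fun_Suc Suc] by simp
qed

lemma computes_big:
  assumes "computes C f" "\<And>r. r > b \<Longrightarrow> \<sigma> r = 0" "\<sigma>' = \<sigma>(b := f (\<sigma> b))"
  shows "big (C b) \<sigma> \<sigma>'"
  using assms unfolding computes_def by blast

text \<open>The second component is evaluated first, in \<open>b + 1\<close>, and the first one then
  in \<open>b + 2\<close>: each program finds the registers above its base empty, and the results
  stand where \<open>Encode\<close> expects them.\<close>

lemma while_fun_pair:
  assumes "while_fun f" "while_fun g" shows "while_fun (\<lambda>x. prod_encode (f x, g x))"
proof -
  obtain C D where C: "computes C f" and D: "computes D g" using assms unfolding while_fun_def by blast
  let ?P = "\<lambda>b. Copy b (b + 1) (b + 2) ;; D (b + 1) ;; Copy b (b + 2) (b + 3) ;; C (b + 2) ;; Clear b ;; Encode b"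
  show ?thesis
  proof (rule while_funI[of ?P])
    fix b and \<sigma> :: "nat \<Rightarrow> nat" assume z: "\<And>r. r > b \<Longrightarrow> \<sigma> r = 0"
    let ?x = "\<sigma> b"
    show "big (?P b) \<sigma> (\<sigma>(b := prod_encode (f ?x, g ?x)))"
    proof (intro big.Seq)
      show "big (Copy b (b + 1) (b + 2)) \<sigma> (\<sigma>(b + 1 := ?x))"
        by (rule big_Copy) (auto simp: z)
      show "big (D (b + 1)) (\<sigma>(b + 1 := ?x)) (\<sigma>(b + 1 := g ?x))"
        by (rule computes_big[OF D]) (auto simp: z)
      show "big (Copy b (b + 2) (b + 3)) (\<sigma>(b + 1 := g ?x)) (\<sigma>(b + 1 := g ?x, b + 2 := ?x))"
        by (rule big_Copy) (auto simp: z)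
      show "big (C (b + 2)) (\<sigma>(b + 1 := g ?x, b + 2 := ?x)) (\<sigma>(b + 1 := g ?x, b + 2 := f ?x))"
        by (rule computes_big[OF C]) (auto simp: z)
      show "big (Clear b) (\<sigma>(b + 1 := g ?x, b + 2 := f ?x)) (\<sigma>(b := 0, b + 1 := g ?x, b + 2 := f ?x))"
        by (rule big_Clear) (auto simp: fun_eq_iff)
      show "big (Encode b) (\<sigma>(b := 0, b + 1 := g ?x, b + 2 := f ?x)) (\<sigma>(b := prod_encode (f ?x, g ?x)))"
        by (rule big_Encode) (auto simp: z fun_eq_iff)
    qed
  qed
qed

lemma while_fun_fst: "while_fun (\<lambda>x. fst (prod_decode x))"
  by (rule while_funI[of "\<lambda>b. Decode b ;; Move (b + 1) b ;; Clear (b + 2)"],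
      intro big.Seq[OF big_Decode[OF _ _ refl] big.Seq[OF big_Move[OF _ refl] big_Clear]])
    (auto simp: fun_eq_iff)

lemma while_fun_snd: "while_fun (\<lambda>x. snd (prod_decode x))"
  by (rule while_funI[of "\<lambda>b. Decode b ;; Move (b + 2) b ;; Clear (b + 1)"],
      intro big.Seq[OF big_Decode[OF _ _ refl] big.Seq[OF big_Move[OF _ refl] big_Clear]])
    (auto simp: fun_eq_iff)

text \<open>The only form of recursion from which the later functions are built. Register
  \<open>b\<close> counts the rounds; the value rests in \<open>b + 2\<close>, where
  \<open>Decode\<close> puts it, and is moved to \<open>b + 1\<close> for each call of
  \<open>C\<close>, with \<open>b + 2\<close> empty as scratch space.\<close>

lemma while_fun_iterate:
  assumes "while_fun f"
  shows "while_fun (\<lambda>z. case prod_decode z of (n, x) \<Rightarrow> (f ^^ n) x)"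
proof -
  obtain C where C: "computes C f" using assms unfolding while_fun_def by blast
  let ?P = "\<lambda>b. Decode b ;; Move (b + 1) b ;; While b (Move (b + 2) (b + 1) ;; C (b + 1) ;; Move (b + 1) (b + 2) ;; Dec b) ;; Move (b + 2) b"
  show ?thesis
  proof (rule while_funI[of ?P])
    fix b and \<sigma> :: "nat \<Rightarrow> nat" assume z: "\<And>r. r > b \<Longrightarrow> \<sigma> r = 0"
    obtain n x where nx: "prod_decode (\<sigma> b) = (n, x)" by fastforce
    let ?f = "\<lambda>i. \<sigma>(b := n - i, b + 2 := (f ^^ i) x)"
    have "big (While b (Move (b + 2) (b + 1) ;; C (b + 1) ;; Move (b + 1) (b + 2) ;; Dec b)) (?f 0) (?f ((?f 0) b))"
    proof (rule big_loop)
      fix i assume "i < ?f 0 b"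
      show "big (Move (b + 2) (b + 1) ;; C (b + 1) ;; Move (b + 1) (b + 2) ;; Dec b) (?f i) (?f (Suc i))"
        by (rule big.Seq[OF big_Move[OF _ refl] big.Seq[OF computes_big[OF C _ refl] big.Seq[OF big_Move[OF _ refl] big_Dec]]])
          (auto simp: fun_eq_iff z)
    qed auto
    then have loop: "big (While b (Move (b + 2) (b + 1) ;; C (b + 1) ;; Move (b + 1) (b + 2) ;; Dec b)) (?f 0) (?f n)" by simp
    show "big (?P b) \<sigma> (\<sigma>(b := case prod_decode (\<sigma> b) of (n, x) \<Rightarrow> (f ^^ n) x))"
    proof (intro big.Seq)
      show "big (Decode b) \<sigma> (\<sigma>(b := 0, b + 1 := n, b + 2 := x))"
        by (rule big_Decode) (auto simp: z nx)
      show "big (Move (b + 1) b) (\<sigma>(b := 0, b + 1 := n, b + 2 := x)) (?f 0)"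
        by (rule big_Move) (auto simp: z fun_eq_iff)
      show "big (Move (b + 2) b) (?f n) (\<sigma>(b := case prod_decode (\<sigma> b) of (n, x) \<Rightarrow> (f ^^ n) x))"
        by (rule big_Move) (auto simp: z nx fun_eq_iff)
    qed (rule loop)
  qed
qed

section \<open>Stream transformations\<close>

definition read_block :: "nat \<Rightarrow> nat \<Rightarrow> 's::{finite,zero_neq_one} program" where
  "read_block r k =
     [If_Input 1 (k + 5), Work_Right r, Work_Write r 1, Input_Right, Goto k, Input_Right]"

lemma seq_name_block:
  fixes a :: "nat \<Rightarrow> nat"
  defines "f \<equiv> \<lambda>j. \<Sum>i<j. a i + 1"
  shows "i < a j \<Longrightarrow> seq_name a (f j + i) = (0 :: 's::{finite,zero_neq_one})"
    and "seq_name a (f j + a j) = (1 :: 's)"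
proof -
  have mono: "strict_mono (\<lambda>j. f j + a j)" unfolding f_def by (rule seq_name_pos_strict_mono)
  show "seq_name a (f j + a j) = (1 :: 's)" unfolding seq_name_def f_def by auto
  show "seq_name a (f j + i) = (0 :: 's)" if "i < a j"
  proof -
    have "f j + i \<noteq> f l + a l" for l
    proof
      assume eq: "f j + i = f l + a l"
      show False
      proof (cases "l < j")
        case True
        then obtain j' where j: "j = Suc j'" by (cases j) auto
        then have "f l + a l \<le> f j' + a j'" using True strict_mono_less_eq[OF mono, of l j'] by simp
        moreover have "f j = f j' + a j' + 1" unfolding f_def j by simp
        ultimately show False using eq by simp
      next
        case False
        then have "f j + a j \<le> f l + a l" using strict_mono_less_eq[OF mono, of j l] by simp
        then show False using eq that by simp
      qed
    qed
    then show ?thesis unfolding seq_name_def f_def by auto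
  qed
qed

lemma reaches_read_block:
  fixes P :: "'s::{finite,zero_neq_one} program"
  assumes P: "code_at P k (read_block r k)" and "\<sigma> r = 0"
  shows "reaches P (seq_name a) (conf_of k \<sigma> (\<Sum>i<j. a i + 1) us)
           (conf_of (k + 6) (\<sigma>(r := a j)) (\<Sum>i<Suc j. a i + 1) us)"
proof -
  let ?s = "\<Sum>i<j. a i + 1"
  have P': "k < length P" "P ! k = If_Input 1 (k + 5)" "code_at P (Suc k) [Work_Right r, Work_Write r 1]"
    "k + 3 < length P" "P ! (k + 3) = Input_Right" "k + 4 < length P" "P ! (k + 4) = Goto k"
    "k + 5 < length P" "P ! (k + 5) = Input_Right"
    using P unfolding read_block_def by (auto simp: code_at_Cons code_at_Nil eval_nat_numeral)
  have zeros: "reaches P (seq_name a) (conf_of k \<sigma> ?s us) (conf_of k (\<sigma>(r := i)) (?s + i) us)"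
    if "i \<le> a j" for i
    using that
  proof (induction i)
    case 0 show ?case using assms by (simp add: reaches_refl fun_upd_idem)
  next
    case (Suc i)
    have "(seq_name a (?s + i) :: 's) = 0" by (rule seq_name_block(1)) (use Suc.prems in simp)
    then have 0: "(seq_name a (?s + i) :: 's) \<noteq> 1" by simp
    have 1: "reaches P (seq_name a) (conf_of k (\<sigma>(r := i)) (?s + i) us) (conf_of (Suc k) (\<sigma>(r := i)) (?s + i) us)"
      by (rule reaches_step) (simp only: step_conf_of(4)[OF P'(1,2)] 0 if_False reaches_refl)
    have 2: "reaches P (seq_name a) (conf_of (Suc k) (\<sigma>(r := i)) (?s + i) us) (conf_of (k + 3) (\<sigma>(r := Suc i)) (?s + i) us)"
      using step_Inc[OF P'(3), of "seq_name a" "\<sigma>(r := i)"] by (simp add: eval_nat_numeral)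
    have 3: "reaches P (seq_name a) (conf_of (k + 4) (\<sigma>(r := Suc i)) (?s + Suc i) us) (conf_of k (\<sigma>(r := Suc i)) (?s + Suc i) us)"
      by (rule reaches_step) (simp only: step_conf_of(2)[OF P'(6,7)] reaches_refl)
    have k: "Suc (k + 3) = k + 4" "Suc (?s + i) = ?s + Suc i" by simp_all
    have 4: "reaches P (seq_name a) (conf_of (k + 3) (\<sigma>(r := Suc i)) (?s + i) us) (conf_of k (\<sigma>(r := Suc i)) (?s + Suc i) us)"
      by (rule reaches_step) (use 3 in \<open>simp only: step_conf_of(3)[OF P'(4,5)] k\<close>)
    show ?case
      using reaches_trans[OF Suc.IH[OF Suc_leD[OF Suc.prems]] reaches_trans[OF 1 reaches_trans[OF 2 4]]] .
  qed
  have 1: "reaches P (seq_name a) (conf_of (k + 5) (\<sigma>(r := a j)) (?s + a j) us)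
      (conf_of (k + 6) (\<sigma>(r := a j)) (\<Sum>i<Suc j. a i + 1) us)"
  proof (rule reaches_step)
    have "Suc (k + 5) = k + 6" "Suc (?s + a j) = (\<Sum>i<Suc j. a i + 1)" by simp_all
    then show "reaches P (seq_name a) (step P (seq_name a) (conf_of (k + 5) (\<sigma>(r := a j)) (?s + a j) us))
        (conf_of (k + 6) (\<sigma>(r := a j)) (\<Sum>i<Suc j. a i + 1) us)"
      by (simp only: step_conf_of(3)[OF P'(8,9)] reaches_refl)
  qed
  have "reaches P (seq_name a) (conf_of k (\<sigma>(r := a j)) (?s + a j) us)
      (conf_of (k + 6) (\<sigma>(r := a j)) (\<Sum>i<Suc j. a i + 1) us)"
    by (rule reaches_step) (simp only: step_conf_of(4)[OF P'(1,2)] seq_name_block(2) if_True simp_thms 1)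
  then show ?thesis using reaches_trans[OF zeros[OF order_refl]] by blast
qed

text \<open>As \<open>list_encode (x # xs) = Suc (prod_encode (x, list_encode xs))\<close>,
  prepending is a pairing followed by an increment. \<open>Encode 1\<close> takes its components
  from registers 3 and 2, which is why the new block is read into register 3 and the history is
  moved to register 2.\<close>

definition push :: cmd where
  "push = Move 0 2 ;; Encode 1 ;; Inc 1 ;; Move 1 0"

lemma big_push:
  "big push ((\<lambda>_. 0)(0 := list_encode xs, 3 := x)) ((\<lambda>_. 0)(0 := list_encode (x # xs)))"
proof -
  let ?h = "list_encode xs"
  show ?thesis
    unfolding push_def
  proof (intro big.Seq)
    show "big (Move 0 2) ((\<lambda>_. 0)(0 := ?h, 3 := x)) ((\<lambda>_. 0)(2 := ?h, 3 := x))"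
      by (rule big_Move) (auto simp: fun_eq_iff)
    show "big (Encode 1) ((\<lambda>_. 0)(2 := ?h, 3 := x)) ((\<lambda>_. 0)(1 := prod_encode (x, ?h)))"
      by (rule big_Encode) (auto simp: fun_eq_iff eval_nat_numeral)
    show "big (Inc 1) ((\<lambda>_. 0)(1 := prod_encode (x, ?h))) ((\<lambda>_. 0)(1 := list_encode (x # xs)))"
      by (rule big_Inc) auto
    show "big (Move 1 0) ((\<lambda>_. 0)(1 := list_encode (x # xs))) ((\<lambda>_. 0)(0 := list_encode (x # xs)))"
      by (rule big_Move) (auto simp: fun_eq_iff)
  qed
qed

fun read_blocks :: "nat \<Rightarrow> nat \<Rightarrow> 's::{finite,zero_neq_one} program" where
  "read_blocks 0 k = []"
| "read_blocks (Suc n) k =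
     (let P = read_block 3 k @ compile push (k + 6) in P @ read_blocks n (k + length P))"

definition prefix_code :: "(nat \<Rightarrow> nat) \<Rightarrow> nat \<Rightarrow> nat \<Rightarrow> nat" where
  "prefix_code a j = (\<lambda>_. 0)(0 := list_encode (rev (map a [0..<j])))"

lemma prefix_code_0: "prefix_code a 0 = (\<lambda>_. 0)"
  by (simp add: prefix_code_def fun_eq_iff)

lemma reaches_read_blocks:
  fixes P :: "'s::{finite,zero_neq_one} program"
  assumes "code_at P k (read_blocks n k)"
  shows "reaches P (seq_name a) (conf_of k (prefix_code a j) (\<Sum>i<j. a i + 1) us)
    (conf_of (k + length (read_blocks n k :: 's program)) (prefix_code a (j + n)) (\<Sum>i<j + n. a i + 1) us)"
  using assms
proof (induction n arbitrary: k j)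
  case 0 show ?case by (simp add: reaches_refl)
next
  case (Suc n)
  let ?P = "read_block 3 k :: 's program" and ?Q = "compile push (k + 6) :: 's program"
  have len: "length ?P = 6" by (simp add: read_block_def)
  have P: "code_at P k ?P" "code_at P (k + 6) ?Q"
    "code_at P (k + 6 + length ?Q) (read_blocks n (k + 6 + length ?Q))"
    using Suc.prems by (simp_all add: code_at_append Let_def len add.assoc)
  have 1: "reaches P (seq_name a) (conf_of k (prefix_code a j) (\<Sum>i<j. a i + 1) us)
      (conf_of (k + 6) ((prefix_code a j)(3 := a j)) (\<Sum>i<Suc j. a i + 1) us)"
    by (rule reaches_read_block[OF P(1)]) (simp add: prefix_code_def)
  have "big push ((prefix_code a j)(3 := a j)) (prefix_code a (Suc j))"
    using big_push[of "rev (map a [0..<j])" "a j"] by (simp add: prefix_code_def)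
  note 2 = compile_correct[OF this P(2), of "seq_name a" "\<Sum>i<Suc j. a i + 1" us]
  show ?case
    using reaches_trans[OF 1 reaches_trans[OF 2 Suc.IH[OF P(3), of "Suc j"]]]
    by (simp add: Let_def len add.assoc del: sum.lessThan_Suc)
qed

text \<open>The history is the only state that survives a round. Each round recomputes
  \<open>f\<close> from the whole history and writes one symbol, so any total function of finite
  histories yields an infinite output.\<close>

definition stream_loop :: "(nat \<Rightarrow> cmd) \<Rightarrow> nat \<Rightarrow> 's::{finite,zero_neq_one} program" where
  "stream_loop C k =
     (let P = read_blocks 1 k; Q = compile (Copy 0 1 2 ;; C 1) (k + length P);
          l = k + length P + length Q
      in P @ Q @ [If_Work 1 0 (l + 3), Output 1, Goto (l + 4), Output 0] @
         compile (Clear 1) (l + 4) @ [Goto k])"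

lemma reaches_stream_loop:
  fixes P :: "'s::{finite,zero_neq_one} program"
  assumes C: "computes C f" and P: "code_at P k (stream_loop C k)"
  shows "reaches P (seq_name a) (conf_of k (prefix_code a j) (\<Sum>i<j. a i + 1) us)
    (conf_of k (prefix_code a (Suc j)) (\<Sum>i<Suc j. a i + 1)
      (us @ [if f (list_encode (rev (map a [0..<Suc j]))) = 0 then 0 else 1]))"
proof -
  let ?P = "read_blocks 1 k :: 's program"
  let ?Q = "compile (Copy 0 1 2 ;; C 1) (k + length ?P) :: 's program"
  define l where "l = k + length ?P + length ?Q"
  let ?R = "compile (Clear 1) (l + 4) :: 's program"
  define i where "i = (\<Sum>i<Suc j. a i + 1)"
  define v where "v = f (list_encode (rev (map a [0..<Suc j])))"
  define s where "s = (if v = 0 then 0 else 1 :: 's)"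
  define \<sigma> where "\<sigma> = (prefix_code a (Suc j))(1 := v)"
  have P': "code_at P k ?P" "code_at P (k + length ?P) ?Q"
    "l < length P" "P ! l = If_Work 1 0 (l + 3)" "l + 1 < length P" "P ! (l + 1) = Output 1"
    "l + 2 < length P" "P ! (l + 2) = Goto (l + 4)" "l + 3 < length P" "P ! (l + 3) = Output 0"
    "code_at P (l + 4) ?R" "l + 4 + length ?R < length P" "P ! (l + 4 + length ?R) = Goto k"
    using P unfolding stream_loop_def Let_def l_def[symmetric] code_at_append
    by (auto simp: code_at_Cons code_at_Nil l_def[symmetric] add.assoc[symmetric] eval_nat_numeral simp del: compile.simps)
  have 1: "reaches P (seq_name a) (conf_of k (prefix_code a j) (\<Sum>i<j. a i + 1) us)
      (conf_of (k + length ?P) (prefix_code a (Suc j)) i us)"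
    using reaches_read_blocks[OF P'(1), of a j us] by (simp add: i_def)
  have "big (Copy 0 1 2 ;; C 1) (prefix_code a (Suc j)) \<sigma>"
    by (rule big.Seq[OF big_Copy[OF _ _ _ _ refl] computes_big[OF C]]) (auto simp: fun_eq_iff prefix_code_def \<sigma>_def v_def)
  note 2 = compile_correct[OF this P'(2), of "seq_name a" i us, folded l_def]
  have \<sigma>1: "\<sigma> 1 = v" by (simp add: \<sigma>_def)
  have l: "Suc (l + 3) = l + 4" "Suc (l + 1) = l + 2" "Suc l = l + 1" by simp_all
  have 3: "reaches P (seq_name a) (conf_of l \<sigma> i us) (conf_of (l + 4) \<sigma> i (us @ [s]))"
  proof (rule reaches_step, cases "v = 0")
    case True
    have "reaches P (seq_name a) (conf_of (l + 3) \<sigma> i us) (conf_of (l + 4) \<sigma> i (us @ [s]))"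
      by (rule reaches_step) (simp only: step_conf_of(5)[OF P'(9,10)] s_def True if_True simp_thms l reaches_refl)
    then show "reaches P (seq_name a) (step P (seq_name a) (conf_of l \<sigma> i us)) (conf_of (l + 4) \<sigma> i (us @ [s]))"
      by (simp only: step_conf_of(1)[OF P'(3,4)] \<sigma>1 True if_True simp_thms)
  next
    case False
    have "reaches P (seq_name a) (conf_of (l + 2) \<sigma> i (us @ [s])) (conf_of (l + 4) \<sigma> i (us @ [s]))"
      by (rule reaches_step) (simp only: step_conf_of(2)[OF P'(7,8)] reaches_refl)
    then have "reaches P (seq_name a) (step P (seq_name a) (conf_of (l + 1) \<sigma> i us)) (conf_of (l + 4) \<sigma> i (us @ [s]))"
      by (simp only: step_conf_of(5)[OF P'(5,6)] s_def False if_False l)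
    from reaches_step[OF this]
    show "reaches P (seq_name a) (step P (seq_name a) (conf_of l \<sigma> i us)) (conf_of (l + 4) \<sigma> i (us @ [s]))"
      by (simp only: step_conf_of(1)[OF P'(3,4)] \<sigma>1 False if_False l)
  qed
  have "big (Clear 1) \<sigma> (prefix_code a (Suc j))"
    by (rule big_Clear) (auto simp: fun_eq_iff prefix_code_def \<sigma>_def)
  note 4 = compile_correct[OF this P'(11), of "seq_name a" i "us @ [s]"]
  have 5: "reaches P (seq_name a) (conf_of (l + 4 + length ?R) (prefix_code a (Suc j)) i (us @ [s]))
      (conf_of k (prefix_code a (Suc j)) i (us @ [s]))"
    by (rule reaches_step) (simp only: step_conf_of(2)[OF P'(12,13)] reaches_refl)
  show ?thesis
    using reaches_trans[OF 1 reaches_trans[OF 2 reaches_trans[OF 3 reaches_trans[OF 4 5]]]]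
    unfolding s_def v_def i_def .
qed

lemma conf_of_init: "init_conf = conf_of 0 (\<lambda>_. 0) 0 []"
  unfolding init_conf_def conf_of_def by (auto simp: fun_eq_iff)

text \<open>Reading \<open>d\<close> blocks ahead lets symbol \<open>k\<close> depend on the first
  \<open>k + d + 1\<close> blocks. The behaviour is described on names of sequences; the names under
  \<open>En\<close> and under \<open>delta_lambda0\<close> are of this form.\<close>

lemma stream_computable:
  assumes f: "while_fun f"
  obtains F :: "'s::{finite,zero_neq_one} name \<rightharpoonup> 's name"
  where "type2_computable F"
    and "\<And>a. F (seq_name a) = Some (\<lambda>k. if f (list_encode (rev (map a [0..<Suc (k + d)]))) = 0 then 0 else 1)"
proof -
  obtain C where C: "computes C f" using f unfolding while_fun_def by blast
  define l where "l = length (read_blocks d 0 :: 's program)"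
  define P :: "'s program" where "P = read_blocks d 0 @ stream_loop C l"
  have code: "code_at P 0 (read_blocks d 0)" "code_at P l (stream_loop C l)"
    unfolding P_def l_def code_at_def by (auto intro: exI[of _ "[]"])
  have "produces P (seq_name a) (\<lambda>k. if f (list_encode (rev (map a [0..<Suc (k + d)]))) = 0 then 0 else 1)"
    (is "produces P _ ?q") for a
  proof -
    have "reaches P (seq_name a) init_conf
        (conf_of l (prefix_code a (n + d)) (\<Sum>i<n + d. a i + 1) (map ?q [0..<n]))" for n
    proof (induction n)
      case 0
      show ?case
        using reaches_read_blocks[OF code(1), of a 0 "[]"]
        by (simp add: conf_of_init prefix_code_0 l_def)
    next
      case (Suc n)
      show ?case
        using reaches_trans[OF Suc reaches_stream_loop[OF C code(2)]] by (simp del: sum.lessThan_Suc)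
    qed
    then have *: "\<exists>t. run P (seq_name a) t = conf_of l (prefix_code a (n + d)) (\<Sum>i<n + d. a i + 1) (map ?q [0..<n])" for n
      unfolding reaches_def run_def by blast
    show ?thesis
      unfolding produces_def
    proof
      fix n
      obtain t where "run P (seq_name a) t = conf_of l (prefix_code a (Suc n + d)) (\<Sum>i<Suc n + d. a i + 1) (map ?q [0..<Suc n])"
        using *[of "Suc n"] by blast
      then have "out (run P (seq_name a) t) = map ?q [0..<Suc n]" by (simp only: conf_of_def conf.simps)
      then show "\<exists>t. n < length (out (run P (seq_name a) t)) \<and> out (run P (seq_name a) t) ! n = ?q n"
        by (intro exI[of _ t]) (simp only: length_map length_upt nth_map_upt, simp)
    qed
  qed
  then have "partial_of (produces P) (seq_name a) = Some (\<lambda>k. if f (list_encode (rev (map a [0..<Suc (k + d)]))) = 0 then 0 else 1)" for a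
    using partial_of_eq_Some_iff[of "produces P" "seq_name a"] produces_unique by blast
  moreover have "type2_computable (partial_of (produces P))"
    unfolding type2_computable_def by blast
  ultimately show thesis using that by blast
qed

section \<open>Computable functions on encoded data\<close>

class encodable =
  fixes enc :: "'a \<Rightarrow> nat"

instantiation nat :: encodable
begin
definition "enc_nat (x :: nat) = x"
instance ..
end

instantiation bool :: encodable
begin
definition "enc_bool (b :: bool) = (of_bool b :: nat)"
instance ..
end

instantiation int :: encodable
begin
definition "enc_int = int_encode"
instance ..
end

instantiation prod :: (encodable, encodable) encodable
begin
definition "enc_prod z = prod_encode (enc (fst z), enc (snd z))"
instance ..
end

instantiation list :: (encodable) encodable
begin
definition "enc_list xs = list_encode (map enc xs)"
instance ..
end

lemma enc_nat_list: "enc (xs :: nat list) = list_encode xs"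
proof -
  have "map enc xs = xs" by (rule map_idI) (simp add: enc_nat_def)
  then show ?thesis by (simp add: enc_list_def)
qed

text \<open>Computability up to codes. The closure properties are stated with a context argument
  \<open>x\<close>, so that they act as introduction rules following the shape of a defining
  expression.\<close>

definition computable :: "('a::encodable \<Rightarrow> 'b::encodable) \<Rightarrow> bool" where
  "computable f \<longleftrightarrow> (\<exists>g. while_fun g \<and> (\<forall>x. g (enc x) = enc (f x)))"

named_theorems computable_intros

lemma computable_nat_iff: "computable (f :: nat \<Rightarrow> nat) \<longleftrightarrow> while_fun f"
proof
  assume "computable f"
  then obtain g where "while_fun g" "\<And>x. g x = f x" unfolding computable_def enc_nat_def by blast
  then show "while_fun f" by (simp add: ext[of g f])
qed (auto simp: computable_def enc_nat_def)

lemma computable_by_code: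
  "computable (g :: nat \<Rightarrow> nat) \<Longrightarrow> (\<And>x. g (enc x) = enc (f x)) \<Longrightarrow> computable f"
  unfolding computable_nat_iff unfolding computable_def by blast

lemma computable_comp:
  assumes "computable f" "computable g" shows "computable (\<lambda>x. f (g x))"
proof -
  obtain f' g' where "while_fun f'" "\<forall>x. f' (enc x) = enc (f x)" "while_fun g'" "\<forall>x. g' (enc x) = enc (g x)"
    using assms unfolding computable_def by blast
  then show ?thesis
    unfolding computable_def by (intro exI[of _ "\<lambda>x. f' (g' x)"]) (simp add: while_fun_comp)
qed

lemma computable_id [computable_intros]: "computable (\<lambda>x. x)"
  unfolding computable_def using while_fun_id by blast

lemma computable_const [computable_intros]: "computable (\<lambda>x. c)"
  unfolding computable_def using while_fun_const by blast

lemma computable_Pair [computable_intros]: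
  assumes "computable f" "computable g" shows "computable (\<lambda>x. (f x, g x))"
proof -
  obtain f' g' where "while_fun f'" "\<forall>x. f' (enc x) = enc (f x)" "while_fun g'" "\<forall>x. g' (enc x) = enc (g x)"
    using assms unfolding computable_def by blast
  then show ?thesis
    unfolding computable_def
    by (intro exI[of _ "\<lambda>x. prod_encode (f' x, g' x)"]) (simp add: while_fun_pair enc_prod_def)
qed

lemma computable_fst [computable_intros]:
  assumes "computable f" shows "computable (\<lambda>x. fst (f x))"
  by (rule computable_comp[OF _ assms], rule computable_by_code[OF iffD2[OF computable_nat_iff while_fun_fst]])
    (simp add: enc_prod_def)

lemma computable_snd [computable_intros]:
  assumes "computable f" shows "computable (\<lambda>x. snd (f x))"
  by (rule computable_comp[OF _ assms], rule computable_by_code[OF iffD2[OF computable_nat_iff while_fun_snd]])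
    (simp add: enc_prod_def)

lemma computable_comp2:
  "computable (\<lambda>z. h (fst z) (snd z)) \<Longrightarrow> computable f \<Longrightarrow> computable g \<Longrightarrow> computable (\<lambda>x. h (f x) (g x))"
  using computable_comp[of "\<lambda>z. h (fst z) (snd z)", OF _ computable_Pair[of f g]] by simp

lemma computable_Suc [computable_intros]: "computable f \<Longrightarrow> computable (\<lambda>x. Suc (f x))"
  by (rule computable_comp) (simp add: computable_nat_iff while_fun_Suc)

lemma computable_pred: "computable f \<Longrightarrow> computable (\<lambda>x. f x - (1 :: nat))"
  by (rule computable_comp[of "\<lambda>x. x - 1"]) (simp add: computable_nat_iff while_fun_pred[simplified])

text \<open>The iterated function depends on the parameter \<open>x\<close>, so the program iterates
  on pairs whose first component carries the code of \<open>x\<close> along unchanged.\<close>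

lemma computable_funpow [computable_intros]:
  fixes f :: "'a::encodable \<Rightarrow> 'b::encodable \<Rightarrow> 'b"
  assumes "computable (\<lambda>z. f (fst z) (snd z))" "computable n" "computable s"
  shows "computable (\<lambda>x. (f x ^^ n x) (s x))"
proof -
  obtain f' n' s' where f: "while_fun f'" "\<And>z. f' (enc z) = enc (f (fst z) (snd z))"
    and n: "while_fun n'" "\<And>x. n' (enc x) = n x"
    and s: "while_fun s'" "\<And>x. s' (enc x) = enc (s x)"
    using assms unfolding computable_def enc_nat_def by metis
  let ?t = "\<lambda>w. prod_encode (fst (prod_decode w), f' w)"
  have t: "(?t ^^ k) (prod_encode (enc x, enc y)) = prod_encode (enc x, enc ((f x ^^ k) y))" for k x y
  proof (induction k)
    case (Suc k)
    then show ?case using f(2)[of "(x, (f x ^^ k) y)"] by (simp add: enc_prod_def)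
  qed simp
  let ?g = "\<lambda>x. snd (prod_decode (case prod_decode (prod_encode (n' x, prod_encode (x, s' x))) of (n, x) \<Rightarrow> (?t ^^ n) x))"
  have "while_fun ?g"
    by (rule while_fun_comp[OF while_fun_snd],
        rule while_fun_comp[OF while_fun_iterate[OF while_fun_pair[OF while_fun_fst f(1)]]],
        intro while_fun_pair n s while_fun_id)
  moreover have "?g (enc x) = enc ((f x ^^ n x) (s x))" for x
    by (simp add: n s t)
  ultimately show ?thesis unfolding computable_def by blast
qed

lemma computable_of_bool [computable_intros]:
  "computable P \<Longrightarrow> computable (\<lambda>x. of_bool (P x) :: nat)"
  unfolding computable_def enc_bool_def enc_nat_def by simp

text \<open>A case distinction is an iteration of the constant function
  \<open>\<lambda>_. f x\<close>, performed once or not at all on the start value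
  \<open>g x\<close>.\<close>

lemma computable_If [computable_intros]:
  assumes "computable P" "computable f" "computable g"
  shows "computable (\<lambda>x. if P x then f x else g x)"
proof -
  have "computable (\<lambda>x. ((\<lambda>_. f x) ^^ of_bool (P x)) (g x))"
    using computable_comp[OF assms(2) computable_fst[OF computable_id]]
    by (intro computable_funpow computable_of_bool assms) simp
  moreover have "((\<lambda>_. f x) ^^ of_bool (P x)) (g x) = (if P x then f x else g x)" for x by simp
  ultimately show ?thesis by simp
qed

section \<open>Arithmetic and bounded search on natural numbers\<close>

lemma computable_minus [computable_intros]:
  assumes "computable f" "computable g" shows "computable (\<lambda>x. f x - g x :: nat)"
proof -
  have "((\<lambda>s. s - 1) ^^ n) m = m - n" for m n :: nat by (induction n) auto
  moreover have "computable (\<lambda>x. ((\<lambda>s. s - 1) ^^ g x) (f x))"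
    by (intro computable_funpow computable_pred computable_intros assms)
  ultimately show ?thesis by simp
qed

lemma computable_plus [computable_intros]:
  assumes "computable f" "computable g" shows "computable (\<lambda>x. f x + g x :: nat)"
proof -
  have "(Suc ^^ n) m = m + n" for m n by simp
  moreover have "computable (\<lambda>x. (Suc ^^ g x) (f x))"
    by (intro computable_intros assms)
  ultimately show ?thesis by (simp add: add.commute)
qed

lemma computable_times [computable_intros]:
  assumes "computable f" "computable g" shows "computable (\<lambda>x. f x * g x :: nat)"
proof -
  have "((\<lambda>s. s + m) ^^ n) 0 = m * n" for m n :: nat by (induction n) auto
  moreover have "computable (\<lambda>x. ((\<lambda>s. s + f x) ^^ g x) 0)"
    using computable_comp[OF assms(1) computable_fst[OF computable_id]]
    by (intro computable_funpow computable_plus computable_snd computable_id computable_const assms) simp_all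
  ultimately show ?thesis by simp
qed

lemma computable_power [computable_intros]:
  assumes "computable f" "computable g" shows "computable (\<lambda>x. f x ^ g x :: nat)"
proof -
  have "((\<lambda>s. s * m) ^^ n) 1 = m ^ n" for m n :: nat by (induction n) (auto simp: mult.commute)
  moreover have "computable (\<lambda>x. ((\<lambda>s. s * f x) ^^ g x) 1)"
    using computable_comp[OF assms(1) computable_fst[OF computable_id]]
    by (intro computable_funpow computable_times computable_snd computable_id computable_const assms) simp_all
  ultimately show ?thesis by simp
qed

lemma computable_eq_0: "computable f \<Longrightarrow> computable (\<lambda>x. f x = (0 :: nat))"
proof (rule computable_comp[of "\<lambda>x. x = 0"])
  have "computable (\<lambda>x. 1 - x :: nat)" by (intro computable_intros)
  then show "computable (\<lambda>x. x = (0 :: nat))"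
    by (rule computable_by_code) (simp add: enc_bool_def enc_nat_def)
qed

lemma computable_Not [computable_intros]: "computable P \<Longrightarrow> computable (\<lambda>x. \<not> P x)"
proof -
  assume "computable P"
  then have "computable (\<lambda>x. of_bool (P x) = (0 :: nat))" by (intro computable_eq_0 computable_of_bool)
  then show ?thesis by simp
qed

lemma computable_conj [computable_intros]:
  "computable P \<Longrightarrow> computable Q \<Longrightarrow> computable (\<lambda>x. P x \<and> Q x)"
proof -
  assume "computable P" "computable Q"
  then have "computable (\<lambda>x. if P x then Q x else False)" by (intro computable_intros)
  moreover have "(if P x then Q x else False) = (P x \<and> Q x)" for x by simp
  ultimately show ?thesis by (simp only:)
qed

lemma computable_le [computable_intros]:
  "computable f \<Longrightarrow> computable g \<Longrightarrow> computable (\<lambda>x. f x \<le> (g x :: nat))"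
  using computable_eq_0[OF computable_minus[of f g]] by simp

lemma computable_less [computable_intros]:
  "computable f \<Longrightarrow> computable g \<Longrightarrow> computable (\<lambda>x. f x < (g x :: nat))"
  using computable_le[OF computable_Suc] by (simp add: Suc_le_eq)

lemma computable_eq [computable_intros]:
  "computable f \<Longrightarrow> computable g \<Longrightarrow> computable (\<lambda>x. f x = (g x :: nat))"
  using computable_conj[OF computable_le[of f g] computable_le[of g f]] by (simp add: eq_iff)

lemma computable_sum [computable_intros]:
  fixes f :: "'a::encodable \<Rightarrow> nat \<Rightarrow> nat"
  assumes "computable (\<lambda>z. f (fst z) (snd z))" "computable n"
  shows "computable (\<lambda>x. \<Sum>k<n x. f x k :: nat)"
proof -
  let ?t = "\<lambda>x z. (Suc (fst z), snd z + f x (fst z))"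
  have "(?t x ^^ m) (0, 0) = (m, \<Sum>k<m. f x k)" for x m by (induction m) auto
  moreover have "computable (\<lambda>x. snd ((?t x ^^ n x) (0, 0)))"
    using computable_comp[OF assms(1), of "\<lambda>z. (fst z, fst (snd z))"]
    by (intro computable_intros assms(2)) (simp add: computable_intros)
  ultimately show ?thesis by simp
qed

lemma computable_Ex_less [computable_intros]:
  fixes P :: "'a::encodable \<Rightarrow> nat \<Rightarrow> bool"
  assumes "computable (\<lambda>z. P (fst z) (snd z))" "computable n"
  shows "computable (\<lambda>x. \<exists>k<n x. P x k)"
proof -
  have "computable (\<lambda>x. 0 < (\<Sum>k<n x. of_bool (P x k) :: nat))"
    by (intro computable_less computable_const computable_sum computable_of_bool assms)
  moreover have "0 < (\<Sum>k<n x. of_bool (P x k) :: nat) \<longleftrightarrow> (\<exists>k<n x. P x k)" for x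
  proof -
    have "(\<Sum>k<n x. of_bool (P x k) :: nat) = 0 \<longleftrightarrow> \<not> (\<exists>k<n x. P x k)" by auto
    then show ?thesis by (simp only: zero_less_iff_neq_zero not_not)
  qed
  ultimately show ?thesis by simp
qed

lemma computable_div [computable_intros]:
  assumes "computable f" "computable g" shows "computable (\<lambda>x. f x div g x :: nat)"
proof (rule computable_comp2[OF _ assms])
  \<comment> \<open>The quotient counts the positive multiples of \<open>n\<close> up to
    \<open>m\<close>; for positive \<open>n\<close> there are at most \<open>m\<close> of them. The
    guard \<open>0 < n\<close> reproduces \<open>m div 0 = 0\<close>.\<close>
  have "(\<Sum>i<m. of_bool (0 < n \<and> Suc i * n \<le> m)) = m div n" for m n :: nat
  proof (cases "n = 0")
    case False
    have "{..<m} \<inter> {i. 0 < n \<and> Suc i * n \<le> m} = {..<m div n}"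
    proof (intro set_eqI)
      fix i
      show "i \<in> {..<m} \<inter> {i. 0 < n \<and> Suc i * n \<le> m} \<longleftrightarrow> i \<in> {..<m div n}"
        using False less_eq_div_iff_mult_less_eq[of n "Suc i" m]
        by (auto simp: Suc_le_eq intro: less_le_trans[OF _ div_le_dividend])
    qed
    then show ?thesis by simp
  qed simp
  moreover have "computable (\<lambda>z. \<Sum>i<fst z. of_bool (0 < snd z \<and> Suc i * snd z \<le> fst z) :: nat)"
    by (intro computable_intros)
  ultimately show "computable (\<lambda>z. fst z div snd z :: nat)" by simp
qed

lemma computable_even [computable_intros]: "computable f \<Longrightarrow> computable (\<lambda>x. even (f x :: nat))"
proof (rule computable_comp[of even])
  have "even n \<longleftrightarrow> 2 * (n div 2) = n" for n :: nat by presburger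
  moreover have "computable (\<lambda>n :: nat. 2 * (n div 2) = n)" by (intro computable_intros)
  ultimately show "computable (even :: nat \<Rightarrow> bool)" by presburger
qed

section \<open>Pairs and lists\<close>

lemma computable_prod_decode [computable_intros]: "computable f \<Longrightarrow> computable (\<lambda>x. prod_decode (f x))"
  by (rule computable_comp[of prod_decode], rule computable_by_code[OF computable_id])
    (simp_all add: enc_prod_def enc_nat_def)

lemma computable_list_decode [computable_intros]: "computable f \<Longrightarrow> computable (\<lambda>x. list_decode (f x))"
  by (rule computable_comp[of list_decode], rule computable_by_code[OF computable_id])
    (simp_all add: enc_nat_list enc_nat_def)

text \<open>The value of \<open>xs ! i\<close> is unspecified beyond the end of the list; with a
  default, lookup becomes a function that is provably computable.\<close>

definition nth_or_0 :: "nat list \<Rightarrow> nat \<Rightarrow> nat" where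
  "nth_or_0 xs i = (if i < length xs then xs ! i else 0)"

lemma computable_drop:
  assumes "computable f" "computable n" shows "computable (\<lambda>x. drop (n x) (f x :: nat list))"
proof -
  have "computable (\<lambda>c. snd (prod_decode (c - 1)))" by (intro computable_intros)
  then have "computable (tl :: nat list \<Rightarrow> _)"
  proof (rule computable_by_code)
    show "snd (prod_decode (enc xs - 1)) = enc (tl xs)" for xs :: "nat list"
      unfolding enc_nat_list by (cases xs) (simp_all add: prod_decode_0)
  qed
  then have "computable (\<lambda>x. (tl ^^ n x) (f x))"
    using computable_comp[of tl snd] by (intro computable_funpow assms) (simp add: computable_intros)
  moreover have "(tl ^^ i) xs = drop i xs" for i and xs :: "nat list"
    by (induction i) (auto simp: drop_Suc tl_drop)
  ultimately show ?thesis by simp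
qed

text \<open>The code of a list bounds its length, so the length is found by counting, below the
  code, the \<open>i\<close> for which dropping \<open>i\<close> entries leaves a nonempty list,
  that is, a nonzero code.\<close>

lemma computable_length [computable_intros]:
  assumes "computable f" shows "computable (\<lambda>x. length (f x :: nat list))"
proof (rule computable_comp[OF _ assms])
  have code: "computable (list_encode)"
    by (rule computable_by_code[OF computable_id]) (simp add: enc_nat_list enc_nat_def)
  have "length xs \<le> list_encode xs" for xs
    by (induction xs) (simp_all add: le_trans[OF _ le_prod_encode_2])
  then have "{..<list_encode xs} \<inter> {i. list_encode (drop i xs) \<noteq> 0} = {..<length xs}" for xs
    using inj_eq[OF inj_list_encode, of _ "[]"] by auto (metis less_le_trans)
  then have "(\<Sum>i<list_encode xs. of_bool (list_encode (drop i xs) \<noteq> 0)) = length xs" for xs by simp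
  moreover have "computable (\<lambda>xs. \<Sum>i<list_encode xs. of_bool (list_encode (drop i xs) \<noteq> 0) :: nat)"
    by (intro computable_intros computable_drop computable_comp[OF code])
  ultimately show "computable (length :: nat list \<Rightarrow> _)" by simp
qed

lemma computable_nth_or_0 [computable_intros]:
  assumes "computable f" "computable n" shows "computable (\<lambda>x. nth_or_0 (f x) (n x))"
proof -
  let ?hd = "\<lambda>xs. case xs of [] \<Rightarrow> 0 | y # _ \<Rightarrow> y"
  have "computable (\<lambda>c. fst (prod_decode (c - 1)))" by (intro computable_intros)
  then have "computable (?hd :: nat list \<Rightarrow> nat)"
  proof (rule computable_by_code)
    show "fst (prod_decode (enc xs - 1)) = enc (?hd xs)" for xs :: "nat list"
      unfolding enc_nat_list enc_nat_def by (cases xs) (simp_all add: prod_decode_0)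
  qed
  from computable_comp[OF this computable_drop[OF assms]]
  have "computable (\<lambda>x. ?hd (drop (n x) (f x)))" .
  moreover have "?hd (drop i xs) = nth_or_0 xs i" for i xs
    unfolding nth_or_0_def by (auto simp: Cons_nth_drop_Suc[symmetric] split: list.split)
  ultimately show ?thesis by simp
qed

section \<open>Integers\<close>

lemma computable_int [computable_intros]:
  assumes "computable f" shows "computable (\<lambda>x. int (f x))"
proof (rule computable_comp[OF _ assms])
  have "computable (\<lambda>n :: nat. 2 * n)" by (intro computable_intros)
  then show "computable int"
    by (rule computable_by_code) (simp add: enc_int_def enc_nat_def int_encode_def sum_encode_def)
qed

lemma computable_nat [computable_intros]:
  assumes "computable f" shows "computable (\<lambda>x. nat (f x))"
proof (rule computable_comp[OF _ assms])
  have "computable (\<lambda>c :: nat. if even c then c div 2 else 0)" by (intro computable_intros)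
  then show "computable nat"
    by (rule computable_by_code) (simp add: enc_int_def enc_nat_def int_encode_def sum_encode_def)
qed

text \<open>Integer operations are carried out on the parts \<open>nat i\<close> and
  \<open>nat (- i)\<close>, and this difference leads back to a signed value. The code of
  \<open>int n\<close> is \<open>2 * n\<close>, that of \<open>- int n\<close> for positive
  \<open>n\<close> is \<open>2 * (n - 1) + 1\<close>.\<close>

lemma computable_int_diff:
  assumes "computable f" "computable g" shows "computable (\<lambda>x. int (f x) - int (g x))"
proof -
  have "computable (\<lambda>n :: nat. if n = 0 then 0 else Suc (2 * (n - 1)))" by (intro computable_intros)
  then have "computable (\<lambda>n. - int n)"
  proof (rule computable_by_code)
    show "(if enc n = 0 then 0 else Suc (2 * (enc n - 1))) = enc (- int n)" for n :: nat
      unfolding enc_int_def enc_nat_def int_encode_def sum_encode_def by (cases n) auto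
  qed
  from computable_comp[OF this computable_minus[OF assms(2,1)]]
  have "computable (\<lambda>x. - int (g x - f x))" .
  then have "computable (\<lambda>x. if g x \<le> f x then int (f x - g x) else - int (g x - f x))"
    using assms by (intro computable_intros)
  moreover have "(if n \<le> m then int (m - n) else - int (n - m)) = int m - int n" for m n by auto
  ultimately show ?thesis by simp
qed

lemma computable_nat_minus:
  assumes "computable f" shows "computable (\<lambda>x. nat (- f x))"
proof (rule computable_comp[OF _ assms, of "\<lambda>x. nat (- x)"])
  have "computable (\<lambda>c :: nat. if even c then 0 else Suc (c div 2))" by (intro computable_intros)
  then show "computable (\<lambda>x. nat (- x))"
    by (rule computable_by_code) (simp add: enc_int_def enc_nat_def int_encode_def sum_encode_def, arith)
qed

lemma computable_int_plus [computable_intros]: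
  assumes "computable f" "computable g" shows "computable (\<lambda>x. f x + g x :: int)"
proof -
  have "computable (\<lambda>x. int (nat (f x) + nat (g x)) - int (nat (- f x) + nat (- g x)))"
    by (intro computable_int_diff computable_intros computable_nat_minus assms)
  moreover have "int (nat i + nat j) - int (nat (- i) + nat (- j)) = i + j" for i j by auto
  ultimately show ?thesis by simp
qed

lemma computable_int_times [computable_intros]:
  assumes "computable f" "computable g" shows "computable (\<lambda>x. f x * g x :: int)"
proof -
  have "computable (\<lambda>x. int (nat (f x) * nat (g x) + nat (- f x) * nat (- g x)) -
      int (nat (f x) * nat (- g x) + nat (- f x) * nat (g x)))"
    by (intro computable_int_diff computable_intros computable_nat_minus assms)
  moreover have "int (nat i * nat j + nat (- i) * nat (- j)) - int (nat i * nat (- j) + nat (- i) * nat j) = i * j" for i j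
    by (cases "0 \<le> i"; cases "0 \<le> j") auto
  ultimately show ?thesis by simp
qed

lemma computable_int_less [computable_intros]:
  assumes "computable f" "computable g" shows "computable (\<lambda>x. f x < (g x :: int))"
proof -
  have "computable (\<lambda>x. nat (f x) + nat (- g x) < nat (g x) + nat (- f x))"
    by (intro computable_intros computable_nat_minus assms)
  moreover have "nat i + nat (- j) < nat j + nat (- i) \<longleftrightarrow> i < j" for i j by auto
  ultimately show ?thesis by simp
qed

lemma computable_uminus [computable_intros]: "computable f \<Longrightarrow> computable (\<lambda>x. - f x :: int)"
  using computable_int_times[OF computable_const[of "- 1"]] by simp

lemma computable_int_decode [computable_intros]: "computable f \<Longrightarrow> computable (\<lambda>x. int_decode (f x))"
  by (rule computable_comp[of int_decode], rule computable_by_code[OF computable_id])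
    (simp_all add: enc_int_def enc_nat_def)

subsection \<open>Rational-valued functions\<close>

text \<open>Fractions are never reduced; a positive denominator is enough to make comparison a cross
  multiplication. The values are typed as reals so that the closure rules apply directly to the
  real-valued masses and integrals of cells.\<close>

definition rat_computable :: "('a::encodable \<Rightarrow> real) \<Rightarrow> bool" where
  "rat_computable r \<longleftrightarrow>
     (\<exists>n d :: 'a \<Rightarrow> int. computable n \<and> computable d \<and> (\<forall>x. 0 < d x \<and> r x = of_int (n x) / of_int (d x)))"

named_theorems rat_computable_intros

lemma rat_computableI:
  assumes "computable n" "computable d" "\<And>x. 0 < d x" "\<And>x. r x = of_int (n x) / of_int (d x)"
  shows "rat_computable r"
  using assms unfolding rat_computable_def by blast

lemma rat_computableE:
  assumes "rat_computable r"
  obtains n d where "computable n" "computable d" "\<And>x. 0 < d x" "\<And>x. d x \<noteq> 0" "\<And>x. r x = of_int (n x) / of_int (d x)"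
  using assms unfolding rat_computable_def by (metis less_irrefl)

lemma rat_computable_of_int: "computable f \<Longrightarrow> rat_computable (\<lambda>x. of_int (f x))"
  by (rule rat_computableI[of f "\<lambda>_. 1"]) (auto intro: computable_intros)

lemma rat_computable_0 [rat_computable_intros]: "rat_computable (\<lambda>_. 0)"
  using rat_computable_of_int[OF computable_const[of 0]] by simp

lemma rat_computable_1 [rat_computable_intros]: "rat_computable (\<lambda>_. 1)"
  using rat_computable_of_int[OF computable_const[of 1]] by simp

lemma rat_computable_plus [rat_computable_intros]:
  assumes "rat_computable r" "rat_computable q" shows "rat_computable (\<lambda>x. r x + q x)"
proof -
  from assms(1) obtain n d where nd: "computable n" "computable d" "\<And>x. 0 < d x" "\<And>x. d x \<noteq> 0"
     "\<And>x. r x = of_int (n x) / of_int (d x)" by (rule rat_computableE) blast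
  from assms(2) obtain m e where me: "computable m" "computable e" "\<And>x. 0 < e x" "\<And>x. e x \<noteq> 0"
     "\<And>x. q x = of_int (m x) / of_int (e x)" by (rule rat_computableE) blast
  show ?thesis
    by (rule rat_computableI[of "\<lambda>x. n x * e x + m x * d x" "\<lambda>x. d x * e x"])
      (auto intro!: computable_intros nd(1-3) me(1-3) simp: nd me add_divide_eq_iff field_simps)
qed

lemma rat_computable_times [rat_computable_intros]:
  assumes "rat_computable r" "rat_computable q" shows "rat_computable (\<lambda>x. r x * q x)"
proof -
  from assms(1) obtain n d where nd: "computable n" "computable d" "\<And>x. 0 < d x" "\<And>x. d x \<noteq> 0"
     "\<And>x. r x = of_int (n x) / of_int (d x)" by (rule rat_computableE) blast
  from assms(2) obtain m e where me: "computable m" "computable e" "\<And>x. 0 < e x" "\<And>x. e x \<noteq> 0"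
     "\<And>x. q x = of_int (m x) / of_int (e x)" by (rule rat_computableE) blast
  show ?thesis
    by (rule rat_computableI[of "\<lambda>x. n x * m x" "\<lambda>x. d x * e x"])
      (auto intro!: computable_intros nd(1-3) me(1-3) simp: nd me)
qed

lemma rat_computable_uminus [rat_computable_intros]:
  "rat_computable r \<Longrightarrow> rat_computable (\<lambda>x. - r x)"
  using rat_computable_times[OF rat_computable_of_int[OF computable_const[of "- 1"]]] by simp

lemma rat_computable_minus [rat_computable_intros]:
  "rat_computable r \<Longrightarrow> rat_computable q \<Longrightarrow> rat_computable (\<lambda>x. r x - q x)"
  using rat_computable_plus[OF _ rat_computable_uminus] by simp

lemma rat_computable_If [rat_computable_intros]:
  assumes "computable P" "rat_computable r" "rat_computable q"
  shows "rat_computable (\<lambda>x. if P x then r x else q x)"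
proof -
  from assms(2) obtain n d where nd: "computable n" "computable d" "\<And>x. 0 < d x" "\<And>x. d x \<noteq> 0"
     "\<And>x. r x = of_int (n x) / of_int (d x)" by (rule rat_computableE) blast
  from assms(3) obtain m e where me: "computable m" "computable e" "\<And>x. 0 < e x" "\<And>x. e x \<noteq> 0"
     "\<And>x. q x = of_int (m x) / of_int (e x)" by (rule rat_computableE) blast
  show ?thesis
    by (rule rat_computableI[of "\<lambda>x. if P x then n x else m x" "\<lambda>x. if P x then d x else e x"])
      (auto intro!: computable_intros nd(1-3) me(1-3) assms(1) simp: nd me)
qed

lemma computable_rat_less [computable_intros]:
  assumes "rat_computable r" "rat_computable q" shows "computable (\<lambda>x. r x < q x)"
proof -
  from assms(1) obtain n d where nd: "computable n" "computable d" "\<And>x. 0 < d x" "\<And>x. d x \<noteq> 0"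
     "\<And>x. r x = of_int (n x) / of_int (d x)" by (rule rat_computableE) blast
  from assms(2) obtain m e where me: "computable m" "computable e" "\<And>x. 0 < e x" "\<And>x. e x \<noteq> 0"
     "\<And>x. q x = of_int (m x) / of_int (e x)" by (rule rat_computableE) blast
  have "r x < q x \<longleftrightarrow> n x * e x < m x * d x" for x
  proof -
    have "r x < q x \<longleftrightarrow> real_of_int (n x) * of_int (e x) < of_int (m x) * of_int (d x)"
      using nd(3)[of x] me(3)[of x] by (simp add: nd(5) me(5) field_simps)
    also have "\<dots> \<longleftrightarrow> n x * e x < m x * d x" by (simp flip: of_int_mult)
    finally show ?thesis .
  qed
  moreover have "computable (\<lambda>x. n x * e x < m x * d x)" by (intro computable_intros nd me)
  ultimately show ?thesis by simp
qed

lemma rat_computable_abs [rat_computable_intros]: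
  assumes "rat_computable r" shows "rat_computable (\<lambda>x. \<bar>r x\<bar>)"
proof -
  have "rat_computable (\<lambda>x. if r x < 0 then - r x else r x)"
    by (intro rat_computable_intros computable_intros assms)
  then show ?thesis by (simp add: abs_if[abs_def])
qed

lemma rat_computable_divide_power [rat_computable_intros]:
  assumes "rat_computable r" "computable f" shows "rat_computable (\<lambda>x. r x / 2 ^ f x)"
proof -
  from assms(1) obtain n d where nd: "computable n" "computable d" "\<And>x. 0 < d x" "\<And>x. d x \<noteq> 0"
     "\<And>x. r x = of_int (n x) / of_int (d x)" by (rule rat_computableE) blast
  show ?thesis
    by (rule rat_computableI[of n "\<lambda>x. d x * int (2 ^ f x)"])
      (intro nd(1), intro computable_intros nd(2) assms(2), use nd in auto)
qed

lemma rat_computable_half [rat_computable_intros]: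
  "rat_computable r \<Longrightarrow> rat_computable (\<lambda>x. r x / 2)"
  using rat_computable_divide_power[OF _ computable_const[of 1]] by simp

text \<open>The loop state consists of index, numerator and denominator, and the denominators are
  simply multiplied.\<close>

lemma rat_computable_sum [rat_computable_intros]:
  fixes r :: "'a::encodable \<Rightarrow> nat \<Rightarrow> real"
  assumes "rat_computable (\<lambda>z. r (fst z) (snd z))" "computable n"
  shows "rat_computable (\<lambda>x. \<Sum>k<n x. r x k)"
proof -
  from assms(1) obtain m d where md: "computable m" "computable d" "\<And>x. 0 < d x" "\<And>x. d x \<noteq> 0"
     "\<And>z. r (fst z) (snd z) = of_int (m z) / of_int (d z)" by (rule rat_computableE) blast
  have r: "r x k = of_int (m (x, k)) / of_int (d (x, k))" for x k using md(5)[of "(x, k)"] by simp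
  define t where "t x z = (Suc (fst z), fst (snd z) * d (x, fst z) + m (x, fst z) * snd (snd z),
      snd (snd z) * d (x, fst z))" for x and z :: "nat \<times> int \<times> int"
  let ?s = "\<lambda>x. (t x ^^ n x) (0, 0, 1)"
  have *: "fst ((t x ^^ i) (0, 0, 1)) = i \<and> 0 < snd (snd ((t x ^^ i) (0, 0, 1))) \<and>
      (\<Sum>k<i. r x k) = of_int (fst (snd ((t x ^^ i) (0, 0, 1)))) / of_int (snd (snd ((t x ^^ i) (0, 0, 1))))" for x i
  proof (induction i)
    case (Suc i)
    then show ?case using md(3)[of "(x, i)"] md(4)[of "(x, i)"]
      by (simp add: t_def r add_frac_eq)
  qed simp
  have s: "computable ?s"
    unfolding t_def by (intro computable_intros computable_comp[OF md(1)] computable_comp[OF md(2)] assms(2))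
  show ?thesis
    by (rule rat_computableI[OF computable_fst[OF computable_snd[OF s]] computable_snd[OF computable_snd[OF s]]])
      (use * in auto)
qed

lemma rat_computable_nat_to_rat [rat_computable_intros]:
  assumes "computable f" shows "rat_computable (\<lambda>x. real_of_rat (nat_to_rat_surj (f x)))"
proof -
  \<comment> \<open>\<open>nat_to_rat_surj\<close> decodes to \<open>Fract a b\<close> with a
    denominator of any sign: a negative sign is moved to the numerator, and \<open>b = 0\<close>
    stands for the rational 0.\<close>
  let ?a = "\<lambda>x. int_decode (fst (prod_decode (f x)))" and ?b = "\<lambda>x. int_decode (snd (prod_decode (f x)))"
  have *: "computable ?a" "computable ?b" by (intro computable_intros assms)+
  show ?thesis
    by (rule rat_computableI[of "\<lambda>x. if 0 < ?b x then ?a x else if ?b x < 0 then - ?a x else 0"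
          "\<lambda>x. if 0 < ?b x then ?b x else if ?b x < 0 then - ?b x else 1"])
      (intro computable_intros *, intro computable_intros *,
       auto simp: nat_to_rat_surj_def Let_def split_beta of_rat_rat Fract_of_int_quotient of_rat_divide)
qed

section \<open>Integration over dyadic cells\<close>

interpretation lambda0: finite_measure lambda0
  by (rule finite_measure_lambda0)

lemma floor_cell: "m \<le> n \<Longrightarrow> x \<in> J n k \<Longrightarrow> \<lfloor>x * 2 ^ m\<rfloor> = int (k div 2 ^ (n - m))"
proof -
  assume mn: "m \<le> n" and x: "x \<in> J n k"
  have "(2::real) ^ n = 2 ^ m * 2 ^ (n - m)" using mn by (simp flip: power_add)
  then have "\<lfloor>x * 2 ^ m\<rfloor> = \<lfloor>x * 2 ^ n / real_of_int (2 ^ (n - m))\<rfloor>" by simp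
  also have "\<dots> = \<lfloor>x * 2 ^ n\<rfloor> div 2 ^ (n - m)" by (rule floor_divide_real_eq_div) simp
  also have "\<dots> = int (k div 2 ^ (n - m))" using x by (simp add: mem_J_iff zdiv_int)
  finally show ?thesis .
qed

text \<open>Passing to a coarser level divides the index of a cell by a power of two. Membership in
  dyadic intervals thus becomes an integer test that a machine can perform.\<close>

lemma mem_J_cell: "m \<le> n \<Longrightarrow> x \<in> J n k \<Longrightarrow> x \<in> J m i \<longleftrightarrow> k div 2 ^ (n - m) = i"
  unfolding mem_J_iff[of x m] using floor_cell by simp

lemma J_sets: "k < 2 ^ n \<Longrightarrow> J n k \<in> sets lambda0"
  unfolding sets_lambda0 using BI_subset_ring by (intro sigma_sets.Basic) (auto simp: BI_def)

lemma J_disjoint: "x \<in> J n k \<Longrightarrow> x \<in> J n l \<Longrightarrow> k = l"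
  by (simp add: mem_J_iff)

lemma measure_J: "k < 2 ^ n \<Longrightarrow> measure lambda0 (J n k) = 1 / 2 ^ n"
proof -
  assume "k < 2 ^ n"
  then have "measure lambda0 (J n k) = measure lborel (J n k)"
    unfolding lambda0_def using J_in_unit by (intro measure_restrict_space) auto
  also have "\<dots> = 1 / 2 ^ n" unfolding J_def by (simp add: divide_right_mono diff_divide_distrib[symmetric])
  finally show ?thesis .
qed

lemma integrable_indicator_J:
  fixes f :: "real \<Rightarrow> real"
  assumes "integrable lambda0 f" "k < 2 ^ n"
  shows "integrable lambda0 (\<lambda>x. indicator (J n k) x * f x)"
  using integrable_mult_indicator[OF J_sets[OF assms(2)] assms(1)] by simp

lemma integral_J_const:
  fixes f :: "real \<Rightarrow> real"
  assumes "k < 2 ^ n" "\<And>x. x \<in> J n k \<Longrightarrow> f x = c"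
  shows "(LINT x|lambda0. indicator (J n k) x * f x) = c / 2 ^ n"
proof -
  have "(LINT x|lambda0. indicator (J n k) x * f x) = (LINT x|lambda0. indicator (J n k) x * c)"
    using assms(2) by (intro Bochner_Integration.integral_cong) (auto simp: indicator_def)
  also have "\<dots> = c / 2 ^ n" using assms(1) by (simp add: J_sets measure_J)
  finally show ?thesis .
qed

lemma integral_cells:
  fixes f :: "real \<Rightarrow> real"
  assumes "integrable lambda0 f"
  shows "(LINT x|lambda0. f x) = (\<Sum>k<2 ^ n. LINT x|lambda0. indicator (J n k) x * f x)"
proof -
  have "(\<Sum>k<2 ^ n. indicator (J n k) x) = (1 :: real)" if x: "x \<in> space lambda0" for x
  proof -
    obtain l where l: "l < 2 ^ n" "x \<in> J n l" using ex_J x by (auto simp: space_lambda0)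
    have "(\<Sum>k<2 ^ n. indicator (J n k) x) = (\<Sum>k<2 ^ n. if k = l then 1 else 0 :: real)"
      using l(2) J_disjoint by (intro sum.cong) (auto simp: indicator_def)
    then show ?thesis using l(1) by simp
  qed
  then have "(LINT x|lambda0. f x) = (LINT x|lambda0. (\<Sum>k<2 ^ n. indicator (J n k) x * f x))"
    by (intro Bochner_Integration.integral_cong) (simp_all flip: sum_distrib_right)
  also have "\<dots> = (\<Sum>k<2 ^ n. LINT x|lambda0. indicator (J n k) x * f x)"
    using integrable_indicator_J[OF assms] by (intro Bochner_Integration.integral_sum) simp
  finally show ?thesis .
qed

lemma J_split: "J n k = J (Suc n) (2 * k) \<union> J (Suc n) (2 * k + 1)"
proof (intro set_eqI)
  fix x :: real
  have 1: "x \<in> J n k" if "x \<in> J (Suc n) i" "i div 2 = k" for i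
    using mem_J_cell[of n "Suc n" x i k] that by simp
  obtain i where i: "i = nat \<lfloor>x * 2 ^ Suc n\<rfloor>" by blast
  have "x \<in> J (Suc n) (2 * k) \<or> x \<in> J (Suc n) (2 * k + 1)" if x: "x \<in> J n k"
  proof -
    have "0 \<le> x" using x by (auto simp: J_def intro: order_trans[of 0 "real k / 2 ^ n"])
    then have xi: "x \<in> J (Suc n) i" by (simp add: mem_J_iff i)
    then have "i div 2 = k" using mem_J_cell[of n "Suc n" x i k] x by simp
    then have "i = 2 * k \<or> i = 2 * k + 1" by linarith
    then show ?thesis using xi by auto
  qed
  then show "x \<in> J n k \<longleftrightarrow> x \<in> J (Suc n) (2 * k) \<union> J (Suc n) (2 * k + 1)" using 1 by auto
qed

lemma integral_J_split:
  fixes f :: "real \<Rightarrow> real"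
  assumes f: "integrable lambda0 f" and k: "k < 2 ^ n"
  shows "(LINT x|lambda0. indicator (J n k) x * f x) =
    (LINT x|lambda0. indicator (J (Suc n) (2 * k)) x * f x) +
    (LINT x|lambda0. indicator (J (Suc n) (2 * k + 1)) x * f x)"
proof -
  have "indicator (J n k) x * f x =
      indicator (J (Suc n) (2 * k)) x * f x + indicator (J (Suc n) (2 * k + 1)) x * f x" for x
    unfolding J_split[of n k] using J_disjoint[of x "Suc n" "2 * k" "2 * k + 1"]
    by (auto simp: indicator_def)
  then show ?thesis
    using integrable_indicator_J[OF f, of "2 * k" "Suc n"] integrable_indicator_J[OF f, of "2 * k + 1" "Suc n"] k
    by simp
qed

text \<open>Every cell is the disjoint union of its two halves, so vanishing integrals propagate
  from level \<open>n\<close> to each coarser level.\<close>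

lemma integral_J_eq_0:
  fixes f :: "real \<Rightarrow> real"
  assumes "m \<le> n" "integrable lambda0 f" "k < 2 ^ m"
    and "\<And>i. i < 2 ^ n \<Longrightarrow> (LINT x|lambda0. indicator (J n i) x * f x) = 0"
  shows "(LINT x|lambda0. indicator (J m k) x * f x) = 0"
  using assms(1,3)
proof (induction m arbitrary: k rule: inc_induct)
  case base then show ?case using assms(4) by simp
next
  case (step m)
  then show ?case using integral_J_split[OF assms(2) step.prems] by simp
qed

section \<open>The density of an enumeration\<close>

text \<open>
  Here \<open>b\<close> is the sequence of blocks after the first one, so it enumerates \<open>{n. \<exists>j. b j = n + 1}\<close>, and
  \<open>J (n + 1) 1\<close> is the interval \<open>[2^-(n+1), 2^-n)\<close>.
\<close>

definition rad :: "nat \<Rightarrow> real \<Rightarrow> real" where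
  "rad l x = (if even \<lfloor>x * 2 ^ l\<rfloor> then 1 else - 1)"

text \<open>\<open>rad\<close> is a Rademacher function, and its level \<open>b j + Suc j\<close>
  serves two purposes. Exceeding \<open>b j\<close>, it makes the wave average out on the interval
  \<open>J (b j) 1\<close>; exceeding \<open>j\<close>, it hides block \<open>j\<close> from all
  cells of level at most \<open>j\<close>.\<close>

definition wave :: "(nat \<Rightarrow> nat) \<Rightarrow> nat \<Rightarrow> real \<Rightarrow> real" where
  "wave b j x = (if b j = 0 then 0 else indicator (J (b j) 1) x * rad (b j + Suc j) x)"

definition dens :: "(nat \<Rightarrow> nat) \<Rightarrow> real \<Rightarrow> real" where
  "dens b x = 1 / 2 + (\<Sum>j. wave b j x) / 2"

definition enumeration :: "(nat \<Rightarrow> nat) \<Rightarrow> bool" where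
  "enumeration b \<longleftrightarrow> (\<forall>i j. b i = b j \<and> b j \<noteq> 0 \<longrightarrow> i = j)"

text \<open>The mean of \<open>wave b j\<close> over the cell \<open>J L k\<close> for
  \<open>k < 2 ^ L\<close>: the wave is constant there if its level is at most \<open>L\<close>, and
  averages out otherwise. The condition \<open>b j + Suc j \<le> L\<close> forces
  \<open>j < L\<close>, which is why the sum in \<open>cell_mass\<close> can stop at
  \<open>L\<close>.\<close>

definition wave_cell :: "(nat \<Rightarrow> nat) \<Rightarrow> nat \<Rightarrow> nat \<Rightarrow> nat \<Rightarrow> real" where
  "wave_cell b L k j =
     (if 0 < b j \<and> b j + Suc j \<le> L \<and> k div 2 ^ (L - b j) = 1
      then if even (k div 2 ^ (L - (b j + Suc j))) then 1 else - 1 else 0)"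

definition cell_mass :: "(nat \<Rightarrow> nat) \<Rightarrow> nat \<Rightarrow> nat \<Rightarrow> real" where
  "cell_mass b L k = (1 + (\<Sum>j<L. wave_cell b L k j)) / 2 ^ Suc L"

lemma J_1_unique: "x \<in> J m 1 \<Longrightarrow> x \<in> J n 1 \<Longrightarrow> m = n"
proof (induction m n rule: linorder_wlog)
  case (le m n)
  then have "1 div 2 ^ (n - m) = (1 :: nat)" using mem_J_cell[of m n x 1 1] by simp
  then have "\<not> 1 < (2 :: nat) ^ (n - m)" by (metis div_less zero_neq_one)
  then have "n - m = 0" by (meson less_2_cases_iff one_less_power neq0_conv one_less_numeral_iff semiring_norm(76))
  then show ?case using le by simp
qed simp

lemma rad_measurable [measurable]: "rad l \<in> borel_measurable lambda0"
proof -
  have "(\<lambda>x :: real. \<lfloor>x * 2 ^ l\<rfloor>) \<in> measurable borel (count_space UNIV)" by measurable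
  then have "rad l \<in> borel_measurable borel" unfolding rad_def by measurable
  then show ?thesis unfolding lambda0_def by (simp add: measurable_restrict_space1)
qed

lemma wave_measurable [measurable]: "wave b j \<in> borel_measurable lambda0"
proof -
  have "(indicator (J (b j) 1) :: real \<Rightarrow> real) \<in> borel_measurable lambda0"
    unfolding lambda0_def by (intro measurable_restrict_space1) (simp add: J_def)
  then show ?thesis unfolding wave_def[abs_def] by (cases "b j = 0") simp_all
qed

lemma abs_wave_le: "\<bar>wave b j x\<bar> \<le> 1"
  unfolding wave_def rad_def by (simp add: indicator_def)

lemma integrable_bounded:
  fixes f :: "real \<Rightarrow> real"
  assumes "f \<in> borel_measurable lambda0" "\<And>x. \<bar>f x\<bar> \<le> B"
  shows "integrable lambda0 f"
  using assms by (intro lambda0.integrable_const_bound[of _ B]) auto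

lemma integrable_wave: "integrable lambda0 (wave b j)"
  by (rule integrable_bounded[OF wave_measurable abs_wave_le])

lemma wave_unique: "enumeration b \<Longrightarrow> wave b i x \<noteq> 0 \<Longrightarrow> wave b j x \<noteq> 0 \<Longrightarrow> i = j"
  using J_1_unique[of x "b i" "b j"] unfolding enumeration_def wave_def
  by (auto split: if_splits simp: indicator_def)

text \<open>The intervals \<open>J n 1\<close> are disjoint for different \<open>n\<close> and no
  number is announced twice, so at most one wave is nonzero at \<open>x\<close>. If all vanish, any
  index serves as \<open>j\<close>.\<close>

lemma wave_sums:
  assumes "enumeration b"
  obtains j where "(\<lambda>i. wave b i x) sums wave b j x" and "\<And>n. (\<Sum>i<n. wave b i x) = (if j < n then wave b j x else 0)"
    and "wave b j x \<noteq> 0 \<or> (\<forall>i. wave b i x = 0)"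
proof -
  obtain j where j: "wave b j x \<noteq> 0 \<or> (\<forall>i. wave b i x = 0)" by blast
  have w: "wave b i x = (if i = j then wave b j x else 0)" for i
    using j wave_unique[OF assms, of i x j] by auto
  have "(\<lambda>i. wave b i x) sums wave b j x"
  proof -
    have "(\<lambda>i. wave b i x) = (\<lambda>i. if i = j then wave b i x else 0)"
      by (rule ext) (use w in meson)
    then show ?thesis using sums_single[of j "\<lambda>i. wave b i x"] by simp
  qed
  moreover have "(\<Sum>i<n. wave b i x) = (if j < n then wave b j x else 0)" for n
  proof -
    have "(\<Sum>i<n. wave b i x) = (\<Sum>i<n. if i = j then wave b j x else 0)"
      by (rule sum.cong[OF refl w])
    then show ?thesis by simp
  qed
  ultimately show thesis using j that by blast
qed

lemma dens_measurable [measurable]: "dens b \<in> borel_measurable lambda0"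
  unfolding dens_def[abs_def] by measurable

lemma dens_bounds: "enumeration b \<Longrightarrow> 0 \<le> dens b x \<and> dens b x \<le> 1"
proof -
  assume "enumeration b"
  then obtain j where "(\<lambda>i. wave b i x) sums wave b j x" by (rule wave_sums)
  then show ?thesis using abs_wave_le[of b j x] unfolding dens_def by (simp add: sums_iff) arith
qed

lemma integrable_dens: "enumeration b \<Longrightarrow> integrable lambda0 (dens b)"
proof (rule integrable_bounded[OF dens_measurable])
  assume b: "enumeration b"
  show "\<bar>dens b x\<bar> \<le> 1" for x using dens_bounds[OF b, of x] by simp
qed

lemma abs_dens_diff:
  assumes "enumeration b" "x \<in> J (Suc n) 1"
  shows "\<bar>dens b x - 1 / 2\<bar> = (if \<exists>j. b j = Suc n then 1 / 2 else 0)"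
proof -
  obtain j where j: "(\<lambda>i. wave b i x) sums wave b j x" "wave b j x \<noteq> 0 \<or> (\<forall>i. wave b i x = 0)"
    using wave_sums[OF assms(1)] by metis
  have d: "dens b x - 1 / 2 = wave b j x / 2" using j(1) by (simp add: dens_def sums_iff)
  show ?thesis
  proof (cases "\<exists>j. b j = Suc n")
    case True
    then obtain i where i: "b i = Suc n" by blast
    then have "\<bar>wave b i x\<bar> = 1" using assms(2) by (simp add: wave_def rad_def)
    moreover from this have "i = j" using j(2) wave_unique[OF assms(1), of i x j] by auto
    ultimately show ?thesis using True by (simp add: d)
  next
    case False
    then have "wave b j x = 0"
      using J_1_unique[OF assms(2), of "b j"] by (auto simp: wave_def indicator_def)
    then show ?thesis using False by (simp add: d)
  qed
qed

lemma rad_cell: "l \<le> L \<Longrightarrow> x \<in> J L k \<Longrightarrow> rad l x = (if even (k div 2 ^ (L - l)) then 1 else - 1)"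
  by (simp add: rad_def floor_cell)

text \<open>On the two halves of a cell of level \<open>n\<close> the function is constantly 1 and
  constantly -1.\<close>

lemma integral_rad:
  assumes k: "k < 2 ^ n" shows "(LINT x|lambda0. indicator (J n k) x * rad (Suc n) x) = 0"
proof -
  have "integrable lambda0 (rad (Suc n))"
    by (rule integrable_bounded[OF rad_measurable, of _ 1]) (simp add: rad_def)
  then have "(LINT x|lambda0. indicator (J n k) x * rad (Suc n) x) =
     (LINT x|lambda0. indicator (J (Suc n) (2 * k)) x * rad (Suc n) x) +
     (LINT x|lambda0. indicator (J (Suc n) (2 * k + 1)) x * rad (Suc n) x)"
    using integral_J_split[OF _ k] by blast
  also have "(LINT x|lambda0. indicator (J (Suc n) (2 * k)) x * rad (Suc n) x) = 1 / 2 ^ Suc n"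
    by (rule integral_J_const) (use k rad_cell[of "Suc n" "Suc n" _ "2 * k"] in auto)
  also have "(LINT x|lambda0. indicator (J (Suc n) (2 * k + 1)) x * rad (Suc n) x) = - 1 / 2 ^ Suc n"
    by (rule integral_J_const) (use k rad_cell[of "Suc n" "Suc n" _ "2 * k + 1"] in auto)
  finally show ?thesis by simp
qed

lemma integral_wave_cell:
  assumes k: "k < 2 ^ L"
  shows "(LINT x|lambda0. indicator (J L k) x * wave b j x) = wave_cell b L k j / 2 ^ L"
proof (cases "b j = 0 \<or> b j + Suc j \<le> L")
  case True
  then have "wave b j x = wave_cell b L k j" if "x \<in> J L k" for x
    using rad_cell[OF _ that, of "b j + Suc j"] mem_J_cell[OF _ that, of "b j" 1]
    by (auto simp: wave_def wave_cell_def indicator_def)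
  then show ?thesis by (rule integral_J_const[OF k])
next
  case False
  \<comment> \<open>This is the last level before the oscillation. As \<open>b j \<le> ?n\<close>,
    each of its cells lies inside or outside \<open>J (b j) 1\<close>, and inside it carries exactly
    one period of mean zero. Here \<open>L \<le> ?n\<close>, so the zero passes to level
    \<open>L\<close>.\<close>
  let ?n = "b j + j"
  have "(LINT x|lambda0. indicator (J ?n i) x * wave b j x) = 0" if i: "i < 2 ^ ?n" for i
  proof -
    define c :: real where "c = (if i div 2 ^ (?n - b j) = 1 then 1 else 0)"
    have "indicator (J ?n i) x * wave b j x = c * (indicator (J ?n i) x * rad (Suc ?n) x)" for x
      using mem_J_cell[of "b j" ?n x i 1] False by (auto simp: wave_def indicator_def c_def)
    then have "(LINT x|lambda0. indicator (J ?n i) x * wave b j x) =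
        c * (LINT x|lambda0. indicator (J ?n i) x * rad (Suc ?n) x)"
      by (simp only: Bochner_Integration.integral_mult_right_zero)
    then show ?thesis using integral_rad[OF i] by simp
  qed
  then have "(LINT x|lambda0. indicator (J L k) x * wave b j x) = 0"
    using False by (intro integral_J_eq_0[where n = ?n, OF _ integrable_wave k]) auto
  then show ?thesis using False by (simp add: wave_cell_def)
qed

text \<open>Waves with index at least \<open>L\<close> integrate to zero over a cell of level
  \<open>L\<close>, so the integrals of the partial sums are constant from \<open>n = L\<close> on,
  and dominated convergence carries this value over to the infinite sum.\<close>

lemma integral_dens_cell:
  assumes b: "enumeration b" and k: "k < 2 ^ L"
  shows "(LINT x|lambda0. indicator (J L k) x * dens b x) = cell_mass b L k"
proof -
  let ?p = "\<lambda>n x. indicator (J L k) x * (1 / 2 + (\<Sum>j<n. wave b j x) / 2) :: real"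
  have p: "(LINT x|lambda0. ?p n x) = cell_mass b L k" if "L \<le> n" for n
  proof -
    define u where "u j x = indicator (J L k) x * wave b j x" for j x
    have p: "?p n = (\<lambda>x. indicator (J L k) x * (1 / 2) + (\<Sum>j<n. u j x) / 2)"
      by (rule ext) (simp only: u_def sum_distrib_left[symmetric] distrib_left times_divide_eq_right)
    have i: "integrable lambda0 (\<lambda>x. indicator (J L k) x * (1 / 2 :: real))"
      by (rule integrable_indicator_J[OF _ k]) simp
    have u: "integrable lambda0 (u j)" for j
      unfolding u_def by (rule integrable_indicator_J[OF integrable_wave k])
    have "(LINT x|lambda0. ?p n x) =
        (LINT x|lambda0. indicator (J L k) x * (1 / 2)) + (LINT x|lambda0. (\<Sum>j<n. u j x) / 2)"
      unfolding p using i u by (intro Bochner_Integration.integral_add) auto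
    also have "(LINT x|lambda0. (\<Sum>j<n. u j x) / 2) = (\<Sum>j<n. LINT x|lambda0. u j x) / 2"
      using u by simp
    also have "(LINT x|lambda0. indicator (J L k) x * (1 / 2)) = (1 / 2 :: real) / 2 ^ L"
      by (rule integral_J_const[OF k]) simp
    also have "(\<Sum>j<n. LINT x|lambda0. u j x) = (\<Sum>j<n. wave_cell b L k j) / 2 ^ L"
      by (simp add: u_def integral_wave_cell[OF k] sum_divide_distrib)
    also have "(\<Sum>j<n. wave_cell b L k j) = (\<Sum>j<L. wave_cell b L k j)"
      using that by (intro sum.mono_neutral_right) (auto simp: wave_cell_def)
    finally show ?thesis by (simp add: cell_mass_def add_divide_distrib)
  qed
  have "(\<lambda>n. LINT x|lambda0. ?p n x) \<longlonglongrightarrow> (LINT x|lambda0. indicator (J L k) x * dens b x)"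
  proof (rule integral_dominated_convergence[where w = "\<lambda>_. 1"])
    have [measurable]: "indicator (J L k) \<in> borel_measurable lambda0" using J_sets[OF k] by simp
    show "(\<lambda>x. indicator (J L k) x * dens b x) \<in> borel_measurable lambda0" by measurable
    show "?p n \<in> borel_measurable lambda0" for n by measurable
    show "AE x in lambda0. (\<lambda>n. ?p n x) \<longlonglongrightarrow> indicator (J L k) x * dens b x"
    proof (rule AE_I2)
      fix x
      have "summable (\<lambda>i. wave b i x)" using wave_sums[OF b, of x] by (metis sums_summable)
      then have "(\<lambda>n. \<Sum>j<n. wave b j x) \<longlonglongrightarrow> (\<Sum>j. wave b j x)" by (rule summable_LIMSEQ)
      then show "(\<lambda>n. ?p n x) \<longlonglongrightarrow> indicator (J L k) x * dens b x"
        unfolding dens_def by (intro tendsto_intros) auto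
    qed
    show "AE x in lambda0. norm (?p n x) \<le> 1" for n
    proof (rule AE_I2)
      fix x
      obtain j where "(\<Sum>i<n. wave b i x) = (if j < n then wave b j x else 0)"
        using wave_sums[OF b, of x] by metis
      then have "\<bar>\<Sum>i<n. wave b i x\<bar> \<le> 1" using abs_wave_le[of b j x] by simp
      then show "norm (?p n x) \<le> 1" by (simp add: indicator_def) arith
    qed
  qed auto
  moreover have "(\<lambda>n. LINT x|lambda0. ?p n x) \<longlonglongrightarrow> cell_mass b L k"
    using p by (intro tendsto_eventually) (auto simp: eventually_sequentially)
  ultimately show ?thesis by (rule LIMSEQ_unique)
qed

definition in_alpha :: "nat \<Rightarrow> nat \<Rightarrow> nat \<Rightarrow> bool" where
  "in_alpha L k e \<longleftrightarrow>
     (\<exists>q<e. odd (e div 2 ^ q) \<and> snd (prod_decode q) < 2 ^ fst (prod_decode q) \<and>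
        k div 2 ^ (L - fst (prod_decode q)) = snd (prod_decode q))"

text \<open>An element \<open>q\<close> of \<open>set_decode e\<close> satisfies
  \<open>q < 2 ^ q\<close> and \<open>2 ^ q \<le> e\<close>, and the interval coded by
  \<open>q\<close> has level at most \<open>q\<close>. So \<open>alpha e\<close> is a union of cells
  of any level \<open>L \<ge> e\<close>, and the search for \<open>q\<close> can stop at
  \<open>e\<close>.\<close>

lemma mem_alpha_cell:
  assumes x: "x \<in> J L k" and e: "e \<le> L"
  shows "x \<in> alpha e \<longleftrightarrow> in_alpha L k e"
proof -
  have bound: "q < e" if "odd (e div 2 ^ q)" for q
  proof (rule ccontr)
    assume "\<not> q < e"
    then have "e < 2 ^ q" using less_exp[of q] by linarith
    then show False using that by simp
  qed
  let ?P = "\<lambda>q. q \<in> set_decode e \<and> snd (prod_decode q) < 2 ^ fst (prod_decode q) \<and>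
      x \<in> J (fst (prod_decode q)) (snd (prod_decode q))"
  have "x \<in> alpha e \<longleftrightarrow> (\<exists>q. ?P q)"
  proof
    assume "x \<in> alpha e"
    then obtain n i where "x \<in> J n i" "i < 2 ^ n" "prod_encode (n, i) \<in> set_decode e"
      unfolding alpha_def by blast
    then have "?P (prod_encode (n, i))" by simp
    then show "\<exists>q. ?P q" ..
  next
    assume "\<exists>q. ?P q"
    then obtain q n i where q: "?P q" "prod_decode q = (n, i)" by (metis surj_pair)
    then have "prod_encode (n, i) \<in> set_decode e" "i < 2 ^ n" "x \<in> J n i"
      by (metis prod_decode_inverse, simp_all)
    then show "x \<in> alpha e" unfolding alpha_def by blast
  qed
  also have "\<dots> \<longleftrightarrow> in_alpha L k e"
  proof -
    have "?P q \<longleftrightarrow> q < e \<and> odd (e div 2 ^ q) \<and> snd (prod_decode q) < 2 ^ fst (prod_decode q) \<and>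
        k div 2 ^ (L - fst (prod_decode q)) = snd (prod_decode q)" for q
    proof (cases "q < e")
      case True
      then have "fst (prod_decode q) \<le> L"
        using e le_prod_encode_1[of "fst (prod_decode q)" "snd (prod_decode q)"] by simp
      from mem_J_cell[OF this x] show ?thesis using True by (simp add: set_decode_def)
    next
      case False
      then show ?thesis using bound[of q] by (auto simp: set_decode_def)
    qed
    then show ?thesis unfolding in_alpha_def by simp
  qed
  finally show ?thesis .
qed

text \<open>The code \<open>e\<close> itself is a sufficient level for \<open>alpha e\<close>. This
  crude choice also makes the mass depend on the first \<open>e\<close> entries of \<open>b\<close>
  only.\<close>

definition ring_mass :: "(nat \<Rightarrow> nat) \<Rightarrow> nat \<Rightarrow> real" where
  "ring_mass b e = (\<Sum>k<2 ^ e. if in_alpha e k e then cell_mass b e k else 0)"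

lemma integral_dens_alpha:
  assumes b: "enumeration b"
  shows "(LINT x|lambda0. indicator (alpha e) x * dens b x) = ring_mass b e"
proof -
  have i: "integrable lambda0 (\<lambda>x. indicator (alpha e) x * dens b x)"
    using integrable_mult_indicator[OF alpha_sets integrable_dens[OF b]] by simp
  have "(LINT x|lambda0. indicator (J e k) x * (indicator (alpha e) x * dens b x)) =
      (if in_alpha e k e then cell_mass b e k else 0)" if k: "k < 2 ^ e" for k
  proof -
    have "indicator (J e k) x * (indicator (alpha e) x * dens b x) =
        (if in_alpha e k e then indicator (J e k) x * dens b x else 0)" for x
      using mem_alpha_cell[of x e k e] by (cases "x \<in> J e k") (simp_all add: indicator_def)
    then show ?thesis using integral_dens_cell[OF b k] by simp
  qed
  then show ?thesis using integral_cells[OF i, of e] by (simp add: ring_mass_def)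
qed

section \<open>The measure belonging to an enumeration\<close>

definition enum_measure :: "(nat \<Rightarrow> nat) \<Rightarrow> real measure" where
  "enum_measure b = density lambda0 (\<lambda>x. ennreal (dens b x))"

lemma emeasure_enum_measure:
  assumes b: "enumeration b" and E: "E \<in> sets lambda0"
  shows "emeasure (enum_measure b) E = ennreal (LINT x|lambda0. indicator E x * dens b x)"
proof -
  have i: "integrable lambda0 (\<lambda>x. indicator E x * dens b x)"
    using integrable_mult_indicator[OF E integrable_dens[OF b]] by simp
  have "emeasure (enum_measure b) E = (\<integral>\<^sup>+x. ennreal (dens b x) * indicator E x \<partial>lambda0)"
    unfolding enum_measure_def using E by (intro emeasure_density) auto
  also have "\<dots> = (\<integral>\<^sup>+x. ennreal (indicator E x * dens b x) \<partial>lambda0)"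
    by (intro nn_integral_cong) (auto split: split_indicator)
  also have "\<dots> = ennreal (LINT x|lambda0. indicator E x * dens b x)"
    using i dens_bounds[OF b] by (intro nn_integral_eq_integral) auto
  finally show ?thesis .
qed

lemma alpha_1: "alpha 1 = {0..<1}"
proof -
  have "set_decode 1 = {0}" using set_encode_inverse[of "{0}"] by (simp add: set_encode_def)
  then have "x \<in> alpha 1 \<longleftrightarrow> x \<in> J 0 0" for x
    unfolding alpha_def using prod_encode_eq[of _ "(0, 0)"] by (auto simp: prod_encode_def triangle_def)
  then show ?thesis using J_0 by auto
qed

text \<open>Every nonzero wave has level at least 2, so the cells of level 1 see no oscillation and
  have mass 1/4 each.\<close>

lemma ring_mass_1: "ring_mass b 1 = 1 / 2"
proof -
  have "in_alpha 1 k 1" if "k < 2" for k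
    unfolding in_alpha_def using that by (intro exI[of _ 0]) (simp add: prod_decode_0)
  moreover have "wave_cell b 1 k 0 = 0" for k
    unfolding wave_cell_def by auto
  ultimately show ?thesis
    unfolding ring_mass_def cell_mass_def by (simp add: numeral_2_eq_2)
qed

lemma enum_measure_dom:
  assumes b: "enumeration b" shows "enum_measure b \<in> dom_RN0"
proof -
  have "emeasure (enum_measure b) E \<le> emeasure lambda0 E" if E: "E \<in> sets lambda0" for E
  proof -
    have "(LINT x|lambda0. indicator E x * dens b x) \<le> (LINT x|lambda0. indicator E x * 1)"
    proof (rule integral_mono)
      show "integrable lambda0 (\<lambda>x. indicator E x * dens b x)"
        using integrable_mult_indicator[OF E integrable_dens[OF b]] by simp
      show "integrable lambda0 (\<lambda>x. indicator E x * (1 :: real))"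
        using integrable_mult_indicator[OF E lambda0.integrable_const[of "1 :: real"]] by simp
      show "indicator E x * dens b x \<le> indicator E x * 1" for x
        using dens_bounds[OF b, of x] by (simp add: indicator_def)
    qed
    also have "\<dots> = measure lambda0 E" using E by simp
    finally show ?thesis
      using emeasure_enum_measure[OF b E] by (simp add: lambda0.emeasure_eq_measure)
  qed
  moreover have "emeasure (enum_measure b) {0..<1} = ennreal (1 / 2)"
    using emeasure_enum_measure[OF b alpha_sets[of 1]] integral_dens_alpha[OF b, of 1]
    unfolding ring_mass_1 alpha_1 by simp
  ultimately show ?thesis
    unfolding dom_RN0_def using sets_lambda0 space_lambda0
    by (simp add: enum_measure_def)
qed

lemma is_density_dens:
  assumes b: "enumeration b" and h: "h \<in> L1 lambda0" "dens b \<in> h"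
  shows "is_density (enum_measure b) h"
proof -
  have "measure (enum_measure b) E = (LINT x:E|lambda0. dens b x)" if "E \<in> dyadic_ring" for E
  proof -
    have "E \<in> sets lambda0" using that unfolding sets_lambda0 by (rule sigma_sets.Basic)
    then show ?thesis
      using emeasure_enum_measure[OF b] dens_bounds[OF b]
      by (simp add: measure_def set_lebesgue_integral_def integral_nonneg)
  qed
  then show ?thesis unfolding is_density_def using h by blast
qed

section \<open>Deciding the enumerated set from a step function\<close>

definition step_cell :: "nat \<Rightarrow> nat \<Rightarrow> nat \<Rightarrow> real" where
  "step_cell c L k = (\<Sum>i<length (list_decode c).
     if in_alpha L k (snd (prod_decode (nth_or_0 (list_decode c) i)))
     then real_of_rat (nat_to_rat_surj (fst (prod_decode (nth_or_0 (list_decode c) i)))) else 0)"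

text \<open>The level \<open>c + Suc n\<close> resolves both objects: all ring codes occurring in
  \<open>c\<close> are at most \<open>c\<close>, and the cells of \<open>J (Suc n) 1\<close> are
  those with \<open>k div 2 ^ c = 1\<close>.\<close>

definition step_dev :: "nat \<Rightarrow> nat \<Rightarrow> real" where
  "step_dev c n = (\<Sum>k<2 ^ (c + Suc n).
     if k div 2 ^ c = 1 then \<bar>step_cell c (c + Suc n) k - 1 / 2\<bar> / 2 ^ (c + Suc n) else 0)"

lemma list_decode_le: "x \<in> set (list_decode c) \<Longrightarrow> x \<le> c"
proof -
  have "x \<le> list_encode xs" if "x \<in> set xs" for xs
    using that
  proof (induction xs)
    case (Cons y xs)
    then show ?case
      using le_prod_encode_1[of y "list_encode xs"] le_prod_encode_2[of "list_encode xs" y] by auto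
  qed simp
  from this[of "list_decode c"] show "x \<in> set (list_decode c) \<Longrightarrow> x \<le> c" by simp
qed

lemma step_fun_cell:
  assumes x: "x \<in> J L k" and c: "c \<le> L"
  shows "step_fun alpha c x = step_cell c L k"
proof -
  let ?xs = "list_decode c"
  have "step_fun alpha c x = (\<Sum>i<length ?xs. case prod_decode (?xs ! i) of (a, e) \<Rightarrow>
      real_of_rat (nat_to_rat_surj a) * indicator (alpha e) x)"
    unfolding step_fun_def by (simp add: sum_list_sum_nth atLeast0LessThan)
  also have "\<dots> = step_cell c L k"
    unfolding step_cell_def
  proof (rule sum.cong[OF refl])
    fix i assume i: "i \<in> {..<length ?xs}"
    obtain a e where ae: "prod_decode (?xs ! i) = (a, e)" by fastforce
    then have "?xs ! i = prod_encode (a, e)" by (metis prod_decode_inverse)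
    moreover have "?xs ! i \<le> c" using list_decode_le[of "?xs ! i" c] i by simp
    ultimately have "e \<le> L" using le_prod_encode_2[of e a] c by simp
    then show "(case prod_decode (?xs ! i) of (a, e) \<Rightarrow> real_of_rat (nat_to_rat_surj a) * indicator (alpha e) x) =
        (if in_alpha L k (snd (prod_decode (nth_or_0 ?xs i)))
         then real_of_rat (nat_to_rat_surj (fst (prod_decode (nth_or_0 ?xs i)))) else 0)"
      using mem_alpha_cell[OF x] ae i by (simp add: nth_or_0_def indicator_def)
  qed
  finally show ?thesis .
qed

lemma integral_step_dev:
  "(LINT x|lambda0. indicator (J (Suc n) 1) x * \<bar>step_fun alpha c x - 1 / 2\<bar>) = step_dev c n"
proof -
  let ?L = "c + Suc n"
  let ?f = "\<lambda>x. indicator (J (Suc n) 1) x * \<bar>step_fun alpha c x - 1 / 2\<bar> :: real"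
  have "integrable lambda0 ?f"
    using integrable_step_fun[of c] by (intro integrable_indicator_J[OF _ one_less_power]) auto
  then have "(LINT x|lambda0. ?f x) = (\<Sum>k<2 ^ ?L. LINT x|lambda0. indicator (J ?L k) x * ?f x)"
    by (rule integral_cells)
  also have "\<dots> = step_dev c n"
    unfolding step_dev_def
  proof (rule sum.cong[OF refl])
    fix k assume "k \<in> {..<2 ^ ?L :: nat}"
    then have k: "k < 2 ^ ?L" by simp
    show "(LINT x|lambda0. indicator (J ?L k) x * ?f x) =
        (if k div 2 ^ c = 1 then \<bar>step_cell c ?L k - 1 / 2\<bar> / 2 ^ ?L else 0)"
    proof (subst integral_J_const[OF k])
      show "?f x = (if k div 2 ^ c = 1 then \<bar>step_cell c ?L k - 1 / 2\<bar> else 0)" if "x \<in> J ?L k" for x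
        using step_fun_cell[OF that] mem_J_cell[OF _ that, of "Suc n" 1] by (simp add: indicator_def)
    qed simp
  qed
  finally show ?thesis .
qed

text \<open>With \<open>r = 1 / 2 ^ n\<close> the exact deviation is \<open>r / 4\<close> or 0, and
  the error is at most \<open>r / 16\<close>. The computed value is therefore at least
  \<open>3 * r / 16\<close> or at most \<open>r / 16\<close>, and the threshold \<open>r / 8\<close>
  separates the two cases.\<close>

lemma step_dev_decides:
  assumes b: "enumeration b"
    and s: "(LINT x|lambda0. \<bar>step_fun alpha c x - dens b x\<bar>) \<le> 1 / 2 ^ (n + 4)"
  shows "1 / 2 ^ (n + 3) < step_dev c n \<longleftrightarrow> (\<exists>j. b j = Suc n)"
proof -
  let ?I = "\<lambda>f. LINT x|lambda0. indicator (J (Suc n) 1) x * \<bar>f x\<bar>"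
  let ?s = "step_fun alpha c"
  have int: "integrable lambda0 (\<lambda>x. indicator (J (Suc n) 1) x * \<bar>f x\<bar>)" if "integrable lambda0 f" for f :: "real \<Rightarrow> real"
    using that by (intro integrable_indicator_J[OF _ one_less_power]) auto
  have i: "integrable lambda0 (\<lambda>x. ?s x - dens b x)" "integrable lambda0 (\<lambda>x. dens b x - 1 / 2)"
    "integrable lambda0 (\<lambda>x. ?s x - 1 / 2)"
    using integrable_step_fun[of c] integrable_dens[OF b] by auto
  have "?I (\<lambda>x. ?s x - dens b x) \<le> (LINT x|lambda0. \<bar>?s x - dens b x\<bar>)"
    using int[OF i(1)] i(1) by (intro integral_mono) (auto simp: indicator_def)
  then have 1: "?I (\<lambda>x. ?s x - dens b x) \<le> 1 / 2 ^ (n + 4)" using s by linarith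
  have 2: "?I (\<lambda>x. dens b x - 1 / 2) = (if \<exists>j. b j = Suc n then 1 / 2 else 0) / 2 ^ Suc n"
    by (rule integral_J_const[OF one_less_power]) (simp_all add: abs_dens_diff[OF b])
  have "?I (\<lambda>x. ?s x - 1 / 2) \<le> (LINT x|lambda0. indicator (J (Suc n) 1) x * \<bar>?s x - dens b x\<bar> +
      indicator (J (Suc n) 1) x * \<bar>dens b x - 1 / 2\<bar>)"
    using int[OF i(1)] int[OF i(2)] int[OF i(3)] by (intro integral_mono) (auto simp: indicator_def)
  then have 3: "?I (\<lambda>x. ?s x - 1 / 2) \<le> ?I (\<lambda>x. ?s x - dens b x) + ?I (\<lambda>x. dens b x - 1 / 2)"
    using int[OF i(1)] int[OF i(2)] by simp
  have "?I (\<lambda>x. dens b x - 1 / 2) \<le> (LINT x|lambda0. indicator (J (Suc n) 1) x * \<bar>?s x - dens b x\<bar> +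
      indicator (J (Suc n) 1) x * \<bar>?s x - 1 / 2\<bar>)"
    using int[OF i(1)] int[OF i(2)] int[OF i(3)] by (intro integral_mono) (auto simp: indicator_def)
  then have 4: "?I (\<lambda>x. dens b x - 1 / 2) \<le> ?I (\<lambda>x. ?s x - dens b x) + ?I (\<lambda>x. ?s x - 1 / 2)"
    using int[OF i(1)] int[OF i(3)] by simp
  define r :: real where "r = 1 / 2 ^ n"
  have r: "0 < r" "1 / 2 ^ (n + 4) = r / 16" "1 / 2 ^ (n + 3) = r / 8"
    by (simp_all add: r_def power_add)
  have 2: "?I (\<lambda>x. dens b x - 1 / 2) = (if \<exists>j. b j = Suc n then r / 4 else 0)"
    unfolding 2 by (simp add: r_def)
  show ?thesis
    using 1 3 4 r(1) unfolding integral_step_dev r(2,3) 2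
    by (cases "\<exists>j. b j = Suc n") simp_all
qed

section \<open>The reduction\<close>

text \<open>A block position is at most its position in the name, so the search for it is bounded.\<close>

definition name_bit :: "(nat \<Rightarrow> nat) \<Rightarrow> nat \<Rightarrow> bool" where
  "name_bit c k \<longleftrightarrow> (\<exists>i<Suc k. k = (\<Sum>j<i. c j + 1) + c i)"

lemma seq_name_bit: "seq_name c k = (if name_bit c k then 1 else 0 :: 's::{finite,zero_neq_one})"
proof -
  have "i < Suc k" if "k = (\<Sum>j<i. c j + 1) + c i" for i
    using that strict_mono_imp_increasing[OF seq_name_pos_strict_mono[of c], of i] by simp
  then show ?thesis unfolding seq_name_def name_bit_def by auto
qed

definition rat_code :: "rat \<Rightarrow> nat" where
  "rat_code r = inv nat_to_rat_surj r"

lemma rat_code: "nat_to_rat_surj (rat_code r) = r"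
  unfolding rat_code_def by (rule surj_f_inv_f[OF surj_nat_to_rat_surj])

definition mass_code_ok :: "(nat \<Rightarrow> nat) \<Rightarrow> nat \<Rightarrow> bool" where
  "mass_code_ok b c \<longleftrightarrow>
     real_of_rat (nat_to_rat_surj (fst (prod_decode c))) < ring_mass b (fst (prod_decode (snd (prod_decode c)))) \<and>
     ring_mass b (fst (prod_decode (snd (prod_decode c)))) < real_of_rat (nat_to_rat_surj (snd (prod_decode (snd (prod_decode c)))))"

text \<open>The item \<open>(-1, \<emptyset>, 1)\<close> is listed at all indices that do not code a correct item.\<close>

definition mass_item :: "(nat \<Rightarrow> nat) \<Rightarrow> nat \<Rightarrow> nat" where
  "mass_item b c = (if mass_code_ok b c then c
     else prod_encode (rat_code (- 1), prod_encode (0, rat_code 1)))"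

definition half_code_ok :: "nat \<Rightarrow> bool" where
  "half_code_ok c \<longleftrightarrow>
     real_of_rat (nat_to_rat_surj (fst (prod_decode c))) < 1 / 2 \<and>
     1 / 2 < real_of_rat (nat_to_rat_surj (snd (prod_decode c)))"

definition half_item :: "nat \<Rightarrow> nat" where
  "half_item c = (if half_code_ok c then c else prod_encode (rat_code 0, rat_code 1))"

text \<open>The second component of the name is the same for all \<open>b\<close>, because the total
  mass is always 1/2.\<close>

definition measure_bit :: "(nat \<Rightarrow> nat) \<Rightarrow> nat \<Rightarrow> bool" where
  "measure_bit b k = (if even k then name_bit (mass_item b) (k div 2) else name_bit half_item (k div 2))"

lemma range_if_default: "P d \<Longrightarrow> range (\<lambda>c. f (if P c then c else d)) = f ` {c. P c}"
  by (auto simp: image_iff)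

lemma surj_image_Collect: "surj f \<Longrightarrow> f ` {c. f c \<in> S} = S"
  using surj_image_vimage_eq[of f S] by (simp add: vimage_def)

lemma ring_mass_0: "ring_mass b 0 = 0"
  by (simp add: ring_mass_def in_alpha_def)

lemma ring_mass_nonneg: "enumeration b \<Longrightarrow> 0 \<le> ring_mass b e"
  unfolding integral_dens_alpha[symmetric]
  using dens_bounds by (intro Bochner_Integration.integral_nonneg) simp

text \<open>All codes are visited in turn, and incorrect ones are replaced by a correct item. As the
  numberings of items are surjective, exactly the correct items are listed.\<close>

lemma delta_M_fin_measure_bit:
  assumes b: "enumeration b"
  shows "delta_M_fin {0..<1} alpha (\<lambda>k. if measure_bit b k then 1 else 0 :: 's::{finite,zero_neq_one}) =
    Some (enum_measure b)"
proof -
  let ?p = "\<lambda>k. if measure_bit b k then 1 else 0 :: 's" and ?\<mu> = "enum_measure b"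
  have fst: "fst_name ?p = seq_name (mass_item b)" and snd: "snd_name ?p = seq_name half_item"
    unfolding fst_name_def[abs_def] snd_name_def[abs_def] measure_bit_def seq_name_bit[abs_def] by auto
  have em: "emeasure ?\<mu> (alpha n) = ennreal (ring_mass b n)" for n
    using emeasure_enum_measure[OF b alpha_sets] integral_dens_alpha[OF b] by simp
  have btw: "strictly_between u (ennreal r) v \<longleftrightarrow> real_of_rat u < r \<and> r < real_of_rat v" if "0 \<le> r" for u v r
    unfolding strictly_between_def using that by (simp add: enn2ereal_ennreal)
  have dom: "?\<mu> \<in> dom_RN0" by (rule enum_measure_dom[OF b])
  moreover have "emeasure ?\<mu> (alpha n) \<noteq> \<infinity>" for n
    unfolding em by simp
  ultimately have "?\<mu> \<in> ring_measures {0..<1} alpha"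
    unfolding ring_measures_def dom_RN0_def range_alpha by blast
  moreover have "lists_all rat_nat_rat (seq_name (mass_item b) :: 's name)
      {(u, n, v). strictly_between u (emeasure ?\<mu> (alpha n)) v}"
    unfolding lists_all_def
  proof (rule exI[of _ "mass_item b"], rule conjI[OF refl])
    have "range (\<lambda>i. rat_nat_rat (mass_item b i)) = rat_nat_rat ` {c. mass_code_ok b c}"
      unfolding mass_item_def
      by (rule range_if_default) (simp add: mass_code_ok_def rat_code ring_mass_0)
    also have "\<dots> = {(u, n, v). strictly_between u (emeasure ?\<mu> (alpha n)) v}"
    proof -
      have ok: "mass_code_ok b c \<longleftrightarrow> rat_nat_rat c \<in> {(u, n, v). strictly_between u (emeasure ?\<mu> (alpha n)) v}" for c
        unfolding em mass_code_ok_def rat_nat_rat_def by (simp add: btw ring_mass_nonneg[OF b] split_beta)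
      show ?thesis unfolding ok by (rule surj_image_Collect[OF surj_rat_nat_rat])
    qed
    finally show "range (\<lambda>i. rat_nat_rat (mass_item b i)) =
      {(u, n, v). strictly_between u (emeasure ?\<mu> (alpha n)) v}" .
  qed
  ultimately have 1: "delta_M {0..<1} alpha (fst_name ?p) = Some ?\<mu>"
    unfolding delta_M_eq_Some_iff names_measure_def fst by blast
  have "lists_all rat_pair (seq_name half_item :: 's name) {(u, v). strictly_between u (emeasure ?\<mu> {0..<1}) v}"
    unfolding lists_all_def
  proof (rule exI[of _ half_item], rule conjI[OF refl])
    have "range (\<lambda>i. rat_pair (half_item i)) = rat_pair ` {c. half_code_ok c}"
      unfolding half_item_def
      by (rule range_if_default) (simp add: half_code_ok_def rat_code)
    also have "\<dots> = {(u, v). strictly_between u (emeasure ?\<mu> {0..<1}) v}"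
    proof -
      have half: "emeasure ?\<mu> {0..<1} = ennreal (1 / 2)" using dom unfolding dom_RN0_def by blast
      have ok: "half_code_ok c \<longleftrightarrow> rat_pair c \<in> {(u, v). strictly_between u (emeasure ?\<mu> {0..<1}) v}" for c
        unfolding half half_code_ok_def rat_pair_def by (simp add: btw split_beta del: ennreal_half)
      show ?thesis unfolding ok by (rule surj_image_Collect[OF surj_rat_pair])
    qed
    finally show "range (\<lambda>i. rat_pair (half_item i)) = {(u, v). strictly_between u (emeasure ?\<mu> {0..<1}) v}" .
  qed
  then show ?thesis unfolding delta_M_fin_def 1 snd by simp
qed

text \<open>Histories are stored in reverse order, and the first block \<open>a 0\<close> does not count for \<open>En\<close>.\<close>

definition past :: "nat list \<Rightarrow> nat \<Rightarrow> nat" where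
  "past xs j = nth_or_0 xs (length xs - Suc (Suc j))"

lemma past_eq: "Suc j < n \<Longrightarrow> past (rev (map a [0..<n])) j = a (Suc j)"
  by (simp add: past_def nth_or_0_def rev_nth)

section \<open>Dependence on finitely many blocks\<close>

lemma cell_mass_cong: "(\<And>j. j < L \<Longrightarrow> b j = b' j) \<Longrightarrow> cell_mass b L k = cell_mass b' L k"
  unfolding cell_mass_def wave_cell_def by (auto intro!: sum.cong)

lemma ring_mass_cong: "(\<And>j. j < e \<Longrightarrow> b j = b' j) \<Longrightarrow> ring_mass b e = ring_mass b' e"
  unfolding ring_mass_def by (auto intro!: sum.cong cell_mass_cong)

text \<open>A pair code is at least as large as its components, so the ring code in item
  \<open>c\<close> is at most \<open>c\<close>, and its mass depends on the first \<open>c\<close>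
  blocks only.\<close>

lemma mass_item_cong:
  assumes "\<And>j. j < c \<Longrightarrow> b j = b' j" shows "mass_item b c = mass_item b' c"
proof -
  let ?e = "fst (prod_decode (snd (prod_decode c)))"
  have "?e \<le> snd (prod_decode c)"
    by (metis le_prod_encode_1 prod.collapse prod_decode_inverse)
  also have "\<dots> \<le> c"
    by (metis le_prod_encode_2 prod.collapse prod_decode_inverse)
  finally have "ring_mass b ?e = ring_mass b' ?e"
    using assms by (intro ring_mass_cong) simp
  then show ?thesis unfolding mass_item_def mass_code_ok_def by simp
qed

text \<open>This causality makes \<open>H\<close> a stream transformation. Symbol \<open>k\<close>
  involves only items with index at most \<open>k div 2\<close>; when it is due, the blocks
  \<open>a 0\<close>, ..., \<open>a k\<close> have been read, which provide the first
  \<open>k\<close> entries of \<open>b\<close> after \<open>a 0\<close> is discarded.\<close>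

lemma measure_bit_cong:
  assumes "\<And>j. j < k \<Longrightarrow> b j = b' j" shows "measure_bit b k = measure_bit b' k"
proof -
  have c: "mass_item b i = mass_item b' i" if "i \<le> k div 2" for i
    using assms that by (intro mass_item_cong) simp
  have "name_bit (mass_item b) (k div 2) = name_bit (mass_item b') (k div 2)"
    unfolding name_bit_def
  proof (rule ex_cong1, rule conj_cong[OF refl])
    fix i assume "i < Suc (k div 2)"
    then have "(\<Sum>j<i. mass_item b j + 1) = (\<Sum>j<i. mass_item b' j + 1)" "mass_item b i = mass_item b' i"
      using c by auto
    then show "k div 2 = (\<Sum>j<i. mass_item b j + 1) + mass_item b i \<longleftrightarrow>
        k div 2 = (\<Sum>j<i. mass_item b' j + 1) + mass_item b' i" by metis
  qed
  then show ?thesis unfolding measure_bit_def by simp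
qed

text \<open>The position is recovered from the history, which has \<open>k + 1\<close> entries when
  symbol \<open>k\<close> is due. Unfolded, the test consists of bounded sums, bounded searches and
  comparisons of rationals.\<close>

lemma computable_measure_bit: "computable (\<lambda>xs. measure_bit (past xs) (length xs - 1))"
  unfolding measure_bit_def name_bit_def mass_item_def mass_code_ok_def half_item_def half_code_ok_def
    ring_mass_def in_alpha_def cell_mass_def wave_cell_def past_def
  by (intro computable_intros rat_computable_intros)

text \<open>With four blocks read ahead, the history for symbol \<open>k\<close> has
  \<open>k + 5\<close> entries. Being stored in reverse, it has the block \<open>s (k + 4)\<close>
  at position 0, and this codes a step function within \<open>1 / 2 ^ (k + 4)\<close> of the
  density.\<close>

lemma computable_step_dev:
  "computable (\<lambda>xs. 1 / 2 ^ (length xs - 5 + 3) < step_dev (nth_or_0 xs 0) (length xs - 5))"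
  unfolding step_dev_def step_cell_def in_alpha_def
  by (intro computable_intros rat_computable_intros)

lemma decision_computable:
  fixes P :: "nat list \<Rightarrow> bool"
  assumes "computable P"
  obtains F :: "'s::{finite,zero_neq_one} name \<rightharpoonup> 's name"
  where "type2_computable F"
    and "\<And>a. F (seq_name a) = Some (\<lambda>k. if P (rev (map a [0..<Suc (k + d)])) then 1 else 0)"
proof -
  obtain f where f: "while_fun f" "\<And>xs. f (list_encode xs) = of_bool (P xs)"
    using assms unfolding computable_def enc_nat_list enc_bool_def by blast
  obtain F :: "'s name \<rightharpoonup> 's name" where F: "type2_computable F"
    "\<And>a. F (seq_name a) = Some (\<lambda>k. if f (list_encode (rev (map a [0..<Suc (k + d)]))) = 0 then 0 else 1)"
    using stream_computable[OF f(1), of d] by blast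
  show thesis
  proof (rule that[OF F(1)])
    show "F (seq_name a) = Some (\<lambda>k. if P (rev (map a [0..<Suc (k + d)])) then 1 else 0)" for a
      unfolding F(2) f(2) by (simp add: fun_eq_iff)
  qed
qed

lemma En_cases:
  fixes y :: "'s::{finite,zero_neq_one} name"
  assumes "En y = Some A"
  obtains a where "y = seq_name a" "enumeration a" "A = {n. \<exists>i. a (Suc i) = n + 1}"
proof -
  let ?E = "\<exists>a. y = seq_name a \<and> (\<forall>i j. a i = a j \<and> a j \<noteq> 0 \<longrightarrow> i = j)"
  have ex: ?E by (rule ccontr) (use assms in \<open>simp only: En_def if_False option.distinct\<close>)
  then obtain a where a: "y = seq_name a" "enumeration a" unfolding enumeration_def by blast
  have "A = {n. \<exists>k. y k = 1 \<and> (\<forall>j\<in>{1..n + 1}. y (k + j) = 0) \<and> y (k + n + 2) = 1}"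
    using assms unfolding En_def if_P[OF ex] option.inject by (rule sym)
  then have "A = {n. \<exists>i. a (Suc i) = n + 1}" unfolding a(1) seq_name_subword_iff .
  then show thesis using that a by blast
qed

theorem theorem2:
  shows "sW_reducible
           (En :: 's::{finite,zero_neq_one} name \<rightharpoonup> nat set) Cf EC
           (delta_M_fin {0..<1} alpha) delta_lambda0 RN0"
proof -
  obtain H :: "'s name \<rightharpoonup> 's name" where H: "type2_computable H"
    "\<And>a. H (seq_name a) = Some (\<lambda>k. if measure_bit (past (rev (map a [0..<Suc (k + 0)])))
        (length (rev (map a [0..<Suc (k + 0)])) - 1) then 1 else 0)"
    using decision_computable[OF computable_measure_bit, of 0] by blast
  obtain K :: "'s name \<rightharpoonup> 's name" where K: "type2_computable K"
    "\<And>s. K (seq_name s) = Some (\<lambda>k. let xs = rev (map s [0..<Suc (k + 4)]) in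
        if 1 / 2 ^ (length xs - 5 + 3) < step_dev (nth_or_0 xs 0) (length xs - 5) then 1 else 0)"
    unfolding Let_def using decision_computable[OF computable_step_dev, of 4] by blast
  have K': "K (seq_name s) = Some (\<lambda>k. if 1 / 2 ^ (k + 3) < step_dev (s (k + 4)) k then 1 else 0)" for s
  proof -
    have 1: "length (rev (map s [0..<Suc (k + 4)])) - 5 = k" for k by simp
    have 2: "nth_or_0 (rev (map s [0..<Suc n])) 0 = s n" for n by (simp add: nth_or_0_def)
    show ?thesis unfolding K(2) Let_def 1 2 ..
  qed
  have "realizer En Cf EC (K \<circ>\<^sub>m G \<circ>\<^sub>m H)" if G: "realizer (delta_M_fin {0..<1} alpha) delta_lambda0 RN0 G" for G
    unfolding realizer_def
  proof (intro allI impI)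
    fix y :: "'s name" and A Z assume "En y = Some A" "EC A = Some Z"
    then obtain a where y: "y = seq_name a" and a: "enumeration a"
      and Z: "Z = {n. \<exists>i. a (Suc i) = n + 1}"
      using En_cases unfolding EC_def by (metis option.inject)
    define b where "b j = a (Suc j)" for j
    have b: "enumeration b" using a unfolding enumeration_def b_def by blast
    let ?p = "\<lambda>k. if measure_bit b k then 1 else 0 :: 's"
    have "measure_bit (past (rev (map a [0..<Suc k]))) k = measure_bit b k" for k
      by (rule measure_bit_cong) (simp add: past_eq b_def del: upt_Suc)
    then have Hy: "H y = Some ?p" unfolding y H(2) by (simp del: upt_Suc)
    obtain h where h: "h \<in> L1 lambda0" "dens b \<in> h" using L1_class[OF integrable_dens[OF b]] .
    have "RN0 (enum_measure b) = Some h"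
      unfolding RN0_eq_Some_iff using enum_measure_dom[OF b] is_density_dens[OF b h] by blast
    then obtain q where q: "G ?p = Some q" "delta_lambda0 q = Some h"
      using G delta_M_fin_measure_bit[OF b] unfolding realizer_def by blast
    then obtain s f where s: "q = seq_name s" "f \<in> h"
      "\<And>i. (LINT x|lambda0. \<bar>step_fun alpha (s i) x - f x\<bar>) \<le> 1 / 2 ^ i"
      unfolding delta_lambda0_eq_Some_iff names_L1_def by blast
    \<comment> \<open>The name returned by \<open>G\<close> approximates some representative of the
      class \<open>h\<close>; it agrees with \<open>dens b\<close> almost everywhere, so the
      distances to the step functions are the same.\<close>
    have f: "integrable lambda0 f" "AE x in lambda0. f x = dens b x"
      using L1_mem[OF h(1) s(2)] h(2) by auto
    have "(LINT x|lambda0. \<bar>step_fun alpha (s i) x - dens b x\<bar>) = (LINT x|lambda0. \<bar>step_fun alpha (s i) x - f x\<bar>)" for i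
      using f integrable_step_fun[of "s i"] by (intro integral_cong_AE) auto
    then have "1 / 2 ^ (n + 3) < step_dev (s (n + 4)) n \<longleftrightarrow> (\<exists>j. b j = Suc n)" for n
      using s(3)[of "n + 4"] by (intro step_dev_decides[OF b]) simp
    then have "Cf (\<lambda>k. if 1 / 2 ^ (k + 3) < step_dev (s (k + 4)) k then 1 else 0 :: 's) = Some Z"
      unfolding Cf_def Z b_def by simp
    moreover have "(K \<circ>\<^sub>m G \<circ>\<^sub>m H) y = Some (\<lambda>k. if 1 / 2 ^ (k + 3) < step_dev (s (k + 4)) k then 1 else 0)"
      unfolding map_comp_def using Hy q(1) s(1) K' by simp
    ultimately show "\<exists>q. (K \<circ>\<^sub>m G \<circ>\<^sub>m H) y = Some q \<and> Cf q = Some Z" by blast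
  qed
  then show ?thesis unfolding sW_reducible_def using H(1) K(1) by blast
qed

end
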